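(* There is a constant $c$ such that the following holds for all $t>0$ and $x\in\mathcal S_0$. If $f$ is a bounded Borel function on $\mathcal S_0$, then for $j\in N_R$ $$\Big|\frac{\partial}{\partial x_j}P_tf(x)\Big|\le\frac{c\|f\|_\infty}{\sqrt t\,\max_{i\in C_j}\{\sqrt{t+x_i}\}}\qquad\text{and}\qquad\Big|\max_{i\in C_j}\{x_i\}\frac{\partial^2}{\partial x_j^2}P_tf(x)\Big|\le\frac{c\|f\|_\infty}{t}.$$ If $f\in\mathcal S^\alpha$, then for $j\in N_R$ $$\Big|\frac{\partial}{\partial x_j}P_tf(x)\Big|\le\frac{c|f|_\alpha t^{\frac\alpha2-\frac12}}{\max_{i\in C_j}\{\sqrt{t+x_i}\}}\le c|f|_\alpha t^{\frac\alpha2-1}\qquad\text{and}\qquad\Big|\max_{i\in C_j}\{x_i\}\frac{\partial^2}{\partial x_j^2}P_tf(x)\Big|\le c|f|_\alpha t^{\frac\alpha2-1}.$$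
   Context: Network. $V=\{1,\dots,d\}$; $\mathcal E\subset V\times V$ is a set of directed edges with $(i,i)\notin\mathcal E$ for all $i$. $C$ (resp. $R$) is the set of vertices appearing as first (resp. second) element of an edge; $C_j=\{i:(i,j)\in\mathcal E\}$, $R_i=\{j:(i,j)\in\mathcal E\}$. $\mathcal S=\{x\in\mathbb R_+^d:\prod_{j\in R}(\sum_{i\in C_j}x_i+x_j)>0\}$. Fix $x^0\in\mathcal S$ and set $Z=\{i\in V:x_i^0=0\}$, $N_R=\{j\in R:\sum_{i\in C_j}x_i^0=0\}$, $N_C=\bigcup_{j\in N_R}C_j$, $N_2=V\setminus(N_R\cup N_C)$, $N_{C2}=N_C\cup N_2$. Then $V=N_R\cup N_C\cup N_2$ is a disjoint union and $N_R\cap Z=\emptyset$. Coefficients. $b_j^0\in\mathbb R$ and $\gamma_j^0$ ($j\in V$) are constants with $\gamma_j^0>0$ for all $j$, $b_j^0\ge0$ if $j\notin N_R$, and $b_j^0>0$ if $j\in(R\cup C)\cap Z$. Semigroup. $\mathcal S_0=\{x\in\mathbb R^d:x_i\ge0\text{ for all }i\in N_{C2}\}$. For $i\in N_{C2}$ let $P^i_{x_i}$ be the law on $\mathcal C(\mathbb R_+,\mathbb R_+)$ of the Feller branching immigration process $x^{(i)}$ started at $x_i$ with generator $b_i^0\frac{\partial}{\partial x}+\gamma_i^0x\frac{\partial^2}{\partial x^2}$, let $E^{N_{C2}}$ be expectation under $\bigotimes_{i\in N_{C2}}P^i_{x_i}$, and for $j\in N_R$ let $I_t^{(j)}=\int_0^t\sum_{i\in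 C_j}x_s^{(i)}ds$. With $p_y(z)=(2\pi y)^{-1/2}e^{-z^2/(2y)}$, for bounded Borel $f$ on $\mathcal S_0$ and $t>0$, $$P_tf(x)=E^{N_{C2}}\Big[\int_{\mathbb R^{|N_R|}}f\big(\{z_j\}_{j\in N_R},\{x_t^{(i)}\}_{i\in N_{C2}}\big)\prod_{j\in N_R}p_{2\gamma_j^0I_t^{(j)}}(z_j-x_j-b_j^0t)\,dz_j\Big].$$ This is the semigroup with generator $\mathcal A^0=\sum_{j\in V}b_j^0\frac{\partial}{\partial x_j}+\sum_{j\in N_R}\gamma_j^0(\sum_{i\in C_j}x_i)\frac{\partial^2}{\partial x_j^2}+\sum_{i\in N_{C2}}\gamma_i^0x_i\frac{\partial^2}{\partial x_i^2}$. Norms. $\alpha\in(0,1)$ is fixed, $\|f\|_\infty$ is the supremum norm, $|f|_\alpha=\sup_{t>0}t^{-\alpha/2}\|P_tf-f\|_\infty$, $\|f\|_\alpha=|f|_\alpha+\|f\|_\infty$, and $\mathcal S^\alpha=\{f:\mathcal S_0\to\mathbb R\text{ Borel}:\|f\|_\alpha<\infty\}$. Constants. With $M^0=\max_{i\in V}\{\gamma_i^0\vee(\gamma_i^0)^{-1}\vee|b_i^0|\}\vee\max_{i\in(R\cup C)\cap Z}(b_i^0)^{-1}<\infty$, the constant $c$ depends only on $\alpha$, $d$ and $M$, uniformly over all coefficients with $M^0\le M$. *)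

theory Defs
  imports "HOL-Probability.Probability"
begin

section \<open>Catalytic networks\<close>

text \<open>
  The vertex set is the universe of a finite type \<open>'v\<close>, so that \<open>d = CARD('v)\<close>;
  an edge \<open>(i, j)\<close> says that \<open>i\<close> catalyses \<open>j\<close>.
\<close>

definition network :: "('v \<times> 'v) set \<Rightarrow> bool" where
  "network E \<longleftrightarrow> (\<forall>i. (i, i) \<notin> E)"

definition catalysts :: "('v \<times> 'v) set \<Rightarrow> 'v set" where
  "catalysts E = fst ` E"

definition reactants :: "('v \<times> 'v) set \<Rightarrow> 'v set" where
  "reactants E = snd ` E"

definition cat_of :: "('v \<times> 'v) set \<Rightarrow> 'v \<Rightarrow> 'v set" where
  "cat_of E j = {i. (i, j) \<in> E}"

definition net_states :: "('v::finite \<times> 'v) set \<Rightarrow> (real ^ 'v) set" where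
  "net_states E =
     {x. (\<forall>i. 0 \<le> x $ i) \<and> (\<Prod>j\<in>reactants E. (\<Sum>i\<in>cat_of E j. x $ i) + x $ j) > 0}"

definition zero_set :: "real ^ 'v \<Rightarrow> 'v set" where
  "zero_set x0 = {i. x0 $ i = 0}"

definition NR :: "('v::finite \<times> 'v) set \<Rightarrow> real ^ 'v \<Rightarrow> 'v set" where
  "NR E x0 = {j \<in> reactants E. (\<Sum>i\<in>cat_of E j. x0 $ i) = 0}"

definition NC :: "('v::finite \<times> 'v) set \<Rightarrow> real ^ 'v \<Rightarrow> 'v set" where
  "NC E x0 = (\<Union>j\<in>NR E x0. cat_of E j)"

definition N2 :: "('v::finite \<times> 'v) set \<Rightarrow> real ^ 'v \<Rightarrow> 'v set" where
  "N2 E x0 = UNIV - (NR E x0 \<union> NC E x0)"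

definition NC2 :: "('v::finite \<times> 'v) set \<Rightarrow> real ^ 'v \<Rightarrow> 'v set" where
  "NC2 E x0 = NC E x0 \<union> N2 E x0"

definition S0 :: "('v::finite \<times> 'v) set \<Rightarrow> real ^ 'v \<Rightarrow> (real ^ 'v) set" where
  "S0 E x0 = {x. \<forall>i\<in>NC2 E x0. 0 \<le> x $ i}"

definition admissible_coeffs ::
  "('v::finite \<times> 'v) set \<Rightarrow> real ^ 'v \<Rightarrow> ('v \<Rightarrow> real) \<Rightarrow> ('v \<Rightarrow> real) \<Rightarrow> bool" where
  "admissible_coeffs E x0 b \<gamma> \<longleftrightarrow>
     (\<forall>j. 0 < \<gamma> j) \<and>
     (\<forall>j. j \<notin> NR E x0 \<longrightarrow> 0 \<le> b j) \<and>
     (\<forall>j \<in> (reactants E \<union> catalysts E) \<inter> zero_set x0. 0 < b j)"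

definition coeff_bound ::
  "('v::finite \<times> 'v) set \<Rightarrow> real ^ 'v \<Rightarrow> ('v \<Rightarrow> real) \<Rightarrow> ('v \<Rightarrow> real) \<Rightarrow> real" where
  "coeff_bound E x0 b \<gamma> =
     Max ((\<Union>i. {\<gamma> i, inverse (\<gamma> i), \<bar>b i\<bar>}) \<union>
          (\<lambda>i. inverse (b i)) ` ((reactants E \<union> catalysts E) \<inter> zero_set x0))"


section \<open>Feller branching processes with immigration\<close>

text \<open>
  Continuous paths from \<open>[0, \<infinity>)\<close> to \<open>[0, \<infinity>)\<close>, with the \<open>\<sigma>\<close>-algebra generated by the
  coordinate maps, which is the Borel \<open>\<sigma>\<close>-algebra of locally uniform convergence.
  Only the \<open>\<sigma>\<close>-algebra of this measure is used. As elements of a product space, paths are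
  \<open>undefined\<close> at negative times.
\<close>

definition path_space :: "(real \<Rightarrow> real) measure" where
  "path_space = restrict_space (\<Pi>\<^sub>M s\<in>{0..}. borel)
     {w. continuous_on {0..} w \<and> (\<forall>s\<ge>0. 0 \<le> w s)}"

definition path_filtration :: "real \<Rightarrow> (real \<Rightarrow> real) measure" where
  "path_filtration t =
     vimage_algebra (space path_space) (\<lambda>w. restrict w {0..t}) (\<Pi>\<^sub>M s\<in>{0..t}. borel)"

definition path_martingale ::
  "(real \<Rightarrow> real) measure \<Rightarrow> (real \<Rightarrow> (real \<Rightarrow> real) \<Rightarrow> real) \<Rightarrow> bool" where
  "path_martingale P X \<longleftrightarrow>
     (\<forall>t\<ge>0. X t \<in> borel_measurable (path_filtration t) \<and> integrable P (X t)) \<and>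
     (\<forall>s t. 0 \<le> s \<and> s \<le> t \<longrightarrow>
        (AE w in P. real_cond_exp P (path_filtration s) (X t) w = X s w))"

text \<open>
  \<open>(f, f', f'')\<close> is a bounded \<open>C\<^sup>2\<close> function on \<open>[0, \<infinity>)\<close> with its first two derivatives,
  which are bounded as well; derivatives at \<open>0\<close> are one-sided.
\<close>

definition C2b_nonneg :: "(real \<Rightarrow> real) \<Rightarrow> (real \<Rightarrow> real) \<Rightarrow> (real \<Rightarrow> real) \<Rightarrow> bool" where
  "C2b_nonneg f f' f'' \<longleftrightarrow>
     (\<forall>y\<ge>0. (f has_real_derivative f' y) (at y within {0..})) \<and>
     (\<forall>y\<ge>0. (f' has_real_derivative f'' y) (at y within {0..})) \<and>
     continuous_on {0..} f'' \<and>
     bounded (f ` {0..}) \<and> bounded (f' ` {0..}) \<and> bounded (f'' ` {0..})"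

text \<open>
  The law of the process started at \<open>y\<close> with generator \<open>b d/dx + \<gamma> x d\<^sup>2/dx\<^sup>2\<close>, i.e. the
  solution of the associated martingale problem, which is well posed for
  \<open>b \<ge> 0\<close>, \<open>\<gamma> > 0\<close>, \<open>y \<ge> 0\<close>. Since the solution has finite moments, the processes
  below are true martingales and not merely local ones.
\<close>

definition feller_law :: "real \<Rightarrow> real \<Rightarrow> real \<Rightarrow> (real \<Rightarrow> real) measure \<Rightarrow> bool" where
  "feller_law b \<gamma> y P \<longleftrightarrow>
     prob_space P \<and> sets P = sets path_space \<and>
     (AE w in P. w 0 = y) \<and>
     (\<forall>f f' f''. C2b_nonneg f f' f'' \<longrightarrow>
        path_martingale P
          (\<lambda>t w. f (w t) - f (w 0) -
             (LINT s:{0..t}|lborel. b * f' (w s) + \<gamma> * w s * f'' (w s))))"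


section \<open>The semigroup\<close>

definition gauss :: "real \<Rightarrow> real \<Rightarrow> real" where
  "gauss y z = (2 * pi * y) powr (- 1 / 2) * exp (- (z\<^sup>2) / (2 * y))"

definition cat_integral ::
  "('v \<times> 'v) set \<Rightarrow> 'v \<Rightarrow> real \<Rightarrow> ('v \<Rightarrow> real \<Rightarrow> real) \<Rightarrow> real" where
  "cat_integral E j t \<omega> = (LINT s:{0..t}|lborel. \<Sum>i\<in>cat_of E j. \<omega> i s)"

text \<open>
  \<open>P i y\<close> is the law of the \<open>i\<close>-th process started at \<open>y\<close>.
  A state is assembled from its \<open>NR\<close>-coordinates \<open>z\<close> and, at the vertices in \<open>NC2\<close>
  (the complement of \<open>NR\<close>), the paths \<open>\<omega>\<close> at time \<open>t\<close>.
\<close>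

definition Pt ::
  "('v::finite \<times> 'v) set \<Rightarrow> real ^ 'v \<Rightarrow> ('v \<Rightarrow> real) \<Rightarrow> ('v \<Rightarrow> real) \<Rightarrow>
   ('v \<Rightarrow> real \<Rightarrow> (real \<Rightarrow> real) measure) \<Rightarrow> real \<Rightarrow> (real ^ 'v \<Rightarrow> real) \<Rightarrow> real ^ 'v \<Rightarrow> real" where
  "Pt E x0 b \<gamma> P t f x =
     (\<integral>\<omega>. (\<integral>z. f (\<chi> k. if k \<in> NR E x0 then z k else \<omega> k t) *
              (\<Prod>j\<in>NR E x0. gauss (2 * \<gamma> j * cat_integral E j t \<omega>) (z j - x $ j - b j * t))
            \<partial>(\<Pi>\<^sub>M j\<in>NR E x0. lborel))
      \<partial>(\<Pi>\<^sub>M i\<in>NC2 E x0. P i (x $ i)))"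


section \<open>Norms\<close>

text \<open>
  The norms take values in \<open>[0, \<infinity>]\<close>, so that finiteness is meaningful.
\<close>

definition sup_norm :: "'a set \<Rightarrow> ('a \<Rightarrow> real) \<Rightarrow> ennreal" where
  "sup_norm S f = (SUP x\<in>S. ennreal \<bar>f x\<bar>)"

definition alpha_seminorm ::
  "('v::finite \<times> 'v) set \<Rightarrow> real ^ 'v \<Rightarrow> ('v \<Rightarrow> real) \<Rightarrow> ('v \<Rightarrow> real) \<Rightarrow>
   ('v \<Rightarrow> real \<Rightarrow> (real \<Rightarrow> real) measure) \<Rightarrow> real \<Rightarrow> (real ^ 'v \<Rightarrow> real) \<Rightarrow> ennreal" where
  "alpha_seminorm E x0 b \<gamma> P \<alpha> f =
     (SUP t\<in>{0<..}. ennreal (t powr (- \<alpha> / 2)) *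
        sup_norm (S0 E x0) (\<lambda>x. Pt E x0 b \<gamma> P t f x - f x))"

definition alpha_norm ::
  "('v::finite \<times> 'v) set \<Rightarrow> real ^ 'v \<Rightarrow> ('v \<Rightarrow> real) \<Rightarrow> ('v \<Rightarrow> real) \<Rightarrow>
   ('v \<Rightarrow> real \<Rightarrow> (real \<Rightarrow> real) measure) \<Rightarrow> real \<Rightarrow> (real ^ 'v \<Rightarrow> real) \<Rightarrow> ennreal" where
  "alpha_norm E x0 b \<gamma> P \<alpha> f = alpha_seminorm E x0 b \<gamma> P \<alpha> f + sup_norm (S0 E x0) f"

definition Salpha ::
  "('v::finite \<times> 'v) set \<Rightarrow> real ^ 'v \<Rightarrow> ('v \<Rightarrow> real) \<Rightarrow> ('v \<Rightarrow> real) \<Rightarrow>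
   ('v \<Rightarrow> real \<Rightarrow> (real \<Rightarrow> real) measure) \<Rightarrow> real \<Rightarrow> (real ^ 'v \<Rightarrow> real) set" where
  "Salpha E x0 b \<gamma> P \<alpha> =
     {f \<in> borel_measurable (restrict_space borel (S0 E x0)). alpha_norm E x0 b \<gamma> P \<alpha> f < \<infinity>}"


section \<open>Partial derivatives\<close>

definition partial_differentiable :: "'v::finite \<Rightarrow> (real ^ 'v \<Rightarrow> real) \<Rightarrow> real ^ 'v \<Rightarrow> bool" where
  "partial_differentiable j g x \<longleftrightarrow> (\<lambda>h. g (x + h *\<^sub>R axis j 1)) field_differentiable (at 0)"

definition partial :: "'v::finite \<Rightarrow> (real ^ 'v \<Rightarrow> real) \<Rightarrow> real ^ 'v \<Rightarrow> real" where
  "partial j g x = deriv (\<lambda>h. g (x + h *\<^sub>R axis j 1)) 0"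

end

theory Submission
  imports Defs "HOL-Real_Asymp.Real_Asymp"
begin

text \<open>
  Let \<open>I\<close> be the time integral up to \<open>t\<close> of a Feller process \<open>X\<close> started at \<open>y\<close>. Applying the
  martingale problem to \<open>exp (- u X)\<close>, with integrating factor \<open>exp (b u s - \<gamma> u\<^sup>2 I\<^sub>s)\<close>, gives
  \<open>E exp (- u X\<^sub>s - \<gamma> u\<^sup>2 I\<^sub>s) = exp (- u y - b u s)\<close>; averaging over \<open>s \<in> [t/2, t]\<close> removes \<open>X\<^sub>s\<close>, and
  integrating over \<open>u\<close> yields \<open>E (1 / I) \<le> C / (t (t + y))\<close>. Since \<open>P\<^sub>t f\<close> is, given the catalysts, a
  Gaussian convolution in the \<open>j\<close>-th coordinate with variance at least \<open>2 \<gamma>\<^sub>j I\<close>, the two derivatives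
  cost \<open>E I\<^bsup>-1/2\<^esup>\<close> and \<open>E I\<^bsup>-1\<^esup>\<close>, which settles the bounds in terms of the supremum norm.

  For the bounds in terms of the seminorm, let \<open>\<sigma>(h, X) = h\<^sup>2 / (h + X)\<close> and suppose that
  \<open>\<bar>f (x + h e\<^sub>j) - f x\<bar> \<le> D \<sigma>(\<bar>h\<bar>, x\<^sub>i)\<^bsup>\<alpha>/2\<^esup>\<close> for some \<open>i \<in> C\<^sub>j\<close>. Only the oscillation of \<open>f\<close> enters the
  derivatives of the convolution, so they improve by the factor \<open>D t\<^bsup>\<alpha>/2\<^esup>\<close>. Writing
  \<open>f = P\<^sub>s f + (f - P\<^sub>s f)\<close> with \<open>s = K \<sigma>(\<bar>h\<bar>, x\<^sub>i)\<close> and \<open>K\<close> large, the mean value theorem turns \<open>D\<close> into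
  \<open>C \<bar>f\<bar>\<^sub>\<alpha> + D / 2\<close>, so that \<open>D \<le> 2 C \<bar>f\<bar>\<^sub>\<alpha>\<close>. In this way neither uniqueness for the martingale
  problem nor the semigroup property is needed.
\<close>

section \<open>Path functionals\<close>

text \<open>The main obstacle is dependence. The oscillation of \<open>f\<close> is measured at the
  random final value \<open>X\<close> of the catalyst, whereas the estimates are in terms of its
  starting value \<open>x\<close>; when \<open>X\<close> is much smaller than \<open>x\<close>, the
  scale \<sigma> is too large, and \<open>X\<close> is not independent of the area that determines
  the variance. No joint law is computed. Instead the product of singular factor and oscillation is
  bounded path by path by a linear combination of 1, of \<open>t * (t + x)\<close> over the
  variance, and of the weight \<open>x / t\<close> on the event \<open>X < x / 2\<close>, so that
  three expectations suffice. The last one is bounded since a Chebyshev argument makes that event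
  have probability of order \<open>t / x\<close>. In the iteration, a waiting time longer by the
  factor \<open>K\<close> costs \<open>K powr (\<alpha> / 2)\<close> and gains
  \<open>sqrt K\<close>; this is where \<alpha> < 1 enters. All bounds are proved for each single
  catalyst of \<open>j\<close>, so a maximiser can be selected at the very end. A catalyst of a
  vertex in \<open>NR\<close> vanishes at \<open>x0\<close>, hence its immigration is at least
  \<open>1 / M\<close>, which keeps the inverse moment finite even when it starts at 0.\<close>

lemma borel_measurable_caratheodory:
  fixes F :: "'a \<Rightarrow> real \<Rightarrow> real"
  assumes m: "\<And>s. (\<lambda>w. F w s) \<in> borel_measurable M"
    and c: "\<And>w. w \<in> space M \<Longrightarrow> continuous_on UNIV (F w)"
  shows "(\<lambda>p. F (fst p) (snd p)) \<in> borel_measurable (M \<Otimes>\<^sub>M borel)"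
proof (rule borel_measurable_LIMSEQ_real)
  \<comment> \<open>Rounding the second argument down to the grid of mesh \<open>1 / Suc n\<close>
    leaves countably many values, so measurability at fixed times is enough; continuity of
    \<open>F w\<close> then gives the limit.\<close>
  let ?G = "\<lambda>n p. F (fst p) (of_int \<lfloor>real (Suc n) * snd p\<rfloor> / real (Suc n))"
  show "?G n \<in> borel_measurable (M \<Otimes>\<^sub>M borel)" for n
  proof (rule measurable_compose_countable[where g="\<lambda>p. \<lfloor>real (Suc n) * snd p\<rfloor>"
        and f="\<lambda>i p. F (fst p) (of_int i / real (Suc n))"])
    show "(\<lambda>p. F (fst p) (of_int i / real (Suc n))) \<in> borel_measurable (M \<Otimes>\<^sub>M borel)" for i
      by (rule measurable_compose[OF measurable_fst m])
  qed measurable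
  fix p assume p: "p \<in> space (M \<Otimes>\<^sub>M (borel :: real measure))"
  have fl: "x - inverse N \<le> of_int \<lfloor>N * x\<rfloor> / N" "of_int \<lfloor>N * x\<rfloor> / N \<le> x" if "0 < N" for N x :: real
  proof -
    have "N * x - 1 \<le> of_int \<lfloor>N * x\<rfloor>" "of_int \<lfloor>N * x\<rfloor> \<le> N * x" by linarith+
    then have "(N * x - 1) / N \<le> of_int \<lfloor>N * x\<rfloor> / N" "of_int \<lfloor>N * x\<rfloor> / N \<le> N * x / N"
      using that by (intro divide_right_mono; simp)+
    with that show "x - inverse N \<le> of_int \<lfloor>N * x\<rfloor> / N" "of_int \<lfloor>N * x\<rfloor> / N \<le> x"
      by (simp_all add: diff_divide_distrib inverse_eq_divide)
  qed
  have "(\<lambda>n. of_int \<lfloor>real (Suc n) * snd p\<rfloor> / real (Suc n)) \<longlonglongrightarrow> snd p"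
  proof (rule tendsto_sandwich[OF _ _ _ tendsto_const])
    show "(\<lambda>n. snd p - inverse (real (Suc n))) \<longlonglongrightarrow> snd p"
      using tendsto_diff[OF tendsto_const LIMSEQ_inverse_real_of_nat] by simp
    show "\<forall>\<^sub>F n in sequentially. snd p - inverse (real (Suc n)) \<le> of_int \<lfloor>real (Suc n) * snd p\<rfloor> / real (Suc n)"
      "\<forall>\<^sub>F n in sequentially. of_int \<lfloor>real (Suc n) * snd p\<rfloor> / real (Suc n) \<le> snd p"
      by (intro always_eventually allI fl of_nat_0_less_iff[THEN iffD2] zero_less_Suc)+
  qed
  moreover have "isCont (F (fst p)) (snd p)"
    using c[of "fst p"] p by (auto simp: space_pair_measure continuous_on_eq_continuous_at)
  ultimately show "(\<lambda>n. ?G n p) \<longlonglongrightarrow> F (fst p) (snd p)"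
    by (rule isCont_tendsto_compose[rotated])
qed

section \<open>The path space and adapted time integrals\<close>

lemma space_path_space:
  "space path_space = {w \<in> extensional {0..}. continuous_on {0..} w \<and> (\<forall>s\<ge>0. 0 \<le> w s)}"
  by (auto simp: path_space_def space_restrict_space space_PiM PiE_def)

lemma measurable_path_eval: "0 \<le> s \<Longrightarrow> (\<lambda>w. w s) \<in> borel_measurable path_space"
  unfolding path_space_def
  by (intro measurable_restrict_space1 measurable_component_singleton) auto

lemma space_path_filtration [simp]: "space (path_filtration t) = space path_space"
  by (simp add: path_filtration_def)

lemma measurable_restrict_path:
  "(\<lambda>w. restrict w {0..t}) \<in> path_space \<rightarrow>\<^sub>M (\<Pi>\<^sub>M s\<in>{0..t}. borel)"
  unfolding restrict_def
  by (intro measurable_PiM_single') (auto simp: measurable_path_eval)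

lemma sets_path_filtration_subset: "sets (path_filtration t) \<subseteq> sets path_space"
  unfolding path_filtration_def
  by (intro sets_image_in_sets measurable_restrict_path) auto

lemma measurable_path_eval_filtration:
  assumes "0 \<le> s" "s \<le> t"
  shows "(\<lambda>w. w s) \<in> borel_measurable (path_filtration t)"
proof -
  have "(\<lambda>w. restrict w {0..t}) \<in> path_filtration t \<rightarrow>\<^sub>M (\<Pi>\<^sub>M s\<in>{0..t}. borel)"
    unfolding path_filtration_def
    by (rule measurable_vimage_algebra1) (auto simp: space_PiM)
  from measurable_compose[OF this measurable_component_singleton[of s "{0..t}"]] assms
  show ?thesis by simp
qed

lemma measurable_filtration_path_space:
  "f \<in> borel_measurable (path_filtration t) \<Longrightarrow> f \<in> borel_measurable path_space"
  using sets_path_filtration_subset by (auto simp: measurable_def)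

definition path_int :: "(real \<Rightarrow> real) \<Rightarrow> real \<Rightarrow> (real \<Rightarrow> real) \<Rightarrow> real" where
  "path_int h t w = (LINT s:{0..t}|lborel. h (w s))"

abbreviation area :: "real \<Rightarrow> (real \<Rightarrow> real) \<Rightarrow> real" where
  "area \<equiv> path_int (\<lambda>x. x)"

lemma continuous_path_comp:
  assumes "w \<in> space path_space" "continuous_on {0..} h"
  shows "continuous_on {0..} (\<lambda>s. h (w s))"
  using assms continuous_on_compose2[of "{0..}" h "{0..}" w] by (auto simp: space_path_space)

text \<open>Paths carry no information at negative times, so time is clamped to the interval up to
  \<open>t\<close>. The result is continuous on the whole line, as
  \<open>borel_measurable_caratheodory\<close> demands, and unchanged where it is
  integrated.\<close>

lemma continuous_path_clamp:
  assumes "w \<in> space path_space" "continuous_on {0..} h"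
  shows "continuous_on UNIV (\<lambda>s. h (w (max 0 (min s t))))"
  by (rule continuous_on_compose2[OF continuous_path_comp[OF assms]]) (auto intro!: continuous_intros)

lemma measurable_path_int_filtration:
  assumes h: "continuous_on {0..} h" and "0 \<le> t" "t \<le> T"
  shows "path_int h t \<in> borel_measurable (path_filtration T)"
proof -
  \<comment> \<open>\<open>h\<close> is controlled only on the nonnegative half-line. Composing with
    \<open>max 0\<close> makes it Borel on the line and changes nothing along paths, which are
    nonnegative.\<close>
  have hm: "(\<lambda>x. h (max 0 x)) \<in> borel_measurable borel"
    by (intro borel_measurable_continuous_onI continuous_on_compose2[OF h]) (auto intro!: continuous_intros)
  have "(\<lambda>p. h (max 0 ((fst p) (max 0 (min (snd p) t))))) \<in> borel_measurable (path_filtration T \<Otimes>\<^sub>M borel)"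
  proof (rule measurable_compose[OF _ hm], rule borel_measurable_caratheodory)
    show "(\<lambda>w. w (max 0 (min s t))) \<in> borel_measurable (path_filtration T)" for s
      using assms by (intro measurable_path_eval_filtration) auto
  qed (use continuous_path_clamp[where h="\<lambda>x. x"] in simp)
  then have [measurable]: "(\<lambda>p. h (max 0 ((fst p) (max 0 (min (snd p) t))))) \<in> borel_measurable (path_filtration T \<Otimes>\<^sub>M lborel)"
    by (simp cong: measurable_cong_sets sets_pair_measure_cong)
  have "(\<lambda>w. LINT s|lborel. indicator {0..t} s *\<^sub>R h (max 0 (w (max 0 (min s t))))) \<in> borel_measurable (path_filtration T)"
    using lborel.borel_measurable_lebesgue_integral[of "\<lambda>w s. indicator {0..t} s *\<^sub>R h (max 0 (w (max 0 (min s t))))" "path_filtration T"]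
    by (simp add: split_beta')
  also have "?this \<longleftrightarrow> ?thesis"
  proof (rule measurable_cong)
    fix w assume "w \<in> space (path_filtration T)"
    then have "0 \<le> w s" if "0 \<le> s" for s using that by (auto simp: space_path_space)
    then show "(LINT s|lborel. indicator {0..t} s *\<^sub>R h (max 0 (w (max 0 (min s t))))) = path_int h t w"
      unfolding path_int_def set_lebesgue_integral_def
      by (intro Bochner_Integration.integral_cong refl) (auto simp: indicator_def max_def)
  qed
  finally show ?thesis .
qed

lemma path_int_has_derivative:
  assumes "w \<in> space path_space" "continuous_on {0..} h" "0 \<le> s" "s \<le> t"
  shows "((\<lambda>s. path_int h s w) has_real_derivative h (w s)) (at s within {0..t})"
proof -
  have c: "continuous_on {0..t} (\<lambda>s. h (w s))"
    by (rule continuous_on_subset[OF continuous_path_comp[OF assms(1,2)]]) auto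
  have d: "((\<lambda>s. integral {0..s} (\<lambda>s. h (w s))) has_real_derivative h (w s)) (at s within {0..t})"
    using assms by (intro integral_has_real_derivative c) auto
  moreover have "integral {0..s} (\<lambda>s. h (w s)) = path_int h s w" if "s \<in> {0..t}" for s
    unfolding path_int_def
    by (intro set_borel_integral_eq_integral(2)[symmetric] borel_integrable_atLeastAtMost')
       (rule continuous_on_subset[OF c], use that in auto)
  ultimately show ?thesis
    using assms by (intro has_field_derivative_transform_within[OF d zero_less_one]) simp_all
qed

lemma path_int_continuous:
  assumes "w \<in> space path_space" "continuous_on {0..} h"
  shows "continuous_on {0..} (\<lambda>s. path_int h s w)"
proof -
  have "continuous (at s within {0..}) (\<lambda>s. path_int h s w)" if "0 \<le> s" for s
  proof -
    have "continuous (at s within {0..s+1}) (\<lambda>s. path_int h s w)"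
      using path_int_has_derivative[OF assms that, of "s+1"] by (auto intro: DERIV_continuous)
    moreover have "at s within {0..s+1} = at s within {0..}"
      by (rule at_within_nhd[of _ "{..<s+1}"]) (auto simp: that)
    ultimately show ?thesis by simp
  qed
  then show ?thesis by (auto simp: continuous_on_eq_continuous_within)
qed

lemma path_int_integrable:
  fixes h :: "real \<Rightarrow> real"
  assumes "w \<in> space path_space" "continuous_on {0..} h" "0 \<le> a"
  shows "set_integrable lborel {a..t} (\<lambda>s. h (w s))"
proof (rule borel_integrable_atLeastAtMost')
  show "continuous_on {a..t} (\<lambda>s. h (w s))"
    by (rule continuous_on_subset[OF continuous_path_comp[OF assms(1,2)]]) (use assms in auto)
qed

lemma measurable_path_int: "continuous_on {0..} h \<Longrightarrow> 0 \<le> t \<Longrightarrow> path_int h t \<in> borel_measurable path_space"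
  by (rule measurable_filtration_path_space[OF measurable_path_int_filtration]) auto

lemma path_int_abs_le:
  assumes "w \<in> space path_space" "continuous_on {0..} h" "0 \<le> t" "\<And>x. 0 \<le> x \<Longrightarrow> \<bar>h x\<bar> \<le> K"
  shows "\<bar>path_int h t w\<bar> \<le> K * t"
proof -
  have i: "set_integrable lborel {0..t} (\<lambda>s. h (w s))"
    by (rule path_int_integrable[OF assms(1,2) order.refl])
  have w: "0 \<le> w s" if "0 \<le> s" for s using assms(1) that by (simp add: space_path_space)
  have "norm (path_int h t w) \<le> (LINT s:{0..t}|lborel. norm (h (w s)))"
    unfolding path_int_def by (rule set_integral_norm_bound[OF i])
  also have "\<dots> \<le> (LINT s:{0..t}|lborel. K)"
  proof (rule set_integral_mono[OF set_integrable_norm[OF i]])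
    show "set_integrable lborel {0..t} (\<lambda>s. K)"
      by (rule borel_integrable_atLeastAtMost') (rule continuous_on_const)
    show "norm (h (w s)) \<le> K" if "s \<in> {0..t}" for s using assms(4)[of "w s"] w that by simp
  qed
  also have "\<dots> = K * t" using assms(3) by (simp add: set_lebesgue_integral_def)
  finally show ?thesis by simp
qed

lemma path_int_0 [simp]: "path_int h 0 w = 0"
proof -
  have "AE s in lborel. indicator {0..0} s *\<^sub>R h (w s) = 0"
    using AE_lborel_singleton[of "0::real"] by eventually_elim simp
  then show ?thesis unfolding path_int_def set_lebesgue_integral_def by (rule integral_eq_zero_AE)
qed

lemma set_integral_subset_mono:
  fixes w :: "real \<Rightarrow> real"
  assumes "set_integrable lborel B w" "A \<subseteq> B" "A \<in> sets lborel" "\<And>x. x \<in> B \<Longrightarrow> 0 \<le> w x"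
  shows "(LINT s:A|lborel. w s) \<le> (LINT s:B|lborel. w s)"
  unfolding set_lebesgue_integral_def
proof (rule integral_mono)
  show "integrable lborel (\<lambda>s. indicator A s *\<^sub>R w s)" "integrable lborel (\<lambda>s. indicator B s *\<^sub>R w s)"
    using assms(1) set_integrable_subset[OF assms(1,3,2)] by (simp_all add: set_integrable_def)
qed (use assms in \<open>auto simp: indicator_def\<close>)

text \<open>The test functions put into the martingale problem. The generator multiplies
  \<open>exp (- u * y)\<close> by the affine function
  \<open>\<gamma> * u\<^sup>2 * y - b * u\<close>, whose time integral along a path involves nothing
  but \<open>area\<close>.\<close>

lemma C2b_nonneg_exp:
  assumes "0 \<le> u"
  shows "C2b_nonneg (\<lambda>y. exp (- u * y)) (\<lambda>y. - u * exp (- u * y)) (\<lambda>y. u\<^sup>2 * exp (- u * y))"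
proof -
  have *: "bounded ((\<lambda>y. c * exp (- u * y)) ` {0..})" for c
    using assms by (auto simp: bounded_iff abs_mult intro!: exI[of _ "\<bar>c\<bar>"] mult_left_le)
  have "((\<lambda>y. exp (- u * y)) has_real_derivative - u * exp (- u * y)) (at y within {0..})"
    "((\<lambda>y. - u * exp (- u * y)) has_real_derivative u\<^sup>2 * exp (- u * y)) (at y within {0..})" for y
    by (rule derivative_eq_intros refl | simp add: power2_eq_square)+
  moreover have "continuous_on {0..} (\<lambda>y. u\<^sup>2 * exp (- u * y))"
    by (intro continuous_intros)
  ultimately show ?thesis
    unfolding C2b_nonneg_def using *[of 1] *[of "-u"] *[of "u\<^sup>2"] by simp
qed

section \<open>Inverse moments of the integrated Feller process\<close>

locale feller =
  fixes b \<gamma> y :: real and P :: "(real \<Rightarrow> real) measure"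
  assumes law: "feller_law b \<gamma> y P"
    and b_nonneg: "0 \<le> b" and \<gamma>_pos: "0 < \<gamma>" and y_nonneg: "0 \<le> y"
begin

sublocale prob_space P using law by (simp add: feller_law_def)

lemma sets_P: "sets P = sets path_space"
  using law by (simp add: feller_law_def)

lemma space_P: "space P = space path_space"
  by (rule sets_eq_imp_space_eq[OF sets_P])

lemma measurable_P: "f \<in> borel_measurable path_space \<Longrightarrow> f \<in> borel_measurable P"
  using sets_P measurable_cong_sets by blast

lemma finite_measure_subalgebra_filtration: "finite_measure_subalgebra P (path_filtration t)"
  by standard (use sets_path_filtration_subset in \<open>auto simp: subalgebra_def space_P sets_P\<close>)

section \<open>The exponential martingale of a single process\<close>

definition gen :: "real \<Rightarrow> real \<Rightarrow> real" where
  "gen u x = b * (- u * exp (- u * x)) + \<gamma> * x * (u\<^sup>2 * exp (- u * x))"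

definition mart :: "real \<Rightarrow> real \<Rightarrow> (real \<Rightarrow> real) \<Rightarrow> real" where
  "mart u t w = exp (- u * w t) - exp (- u * w 0) - path_int (gen u) t w"

lemma path_martingale_mart:
  assumes "0 \<le> u" shows "path_martingale P (mart u)"
proof -
  have *: "\<forall>f f' f''. C2b_nonneg f f' f'' \<longrightarrow> path_martingale P
          (\<lambda>t w. f (w t) - f (w 0) -
             (LINT s:{0..t}|lborel. b * f' (w s) + \<gamma> * w s * f'' (w s)))"
    using law unfolding feller_law_def by (elim conjE)
  show ?thesis
    using *[THEN spec, THEN spec, THEN spec, THEN mp, OF C2b_nonneg_exp[OF assms]]
    unfolding mart_def[abs_def] gen_def path_int_def .
qed

lemma continuous_gen: "continuous_on A (gen u)"
  unfolding gen_def by (intro continuous_intros)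

text \<open>\<open>u * x * exp (- u * x) \<le> 1\<close> beats the linear growth of the diffusion
  coefficient. Hence \<open>mart\<close> is bounded on bounded time intervals by a constant
  independent of the path.\<close>

lemma gen_bound:
  assumes "0 \<le> u" "0 \<le> x"
  shows "\<bar>gen u x\<bar> \<le> u * (b + \<gamma>)"
proof -
  have "u * x \<le> exp (u * x)"
    using exp_ge_add_one_self[of "u * x"] by linarith
  then have *: "u * x * exp (- u * x) \<le> 1"
    by (simp add: exp_minus field_simps)
  have "u * \<gamma> * (u * x * exp (- u * x)) \<le> u * \<gamma> * 1"
    by (rule mult_left_mono[OF *]) (use assms \<gamma>_pos in auto)
  moreover have "u * b * exp (- u * x) \<le> u * b * 1"
    by (rule mult_left_mono) (use assms b_nonneg in auto)
  moreover have "0 \<le> u * b * exp (- u * x)" "0 \<le> u * \<gamma> * (u * x * exp (- u * x))"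
    using assms b_nonneg \<gamma>_pos by auto
  moreover have "gen u x = u * \<gamma> * (u * x * exp (- u * x)) - u * b * exp (- u * x)"
    by (simp add: gen_def power2_eq_square)
  ultimately show ?thesis by (simp add: distrib_left)
qed

lemma mart_bound:
  assumes "0 \<le> u" "w \<in> space path_space" "0 \<le> t"
  shows "\<bar>mart u t w\<bar> \<le> 1 + u * (b + \<gamma>) * t"
proof -
  have "\<bar>path_int (gen u) t w\<bar> \<le> u * (b + \<gamma>) * t"
    using assms by (intro path_int_abs_le continuous_gen gen_bound)
  moreover have "0 \<le> w t" "0 \<le> w 0" using assms by (auto simp: space_path_space)
  then have "exp (- u * w t) \<le> 1" "exp (- u * w 0) \<le> 1" using assms by auto
  moreover have "0 < exp (- u * w t)" "0 < exp (- u * w 0)" by auto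
  ultimately show ?thesis unfolding mart_def by linarith
qed

lemma mart_0: "mart u 0 w = 0" by (simp add: mart_def)

lemma integrable_mart:
  assumes "0 \<le> u" "0 \<le> t" shows "integrable P (mart u t)"
  by (rule path_martingale_mart[OF assms(1), unfolded path_martingale_def, THEN conjunct1, rule_format,
        THEN conjunct2, OF assms(2)])

lemma cond_exp_mart:
  assumes "0 \<le> u" "0 \<le> s" "s \<le> t"
  shows "AE w in P. real_cond_exp P (path_filtration s) (mart u t) w = mart u s w"
  by (rule path_martingale_mart[OF assms(1), unfolded path_martingale_def, THEN conjunct2, rule_format,
        OF conjI[OF assms(2,3)]])

text \<open>The conditional expectations enter the later arguments only in this form.
  \<open>Z\<close> may be unbounded: a product that is not integrable has Bochner integral 0 by
  convention.\<close>

lemma mart_increment: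
  assumes u: "0 \<le> u" and st: "0 \<le> s" "s \<le> t" and Z: "Z \<in> borel_measurable (path_filtration s)"
  shows "(\<integral>w. Z w * (mart u t w - mart u s w) \<partial>P) = 0"
proof (cases "integrable P (\<lambda>w. Z w * (mart u t w - mart u s w))")
  case True
  interpret F: finite_measure_subalgebra P "path_filtration s"
    by (rule finite_measure_subalgebra_filtration)
  have i: "integrable P (mart u t)" "integrable P (mart u s)"
    using integrable_mart u st by auto
  have "AE w in P. real_cond_exp P (path_filtration s) (\<lambda>w. mart u t w - mart u s w) w = 0"
    using F.real_cond_exp_diff[OF i] cond_exp_mart[OF u st] cond_exp_mart[OF u st(1) order.refl] by eventually_elim simp
  then have "(\<integral>w. Z w * real_cond_exp P (path_filtration s) (\<lambda>w. mart u t w - mart u s w) w \<partial>P) = 0"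
    by (intro integral_eq_zero_AE) auto
  then show ?thesis
    using F.real_cond_exp_intg(2)[OF True Z] i by simp
qed (rule not_integrable_integral_eq)

lemma expectation_mart: "0 \<le> u \<Longrightarrow> 0 \<le> t \<Longrightarrow> expectation (mart u t) = 0"
  using mart_increment[of u 0 t "\<lambda>_. 1"] by (simp add: mart_0)

lemma measurable_mart: "0 \<le> u \<Longrightarrow> 0 \<le> t \<Longrightarrow> mart u t \<in> borel_measurable P"
  by (rule borel_measurable_integrable[OF integrable_mart])

lemma AE_start: "AE w in P. w 0 = y"
  using law by (simp add: feller_law_def)

text \<open>\<open>gen_bound\<close> controls the drift uniformly in the path, so the Laplace
  transform moves at most at rate \<open>u * (b + \<gamma>)\<close>. Taken at \<open>u\<close> of
  order \<open>1 / y\<close>, this is the input for the lower tail estimate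
  \<open>prob_half_le\<close>.\<close>

lemma expectation_exp_diff:
  assumes "0 \<le> u" "0 \<le> t"
  shows "\<bar>expectation (\<lambda>w. exp (- u * w t)) - exp (- u * y)\<bar> \<le> u * (b + \<gamma>) * t"
proof -
  have [measurable]: "(\<lambda>w. w t) \<in> borel_measurable P" "(\<lambda>w. w 0) \<in> borel_measurable P"
    by (rule measurable_P, rule measurable_path_eval, use assms in simp)+
  have [measurable]: "path_int (gen u) t \<in> borel_measurable P"
    by (rule measurable_P, rule measurable_path_int) (use assms continuous_gen in auto)
  have nn: "0 \<le> w t" "0 \<le> w 0" if "w \<in> space P" for w using that assms by (auto simp: space_P space_path_space)
  have i1: "integrable P (\<lambda>w. exp (- u * w t))" "integrable P (\<lambda>w. exp (- u * w 0))"
    by (rule integrable_const_bound[where B=1]; use assms nn in auto)+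
  have bd: "\<bar>path_int (gen u) t w\<bar> \<le> u * (b + \<gamma>) * t" if "w \<in> space P" for w
    using assms that by (intro path_int_abs_le continuous_gen gen_bound) (auto simp: space_P)
  have i2: "integrable P (path_int (gen u) t)"
    by (rule integrable_const_bound[where B="u * (b + \<gamma>) * t"]) (use bd in auto)
  have "expectation (\<lambda>w. exp (- u * w 0)) = expectation (\<lambda>w. exp (- u * y))"
    using AE_start by (intro integral_cong_AE) auto
  then have "expectation (\<lambda>w. exp (- u * w 0)) = exp (- u * y)" by (simp add: prob_space)
  then have "expectation (\<lambda>w. exp (- u * w t)) - exp (- u * y) = expectation (path_int (gen u) t)"
    using expectation_mart[OF assms] i1 i2 unfolding mart_def by simp
  moreover have "expectation (\<lambda>w. \<bar>path_int (gen u) t w\<bar>) \<le> expectation (\<lambda>w. u * (b + \<gamma>) * t)"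
    by (rule integral_mono) (use bd i2 in auto)
  moreover have "\<bar>expectation (path_int (gen u) t)\<bar> \<le> expectation (\<lambda>w. \<bar>path_int (gen u) t w\<bar>)"
    by (rule integral_abs_bound)
  moreover have "expectation (\<lambda>w. u * (b + \<gamma>) * t) = u * (b + \<gamma>) * t"
    by (simp add: prob_space)
  ultimately show ?thesis by linarith
qed

section \<open>An integrating factor and the resulting Laplace identity\<close>

lemma mart_has_derivative:
  assumes "w \<in> space path_space" "0 \<le> s" "s \<le> t"
  shows "((\<lambda>s. path_int (gen u) s w) has_real_derivative gen u (w s)) (at s within {0..t})"
  by (rule path_int_has_derivative[OF assms(1) continuous_gen assms(2,3)])

text \<open>The exponential of minus the time integral of the multiplier by which the generator acts
  on \<open>exp (- u * x)\<close>. Thus \<open>disc u s w * gen u (w s)\<close> cancels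
  \<open>disc' u s w * exp (- u * w s)\<close>, and the discounted exponential keeps a constant
  expectation.\<close>

definition disc :: "real \<Rightarrow> real \<Rightarrow> (real \<Rightarrow> real) \<Rightarrow> real" where
  "disc u s w = exp (b * u * s - \<gamma> * u\<^sup>2 * area s w)"

definition disc' :: "real \<Rightarrow> real \<Rightarrow> (real \<Rightarrow> real) \<Rightarrow> real" where
  "disc' u s w = (b * u - \<gamma> * u\<^sup>2 * w s) * disc u s w"

lemma disc_has_derivative:
  assumes "w \<in> space path_space" "0 \<le> s" "s \<le> t"
  shows "((\<lambda>s. disc u s w) has_real_derivative disc' u s w) (at s within {0..t})"
proof -
  note d = path_int_has_derivative[OF assms(1) continuous_on_id assms(2,3)]
  show ?thesis
    unfolding disc_def disc'_def
    by (rule derivative_eq_intros refl d[unfolded id_def] | simp)+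
qed

lemma continuous_paths:
  assumes "w \<in> space path_space"
  shows "continuous_on {0..} w" "continuous_on {0..} (\<lambda>s. disc u s w)" "continuous_on {0..} (\<lambda>s. disc' u s w)"
    "continuous_on {0..} (\<lambda>s. mart u s w)"
proof -
  show *: "continuous_on {0..} w" using assms by (simp add: space_path_space)
  have 1: "continuous_on {0..} (\<lambda>s. area s w)"
    by (rule path_int_continuous[OF assms continuous_on_id])
  have 2: "continuous_on {0..} (\<lambda>s. path_int (gen u) s w)"
    by (rule path_int_continuous[OF assms continuous_gen])
  show 3: "continuous_on {0..} (\<lambda>s. disc u s w)"
    unfolding disc_def by (intro continuous_intros 1)
  show "continuous_on {0..} (\<lambda>s. disc' u s w)"
    unfolding disc'_def by (intro continuous_intros * 3)
  show "continuous_on {0..} (\<lambda>s. mart u s w)"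
    unfolding mart_def by (intro continuous_intros * 2)
qed

text \<open>Integration by parts of \<open>mart\<close> against a process of bounded variation,
  carried out path by path. The point is the shape of the remainder: a weight known at time
  \<open>s\<close> multiplies a later increment of the martingale, so its expectation will
  vanish.\<close>

lemma exp_disc_eq:
  assumes w: "w \<in> space path_space" and t: "0 \<le> t"
  shows "exp (- u * w t) * disc u t w = mart u t w + exp (- u * w 0)
           + (LINT s:{0..t}|lborel. disc' u s w * (mart u t w - mart u s w))"
proof -
  \<comment> \<open>The terminal value \<open>mart u t w\<close> is frozen in the antiderivative; at
    \<open>s = t\<close> the bracket collapses to \<open>exp (- u * w t)\<close>.\<close>
  let ?\<Phi> = "\<lambda>s. disc u s w * (mart u t w + exp (- u * w 0) + path_int (gen u) s w)"
  have "(LINT s:{0..t}|lborel. disc' u s w * (mart u t w - mart u s w)) = ?\<Phi> t - ?\<Phi> 0"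
    unfolding set_lebesgue_integral_def
  proof (rule integral_FTC_Icc[OF t])
    fix s assume s: "0 \<le> s" "s \<le> t"
    have "disc u s w * gen u (w s) = - (disc' u s w * exp (- u * w s))"
      by (simp add: gen_def disc'_def algebra_simps)
    then have eq: "disc' u s w * (mart u t w - mart u s w) =
        disc' u s w * (mart u t w + exp (- u * w 0) + path_int (gen u) s w) + disc u s w * gen u (w s)"
      by (simp add: mart_def[of u s] algebra_simps)
    have "(?\<Phi> has_real_derivative disc' u s w * (mart u t w - mart u s w)) (at s within {0..t})"
      unfolding eq
      by (rule derivative_eq_intros refl disc_has_derivative[OF w s] mart_has_derivative[OF w s] | simp)+
    then show "(?\<Phi> has_vector_derivative disc' u s w * (mart u t w - mart u s w)) (at s within {0..t})"
      by (simp add: has_real_derivative_iff_has_vector_derivative)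
  next
    show "continuous_on {0..t} (\<lambda>s. disc' u s w * (mart u t w - mart u s w))"
      by (rule continuous_on_subset[of "{0..}"]) (auto intro!: continuous_intros continuous_paths[OF w])
  qed
  moreover have "?\<Phi> t = exp (- u * w t) * disc u t w" by (simp add: mart_def)
  moreover have "?\<Phi> 0 = mart u t w + exp (- u * w 0)" by (simp add: disc_def)
  ultimately show ?thesis by linarith
qed

lemma measurable_disc:
  assumes "0 \<le> s" "s \<le> T"
  shows "disc u s \<in> borel_measurable (path_filtration T)" "disc' u s \<in> borel_measurable (path_filtration T)"
proof -
  have [measurable]: "area s \<in> borel_measurable (path_filtration T)"
    by (rule measurable_path_int_filtration[OF continuous_on_id[unfolded id_def] assms])
  have [measurable]: "(\<lambda>w. w s) \<in> borel_measurable (path_filtration T)"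
    by (rule measurable_path_eval_filtration[OF assms])
  show [measurable]: "disc u s \<in> borel_measurable (path_filtration T)" unfolding disc_def[abs_def] by measurable
  show "disc' u s \<in> borel_measurable (path_filtration T)" unfolding disc'_def[abs_def] by measurable
qed

text \<open>\<open>disc'\<close> is unbounded in the path, but its time integral is not: up to the
  factor \<open>exp (b * u * s)\<close>, the potential part is the derivative of
  \<open>- exp (- (\<gamma> * u\<^sup>2 * area s w))\<close>, which increases by at most 1. This is
  the domination needed for Fubini.\<close>

lemma set_integral_disc'_le:
  assumes w: "w \<in> space path_space" and t: "0 \<le> t" and u: "0 \<le> u"
  shows "(LINT s:{0..t}|lborel. \<bar>disc' u s w\<bar>) \<le> exp (b * u * t) * (b * u * t + 1)"
proof -
  let ?e = "\<lambda>s. exp (- (\<gamma> * u\<^sup>2 * area s w))"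
  let ?d = "\<lambda>s. \<gamma> * u\<^sup>2 * w s * ?e s"
  have nn: "0 \<le> w s" if "0 \<le> s" for s using w that by (simp add: space_path_space)
  have In: "0 \<le> area s w" for s
    unfolding path_int_def set_lebesgue_integral_def by (rule integral_nonneg_AE) (auto simp: nn indicator_def)
  have c: "continuous_on {0..t} (\<lambda>s. area s w)" "continuous_on {0..t} w"
    by (rule continuous_on_subset[OF path_int_continuous[OF w continuous_on_id[unfolded id_def]]], simp)
       (rule continuous_on_subset[OF continuous_paths(1)[OF w]], simp)
  have cd: "continuous_on {0..t} ?d" by (intro continuous_intros c)
  have ci: "continuous_on {0..t} (\<lambda>s. \<bar>disc' u s w\<bar>)"
    by (intro continuous_intros, rule continuous_on_subset[OF continuous_paths(3)[OF w]], simp)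
  have "(LINT s:{0..t}|lborel. ?d s) = - ?e t - (- ?e 0)"
    unfolding set_lebesgue_integral_def
  proof (rule integral_FTC_Icc[OF t _ cd])
    fix s assume s: "0 \<le> s" "s \<le> t"
    note d = path_int_has_derivative[OF w continuous_on_id s, unfolded id_def]
    have "((\<lambda>s. - ?e s) has_real_derivative ?d s) (at s within {0..t})"
      by (rule derivative_eq_intros refl d | simp)+
    then show "((\<lambda>s. - ?e s) has_vector_derivative ?d s) (at s within {0..t})"
      by (simp add: has_real_derivative_iff_has_vector_derivative)
  qed
  then have 1: "(LINT s:{0..t}|lborel. ?d s) \<le> 1" by simp
  have "(LINT s:{0..t}|lborel. \<bar>disc' u s w\<bar>) \<le> (LINT s:{0..t}|lborel. exp (b * u * t) * (b * u + ?d s))"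
  proof (rule set_integral_mono)
    show "set_integrable lborel {0..t} (\<lambda>s. \<bar>disc' u s w\<bar>)"
      by (rule borel_integrable_atLeastAtMost'[OF ci])
    show "set_integrable lborel {0..t} (\<lambda>s. exp (b * u * t) * (b * u + ?d s))"
      by (rule borel_integrable_atLeastAtMost') (intro continuous_intros c)
    fix s assume s: "s \<in> {0..t}"
    have "\<bar>b * u - \<gamma> * u\<^sup>2 * w s\<bar> \<le> b * u + \<gamma> * u\<^sup>2 * w s"
      using nn[of s] s b_nonneg \<gamma>_pos u by (simp add: abs_le_iff)
    then have "\<bar>disc' u s w\<bar> \<le> (b * u + \<gamma> * u\<^sup>2 * w s) * disc u s w"
      by (simp add: disc'_def abs_mult disc_def mult_right_mono)
    also have "disc u s w = exp (b * u * s) * ?e s" by (simp add: disc_def exp_diff exp_minus field_simps)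
    also have "(b * u + \<gamma> * u\<^sup>2 * w s) * (exp (b * u * s) * ?e s) = exp (b * u * s) * (b * u * ?e s + ?d s)"
      by (simp add: algebra_simps)
    also have "\<dots> \<le> exp (b * u * t) * (b * u + ?d s)"
    proof (rule mult_mono)
      show "exp (b * u * s) \<le> exp (b * u * t)" using s b_nonneg u by (simp add: mult_left_mono)
      show "b * u * ?e s + ?d s \<le> b * u + ?d s"
        using In[of s] b_nonneg \<gamma>_pos u by (simp add: mult_left_le)
      show "0 \<le> b * u * ?e s + ?d s" using nn[of s] s b_nonneg \<gamma>_pos u by simp
    qed simp
    finally show "\<bar>disc' u s w\<bar> \<le> exp (b * u * t) * (b * u + ?d s)" .
  qed
  also have "\<dots> = exp (b * u * t) * (b * u * t + (LINT s:{0..t}|lborel. ?d s))"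
  proof -
    have "(LINT s:{0..t}|lborel. b * u + ?d s) = (LINT s:{0..t}|lborel. b * u) + (LINT s:{0..t}|lborel. ?d s)"
      by (rule set_integral_add(2)) (rule borel_integrable_atLeastAtMost', intro continuous_intros c)+
    moreover have "(LINT s:{0..t}|lborel. b * u) = b * u * t"
      using t by (simp add: set_lebesgue_integral_def)
    ultimately show ?thesis by (subst set_integral_mult_right) simp
  qed
  also have "\<dots> \<le> exp (b * u * t) * (b * u * t + 1)"
    using 1 by (intro mult_left_mono add_left_mono) auto
  finally show ?thesis .
qed

text \<open>Continuity in \<open>s\<close> supplies joint measurability, and the bound
  \<open>K\<close> on the time integral of \<open>\<bar>F s w\<bar>\<close> supplies integrability.
  A pointwise bound would be out of reach for the weight \<open>disc'\<close>.\<close>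

lemma Fubini_set_integral:
  fixes F :: "real \<Rightarrow> (real \<Rightarrow> real) \<Rightarrow> real"
  assumes a: "0 \<le> a" "a \<le> t"
    and m: "\<And>s. 0 \<le> s \<Longrightarrow> s \<le> t \<Longrightarrow> F s \<in> borel_measurable P"
    and c: "\<And>w. w \<in> space path_space \<Longrightarrow> continuous_on {0..} (\<lambda>s. F s w)"
    and K: "\<And>w. w \<in> space path_space \<Longrightarrow> (LINT s:{a..t}|lborel. \<bar>F s w\<bar>) \<le> K"
  shows "integrable P (\<lambda>w. LINT s:{a..t}|lborel. F s w)"
    and "expectation (\<lambda>w. LINT s:{a..t}|lborel. F s w) = (LINT s:{a..t}|lborel. expectation (F s))"
    and "set_integrable lborel {a..t} (\<lambda>s. expectation (F s))"
proof -
  interpret pair_sigma_finite P lborel ..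
  define cl where "cl s = max 0 (min s t)" for s :: real
  have cl: "0 \<le> cl s" "cl s \<le> t" for s using a by (auto simp: cl_def)
  let ?G = "\<lambda>w s. indicator {a..t} s *\<^sub>R F (cl s) w"
  have G: "?G w s = indicator {a..t} s *\<^sub>R F s w" for s w
    using a by (auto simp: indicator_def cl_def)
  have "(\<lambda>p. F (cl (snd p)) (fst p)) \<in> borel_measurable (P \<Otimes>\<^sub>M borel)"
  proof (rule borel_measurable_caratheodory[OF m[OF cl]])
    fix w assume "w \<in> space P"
    then have w: "w \<in> space path_space" by (simp add: space_P)
    have "continuous_on UNIV cl" unfolding cl_def by (intro continuous_intros)
    moreover have "cl ` UNIV \<subseteq> {0..}" using cl by auto
    ultimately show "continuous_on UNIV (\<lambda>s. F (cl s) w)" by (rule continuous_on_compose2[OF c[OF w]])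
  qed
  then have [measurable]: "(\<lambda>p. F (cl (snd p)) (fst p)) \<in> borel_measurable (P \<Otimes>\<^sub>M lborel)"
    by (simp cong: measurable_cong_sets sets_pair_measure_cong)
  have mG: "(\<lambda>p. ?G (fst p) (snd p)) \<in> borel_measurable (P \<Otimes>\<^sub>M lborel)"
    by measurable
  have iG: "integrable lborel (?G w)" if "w \<in> space P" for w
  proof -
    have "continuous_on {a..t} (\<lambda>s. F s w)"
      using a by (intro continuous_on_subset[OF c]) (use that space_P in auto)
    from borel_integrable_atLeastAtMost'[OF this] show ?thesis unfolding G set_integrable_def .
  qed
  have nG: "(\<integral>s. norm (?G w s) \<partial>lborel) \<le> K" if "w \<in> space P" for w
    using K[of w] that unfolding G by (simp add: set_lebesgue_integral_def space_P abs_mult)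
  have "integrable (P \<Otimes>\<^sub>M lborel) (\<lambda>p. ?G (fst p) (snd p))"
  proof (rule Fubini_integrable[OF mG])
    show "AE w in P. integrable lborel (\<lambda>s. ?G (fst (w, s)) (snd (w, s)))"
      using iG by simp
    show "integrable P (\<lambda>w. \<integral>s. norm (?G (fst (w, s)) (snd (w, s))) \<partial>lborel)"
    proof (rule integrable_const_bound[where B=K])
      show "AE w in P. norm (\<integral>s. norm (?G (fst (w, s)) (snd (w, s))) \<partial>lborel) \<le> K"
        using nG by (intro AE_I2) simp
      show "(\<lambda>w. \<integral>s. norm (?G (fst (w, s)) (snd (w, s))) \<partial>lborel) \<in> borel_measurable P"
        using mG by (intro lborel.borel_measurable_lebesgue_integral) (simp add: split_beta')
    qed
  qed
  then have int: "integrable (P \<Otimes>\<^sub>M lborel) (case_prod ?G)" by (simp add: split_beta')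
  have E: "expectation (\<lambda>w. indicator {a..t} s *\<^sub>R F s w) = indicator {a..t} s *\<^sub>R expectation (F s)" for s
    by simp
  show "integrable P (\<lambda>w. LINT s:{a..t}|lborel. F s w)"
    using integrable_fst[OF int] unfolding set_lebesgue_integral_def G .
  show "set_integrable lborel {a..t} (\<lambda>s. expectation (F s))"
    using integrable_snd[OF int] unfolding set_integrable_def G E .
  show "expectation (\<lambda>w. LINT s:{a..t}|lborel. F s w) = (LINT s:{a..t}|lborel. expectation (F s))"
    using Fubini_integral[OF int] unfolding set_lebesgue_integral_def G E by simp
qed

lemma expectation_set_integral_disc':
  assumes t: "0 \<le> t" and u: "0 \<le> u"
  shows "integrable P (\<lambda>w. LINT s:{0..t}|lborel. disc' u s w * (mart u t w - mart u s w))"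
    and "expectation (\<lambda>w. LINT s:{0..t}|lborel. disc' u s w * (mart u t w - mart u s w)) = 0"
proof -
  let ?F = "\<lambda>s w. disc' u s w * (mart u t w - mart u s w)"
  define L where "L = 1 + u * (b + \<gamma>) * t"
  have L: "0 \<le> L" using u t b_nonneg \<gamma>_pos by (simp add: L_def)
  have m: "?F s \<in> borel_measurable P" if s: "0 \<le> s" "s \<le> t" for s
  proof -
    have [measurable]: "disc' u s \<in> borel_measurable P"
      by (rule measurable_P, rule measurable_filtration_path_space, rule measurable_disc(2)[OF s])
    have [measurable]: "mart u t \<in> borel_measurable P" "mart u s \<in> borel_measurable P"
      by (rule measurable_mart, use u t s in auto)+
    show ?thesis by measurable
  qed
  have c: "continuous_on {0..} (\<lambda>s. ?F s w)" if "w \<in> space path_space" for w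
    by (intro continuous_intros continuous_paths[OF that])
  have K: "(LINT s:{0..t}|lborel. \<bar>?F s w\<bar>) \<le> 2 * L * (exp (b * u * t) * (b * u * t + 1))"
    if w: "w \<in> space path_space" for w
  proof -
    have i: "set_integrable lborel {0..t} (\<lambda>s. \<bar>g s\<bar>)" if "continuous_on {0..} g" for g :: "real \<Rightarrow> real"
      by (intro borel_integrable_atLeastAtMost' continuous_intros continuous_on_subset[OF that]) simp
    have "(LINT s:{0..t}|lborel. \<bar>?F s w\<bar>) \<le> (LINT s:{0..t}|lborel. 2 * L * \<bar>disc' u s w\<bar>)"
    proof (rule set_integral_mono[OF i[OF c[OF w]] set_integrable_mult_right[OF i[OF continuous_paths(3)[OF w]]]])
      fix s assume s: "s \<in> {0..t}"
      then have "u * (b + \<gamma>) * s \<le> u * (b + \<gamma>) * t"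
        using u b_nonneg \<gamma>_pos by (intro mult_left_mono) auto
      then have "\<bar>mart u s w\<bar> \<le> L"
        using s mart_bound[OF u w, of s] unfolding L_def by auto
      moreover have "\<bar>mart u t w\<bar> \<le> L" unfolding L_def by (rule mart_bound[OF u w t])
      ultimately have "\<bar>mart u t w - mart u s w\<bar> \<le> 2 * L" by linarith
      then have "\<bar>mart u t w - mart u s w\<bar> * \<bar>disc' u s w\<bar> \<le> 2 * L * \<bar>disc' u s w\<bar>"
        by (rule mult_right_mono) simp
      then show "\<bar>?F s w\<bar> \<le> 2 * L * \<bar>disc' u s w\<bar>" by (simp add: abs_mult mult.commute)
    qed
    also have "\<dots> = 2 * L * (LINT s:{0..t}|lborel. \<bar>disc' u s w\<bar>)" by simp
    also have "\<dots> \<le> 2 * L * (exp (b * u * t) * (b * u * t + 1))"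
      using L by (intro mult_left_mono set_integral_disc'_le[OF w t u]) auto
    finally show ?thesis .
  qed
  note F = Fubini_set_integral[OF order.refl t m c K]
  show "integrable P (\<lambda>w. LINT s:{0..t}|lborel. ?F s w)" by (rule F(1))
  have "expectation (\<lambda>w. LINT s:{0..t}|lborel. ?F s w) = (LINT s:{0..t}|lborel. expectation (?F s))" by (rule F(2))
  also have "\<dots> = 0"
    unfolding set_lebesgue_integral_def
    by (rule integral_eq_zero_AE) (auto simp: indicator_def intro!: mart_increment[OF u] measurable_disc)
  finally show "expectation (\<lambda>w. LINT s:{0..t}|lborel. ?F s w) = 0" .
qed

text \<open>A Feynman-Kac identity. For a general potential the exponent would solve a Riccati
  equation; \<open>\<gamma> * u\<^sup>2 * x\<close> is the potential for which the constant
  \<open>u\<close> is a stationary solution, so the answer is explicit. In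
  \<open>exp_disc_eq\<close> every term but the initial one has expectation 0.\<close>

lemma expectation_exp_disc:
  assumes t: "0 \<le> t" and u: "0 \<le> u"
  shows "expectation (\<lambda>w. exp (- u * w t) * disc u t w) = exp (- u * y)"
proof -
  have [measurable]: "(\<lambda>w. w 0) \<in> borel_measurable P"
    by (rule measurable_P, rule measurable_path_eval, simp)
  have nn: "0 \<le> w 0" if "w \<in> space P" for w using that by (simp add: space_P space_path_space)
  have i1: "integrable P (\<lambda>w. exp (- u * w 0))"
    by (rule integrable_const_bound[where B=1]; use u nn in auto)
  have "expectation (\<lambda>w. exp (- u * w 0)) = expectation (\<lambda>w. exp (- u * y))"
    using AE_start by (intro integral_cong_AE) auto
  then have e0: "expectation (\<lambda>w. exp (- u * w 0)) = exp (- u * y)" by (simp add: prob_space)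
  have "expectation (\<lambda>w. exp (- u * w t) * disc u t w) = expectation (\<lambda>w. mart u t w + exp (- u * w 0)
           + (LINT s:{0..t}|lborel. disc' u s w * (mart u t w - mart u s w)))"
    by (rule Bochner_Integration.integral_cong[OF refl exp_disc_eq]) (use t space_P in auto)
  also have "\<dots> = exp (- u * y)"
    using expectation_set_integral_disc'[OF t u] integrable_mart[OF u t] expectation_mart[OF u t] i1 e0 by simp
  finally show ?thesis .
qed

section \<open>Laplace bound, positivity and inverse moment of the area\<close>

lemma area_nonneg:
  assumes "w \<in> space path_space"
  shows "0 \<le> area s w"
proof -
  have "0 \<le> w r" if "0 \<le> r" for r using assms that by (simp add: space_path_space)
  then show ?thesis
    unfolding path_int_def set_lebesgue_integral_def by (intro integral_nonneg_AE) (auto simp: indicator_def)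
qed

lemma area_mono:
  assumes "w \<in> space path_space" "0 \<le> s" "s \<le> t"
  shows "area s w \<le> area t w"
proof -
  have "0 \<le> w r" if "0 \<le> r" for r using assms that by (simp add: space_path_space)
  moreover have "set_integrable lborel {0..r} w" for r
    by (rule path_int_integrable[OF assms(1) continuous_on_id order.refl, unfolded id_def])
  ultimately show ?thesis
    unfolding path_int_def using assms by (intro set_integral_subset_mono) auto
qed

lemma measurable_area: "0 \<le> t \<Longrightarrow> area t \<in> borel_measurable P"
  by (rule measurable_P, rule measurable_path_int[OF continuous_on_id[unfolded id_def]])

lemma exp_path_int_le_1:
  assumes "w \<in> space path_space" "0 < t" "0 \<le> u"
  shows "exp (- (\<gamma> * u\<^sup>2 + 2 * u / t) * area t w) \<le> 1"
proof -
  have "0 \<le> (\<gamma> * u\<^sup>2 + 2 * u / t) * area t w"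
    using assms area_nonneg[OF assms(1)] \<gamma>_pos by (intro mult_nonneg_nonneg add_nonneg_nonneg) auto
  then show ?thesis by (simp only: exp_le_one_iff mult_minus_left neg_le_0_iff_le)
qed

lemma integrable_exp_path_int:
  assumes "0 < t" "0 \<le> u"
  shows "integrable P (\<lambda>w. exp (- (\<gamma> * u\<^sup>2 + 2 * u / t) * area t w))"
proof (rule integrable_const_bound[where B=1])
  have [measurable]: "area t \<in> borel_measurable P"
    by (rule measurable_area) (use assms in simp)
  show "(\<lambda>w. exp (- (\<gamma> * u\<^sup>2 + 2 * u / t) * area t w)) \<in> borel_measurable P"
    by measurable
qed (use exp_path_int_le_1[OF _ assms] space_P in \<open>auto intro!: AE_I2\<close>)

text \<open>
  The terminal factor in the exponential martingale is removed by averaging over \<open>[t/2, t]\<close> and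
  using that \<open>\<lambda>z. exp (- z)\<close> lies above its tangents.
\<close>

lemma exp_path_int_le_average:
  assumes w: "w \<in> space path_space" and t: "0 < t" and u: "0 \<le> u"
  shows "exp (- (\<gamma> * u\<^sup>2 + 2 * u / t) * area t w)
    \<le> 2 / t * (LINT s:{t/2..t}|lborel. exp (- u * w s) * exp (- \<gamma> * u\<^sup>2 * area s w))"
proof -
  let ?I = "\<lambda>s. area s w"
  \<comment> \<open>The window has length \<open>t / 2\<close>, so \<open>m\<close> dominates the
    average of \<open>u * w s\<close> over it. The tangent to the exponential is taken at this
    path-dependent level, which replaces the terminal factor by \<open>exp (- m)\<close>, a function
    of \<open>area t w\<close>.\<close>
  define m where "m = 2 * u / t * ?I t"
  have nn: "0 \<le> w s" if "0 \<le> s" for s using w that by (simp add: space_path_space)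
  have cw: "continuous_on {t/2..t} w" and cI: "continuous_on {t/2..t} ?I"
    by (rule continuous_on_subset[OF continuous_paths(1)[OF w]], use t in simp)
       (rule continuous_on_subset[OF path_int_continuous[OF w continuous_on_id[unfolded id_def]]], use t in simp)
  have iw: "set_integrable lborel {r..t} w" if "0 \<le> r" for r
    by (rule path_int_integrable[OF w continuous_on_id that, unfolded id_def])
  have "(LINT s:{t/2..t}|lborel. w s) \<le> ?I t"
    unfolding path_int_def using t nn by (intro set_integral_subset_mono iw) auto
  then have "u * (LINT s:{t/2..t}|lborel. w s) \<le> t / 2 * m"
    using u t by (simp add: m_def mult_left_mono)
  then have "t / 2 * exp (- m) \<le> exp (- m) * (t / 2 * (1 + m) - u * (LINT s:{t/2..t}|lborel. w s))"
    using t mult_left_mono[of "t / 2" "t / 2 * (1 + m) - u * (LINT s:{t/2..t}|lborel. w s)" "exp (- m)"]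
    by (simp add: algebra_simps)
  also have "\<dots> = exp (- m) * (LINT s:{t/2..t}|lborel. (1 + m) - u * w s)"
  proof -
    have "(LINT s:{t/2..t}|lborel. (1 + m) - u * w s) = (LINT s:{t/2..t}|lborel. 1 + m) - (LINT s:{t/2..t}|lborel. u * w s)"
      by (rule set_integral_diff(2)) (rule borel_integrable_atLeastAtMost', intro continuous_intros cw)+
    moreover have "(LINT s:{t/2..t}|lborel. 1 + m) = t / 2 * (1 + m)"
      using t by (simp add: set_lebesgue_integral_def)
    ultimately show ?thesis by simp
  qed
  also have "\<dots> = (LINT s:{t/2..t}|lborel. exp (- m) * ((1 + m) - u * w s))" by simp
  finally have 1: "t / 2 * exp (- m) \<le> (LINT s:{t/2..t}|lborel. exp (- m) * ((1 + m) - u * w s))" .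
  have "exp (- \<gamma> * u\<^sup>2 * ?I t) * (t / 2 * exp (- m)) \<le>
      exp (- \<gamma> * u\<^sup>2 * ?I t) * (LINT s:{t/2..t}|lborel. exp (- m) * ((1 + m) - u * w s))"
    by (rule mult_left_mono[OF 1]) simp
  also have "\<dots> = (LINT s:{t/2..t}|lborel. exp (- \<gamma> * u\<^sup>2 * ?I t) * (exp (- m) * ((1 + m) - u * w s)))"
    by simp
  also have "\<dots> \<le> (LINT s:{t/2..t}|lborel. exp (- u * w s) * exp (- \<gamma> * u\<^sup>2 * ?I s))"
  proof (rule set_integral_mono)
    show "set_integrable lborel {t/2..t} (\<lambda>s. exp (- \<gamma> * u\<^sup>2 * ?I t) * (exp (- m) * ((1 + m) - u * w s)))"
      by (rule borel_integrable_atLeastAtMost') (intro continuous_intros cw)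
    show "set_integrable lborel {t/2..t} (\<lambda>s. exp (- u * w s) * exp (- \<gamma> * u\<^sup>2 * ?I s))"
      by (rule borel_integrable_atLeastAtMost') (intro continuous_intros cw cI)
    fix s assume s: "s \<in> {t/2..t}"
    have "?I s \<le> ?I t" by (rule area_mono[OF w]) (use s t in auto)
    then have e1: "exp (- \<gamma> * u\<^sup>2 * ?I t) \<le> exp (- \<gamma> * u\<^sup>2 * ?I s)"
      using \<gamma>_pos by (simp add: mult_left_mono)
    have e2: "exp (- m) * ((1 + m) - u * w s) \<le> exp (- u * w s)"
    proof -
      have "1 + (m - u * w s) \<le> exp (m - u * w s)" by (rule exp_ge_add_one_self)
      then have "exp (- m) * (1 + (m - u * w s)) \<le> exp (- m) * exp (m - u * w s)" by simp
      also have "\<dots> = exp (- u * w s)" by (simp add: exp_add[symmetric])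
      finally show ?thesis by (simp add: algebra_simps)
    qed
    have "exp (- \<gamma> * u\<^sup>2 * ?I t) * (exp (- m) * ((1 + m) - u * w s)) \<le> exp (- \<gamma> * u\<^sup>2 * ?I t) * exp (- u * w s)"
      by (rule mult_left_mono[OF e2]) simp
    also have "\<dots> \<le> exp (- \<gamma> * u\<^sup>2 * ?I s) * exp (- u * w s)"
      by (rule mult_right_mono[OF e1]) simp
    finally show "exp (- \<gamma> * u\<^sup>2 * ?I t) * (exp (- m) * ((1 + m) - u * w s)) \<le> exp (- u * w s) * exp (- \<gamma> * u\<^sup>2 * ?I s)"
      by (simp only: mult.commute)
  qed
  finally have "2 / t * (exp (- \<gamma> * u\<^sup>2 * ?I t) * (t / 2 * exp (- m))) \<le> 2 / t * (LINT s:{t/2..t}|lborel. exp (- u * w s) * exp (- \<gamma> * u\<^sup>2 * ?I s))"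
    using t by (intro mult_left_mono) auto
  moreover have "2 / t * (exp (- \<gamma> * u\<^sup>2 * ?I t) * (t / 2 * exp (- m))) = exp (- (\<gamma> * u\<^sup>2 + 2 * u / t) * ?I t)"
    using t by (simp add: m_def exp_add[symmetric] algebra_simps)
  ultimately show ?thesis by simp
qed

lemma expectation_exp_exp:
  assumes "0 \<le> u" "0 \<le> s"
  shows "expectation (\<lambda>w. exp (- u * w s) * exp (- \<gamma> * u\<^sup>2 * area s w)) = exp (- u * y - b * u * s)"
proof -
  have "exp (- u * y) = expectation (\<lambda>w. exp (b * u * s) * (exp (- u * w s) * exp (- \<gamma> * u\<^sup>2 * area s w)))"
    unfolding expectation_exp_disc[OF assms(2,1), symmetric]
    by (rule Bochner_Integration.integral_cong) (simp_all add: disc_def exp_add[symmetric])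
  then have *: "exp (- u * y) = exp (b * u * s) * expectation (\<lambda>w. exp (- u * w s) * exp (- \<gamma> * u\<^sup>2 * area s w))"
    by simp
  have "exp (- u * y - b * u * s) = exp (- u * y) / exp (b * u * s)" by (rule exp_diff)
  then show ?thesis unfolding * by simp
qed

text \<open>The average starts at \<open>t / 2\<close> rather than at 0 so that immigration
  contributes at least \<open>b * t / 2\<close> to the exponent; for \<open>b > 0\<close> this gives
  decay in \<open>u\<close> even when \<open>y = 0\<close>.\<close>

lemma laplace_path_int_le:
  assumes t: "0 < t" and u: "0 \<le> u"
  shows "expectation (\<lambda>w. exp (- (\<gamma> * u\<^sup>2 + 2 * u / t) * area t w)) \<le> exp (- u * (y + b * t / 2))"
proof -
  let ?h = "\<lambda>s w. exp (- u * w s) * exp (- \<gamma> * u\<^sup>2 * area s w)"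
  have m: "?h s \<in> borel_measurable P" if "0 \<le> s" for s
  proof -
    have [measurable]: "(\<lambda>w. w s) \<in> borel_measurable P" "area s \<in> borel_measurable P"
      by (rule measurable_P, rule measurable_path_eval[OF that], rule measurable_area[OF that])
    show ?thesis by measurable
  qed
  have c: "continuous_on {0..} (\<lambda>s. ?h s w)" if "w \<in> space path_space" for w
    by (intro continuous_intros continuous_paths[OF that] path_int_continuous[OF that continuous_on_id[unfolded id_def]])
  have K: "(LINT s:{t/2..t}|lborel. \<bar>?h s w\<bar>) \<le> t / 2" if w: "w \<in> space path_space" for w
  proof -
    have "(LINT s:{t/2..t}|lborel. \<bar>?h s w\<bar>) \<le> (LINT s:{t/2..t}|lborel. 1)"
    proof (rule set_integral_mono)
      show "set_integrable lborel {t/2..t} (\<lambda>s. \<bar>?h s w\<bar>)"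
        using t by (intro borel_integrable_atLeastAtMost' continuous_on_subset[OF continuous_on_rabs[OF c[OF w]]]) auto
      show "set_integrable lborel {t/2..t} (\<lambda>s. 1 :: real)"
        by (rule borel_integrable_atLeastAtMost') (rule continuous_on_const)
      fix s assume "s \<in> {t/2..t}"
      then have "0 \<le> w s" using w t by (simp add: space_path_space)
      then show "\<bar>?h s w\<bar> \<le> 1"
        using area_nonneg[OF w, of s] u \<gamma>_pos by (auto simp: abs_mult intro!: mult_le_one)
    qed
    also have "\<dots> = t / 2" using t by (simp add: set_lebesgue_integral_def)
    finally show ?thesis .
  qed
  have t2: "0 \<le> t / 2" "t / 2 \<le> t" using t by auto
  note F = Fubini_set_integral[OF t2 m c K]
  have "expectation (\<lambda>w. LINT s:{t/2..t}|lborel. ?h s w) = (LINT s:{t/2..t}|lborel. expectation (?h s))"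
    by (rule F(2))
  also have "\<dots> \<le> (LINT s:{t/2..t}|lborel. exp (- u * (y + b * t / 2)))"
  proof (rule set_integral_mono)
    show "set_integrable lborel {t/2..t} (\<lambda>s. expectation (?h s))" by (rule F(3))
    show "set_integrable lborel {t/2..t} (\<lambda>s. exp (- u * (y + b * t / 2)))"
      by (rule borel_integrable_atLeastAtMost') (rule continuous_on_const)
    fix s assume s: "s \<in> {t/2..t}"
    then have "u * b * (t / 2) \<le> u * b * s" using u b_nonneg by (intro mult_left_mono) auto
    then show "expectation (?h s) \<le> exp (- u * (y + b * t / 2))"
      using expectation_exp_exp[OF u, of s] s t by (simp add: algebra_simps)
  qed
  also have "\<dots> = t / 2 * exp (- u * (y + b * t / 2))" using t by (simp add: set_lebesgue_integral_def)
  finally have le: "expectation (\<lambda>w. LINT s:{t/2..t}|lborel. ?h s w) \<le> t / 2 * exp (- u * (y + b * t / 2))" .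
  have i: "integrable P (\<lambda>w. LINT s:{t/2..t}|lborel. ?h s w)" by (rule F(1))
  have "expectation (\<lambda>w. exp (- (\<gamma> * u\<^sup>2 + 2 * u / t) * area t w))
    \<le> expectation (\<lambda>w. 2 / t * (LINT s:{t/2..t}|lborel. ?h s w))"
    by (rule integral_mono[OF integrable_exp_path_int[OF t u] integrable_mult_right[OF i] exp_path_int_le_average[OF _ t u]])
       (simp add: space_P)
  also have "\<dots> = 2 / t * expectation (\<lambda>w. LINT s:{t/2..t}|lborel. ?h s w)"
    by (rule integral_mult_right_zero)
  also have "\<dots> \<le> 2 / t * (t / 2 * exp (- u * (y + b * t / 2)))"
    by (rule mult_left_mono[OF le]) (use t in simp)
  also have "\<dots> = exp (- u * (y + b * t / 2))" using t by simp
  finally show ?thesis .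
qed

text \<open>Where the area vanishes, the exponential in \<open>laplace_path_int_le\<close> equals 1
  for every \<open>u\<close>, whereas its expectation tends to 0 as \<open>u\<close> grows.\<close>

lemma AE_path_int_pos:
  assumes t: "0 < t" and b: "0 < b"
  shows "AE w in P. 0 < area t w"
proof -
  let ?I = "area t"
  have [measurable]: "?I \<in> borel_measurable P"
    by (rule measurable_area) (use t in simp)
  have le: "prob {w \<in> space P. ?I w = 0} \<le> exp (- u * (y + b * t / 2))" if u: "0 \<le> u" for u
  proof -
    have "prob {w \<in> space P. ?I w = 0} = expectation (indicator {w \<in> space P. ?I w = 0})"
      by simp
    also have "\<dots> \<le> expectation (\<lambda>w. exp (- (\<gamma> * u\<^sup>2 + 2 * u / t) * ?I w))"
    proof (rule integral_mono)
      show "integrable P (\<lambda>w. exp (- (\<gamma> * u\<^sup>2 + 2 * u / t) * ?I w))"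
      by (rule integrable_exp_path_int[OF t u])
    qed (auto simp: indicator_def intro!: integrable_real_indicator simp: emeasure_eq_measure)
    also have "\<dots> \<le> exp (- u * (y + b * t / 2))" by (rule laplace_path_int_le[OF t u])
    finally show ?thesis .
  qed
  have A: "0 < y + b * t / 2" using t b y_nonneg by (simp add: add_nonneg_pos)
  have "((\<lambda>u. exp (- u * (y + b * t / 2))) \<longlongrightarrow> 0) at_top"
    using A by real_asymp
  then have "prob {w \<in> space P. ?I w = 0} \<le> 0"
    by (rule tendsto_lowerbound) (use le in \<open>auto intro: eventually_mono[OF eventually_ge_at_top[of 0]]\<close>)
  then have "prob {w \<in> space P. ?I w = 0} = 0"
    by (simp add: measure_le_0_iff)
  then have "AE w in P. ?I w \<noteq> 0"
    by (subst (asm) prob_eq_0) auto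
  then show ?thesis
    by (rule AE_mp) (rule AE_I2, use area_nonneg in \<open>force simp: space_P less_le\<close>)
qed

lemma nn_integral_exp_quadratic:
  fixes A B C :: real
  assumes "0 < A" "0 \<le> B" "0 \<le> C"
  shows "(\<integral>\<^sup>+u. ennreal (exp (- u * A) * (B * u + C)) * indicator {0..} u \<partial>lborel) = ennreal (B / A\<^sup>2 + C / A)"
proof -
  let ?F = "\<lambda>u. - exp (- u * A) * (B * u / A + B / A\<^sup>2 + C / A)"
  have "(\<integral>\<^sup>+u. ennreal (exp (- u * A) * (B * u + C)) * indicator {0..} u \<partial>lborel) = ennreal (0 - ?F 0)"
  proof (rule nn_integral_FTC_atLeast)
    fix u :: real assume "0 \<le> u"
    show "(?F has_real_derivative exp (- u * A) * (B * u + C)) (at u)"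
      by (rule derivative_eq_intros refl | (use assms in \<open>simp add: field_simps power2_eq_square\<close>))+
    show "0 \<le> exp (- u * A) * (B * u + C)" using assms \<open>0 \<le> u\<close> by simp
  next
    show "(?F \<longlongrightarrow> 0) at_top" using assms(1) by real_asymp
  qed simp
  then show ?thesis by (simp add: add.commute)
qed

text \<open>The weight is the derivative of the exponent polynomial, so integrating over
  \<open>u\<close> reproduces \<open>1 / v\<close> exactly. The Laplace variable is thus
  \<open>g * u\<^sup>2 + 2 * u / t\<close>, the combination for which
  \<open>laplace_path_int_le\<close> has a bound.\<close>

lemma nn_integral_exp_square:
  fixes g t v :: real
  assumes "0 < t" "0 \<le> g" "0 < v"
  shows "(\<integral>\<^sup>+u. ennreal (exp (- (g * u\<^sup>2 + 2 * u / t) * v) * (2 * g * u + 2 / t)) * indicator {0..} u \<partial>lborel) = ennreal (1 / v)"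
proof -
  let ?F = "\<lambda>u. - exp (- (g * u\<^sup>2 + 2 * u / t) * v) / v"
  have "(\<integral>\<^sup>+u. ennreal (exp (- (g * u\<^sup>2 + 2 * u / t) * v) * (2 * g * u + 2 / t)) * indicator {0..} u \<partial>lborel) = ennreal (0 - ?F 0)"
  proof (rule nn_integral_FTC_atLeast)
    fix u :: real assume "0 \<le> u"
    show "(?F has_real_derivative exp (- (g * u\<^sup>2 + 2 * u / t) * v) * (2 * g * u + 2 / t)) (at u)"
      by (rule derivative_eq_intros refl | (use assms in \<open>simp add: field_simps power2_eq_square\<close>))+
    show "0 \<le> exp (- (g * u\<^sup>2 + 2 * u / t) * v) * (2 * g * u + 2 / t)" using assms \<open>0 \<le> u\<close> by simp
  next
    have lim: "((\<lambda>u. exp (- (2 / t * v) * u) / v) \<longlongrightarrow> 0) at_top"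
    proof -
      define c where "c = 2 / t * v"
      have "0 < c" using assms by (simp add: c_def)
      then have "((\<lambda>u. exp (- c * u)) \<longlongrightarrow> 0) at_top" by real_asymp
      from tendsto_divide[OF this tendsto_const, of v] show ?thesis
        using assms by (simp add: c_def)
    qed
    have "((\<lambda>u. exp (- (g * u\<^sup>2 + 2 * u / t) * v) / v) \<longlongrightarrow> 0) at_top"
    proof (rule tendsto_sandwich[OF _ _ tendsto_const lim])
      show "\<forall>\<^sub>F u in at_top. exp (- (g * u\<^sup>2 + 2 * u / t) * v) / v \<le> exp (- (2 / t * v) * u) / v"
        using assms by (intro always_eventually allI divide_right_mono) (auto simp: algebra_simps)
    qed (use assms in auto)
    then show "(?F \<longlongrightarrow> 0) at_top" using tendsto_minus by fastforce
  qed simp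
  then show ?thesis by simp
qed

lemma nn_integral_inverse_path_int_le:
  assumes t: "0 < t" and b: "0 < b"
  shows "(\<integral>\<^sup>+w. ennreal (1 / area t w) \<partial>P)
    \<le> ennreal (2 * \<gamma> / (y + b * t / 2)\<^sup>2 + 2 / t / (y + b * t / 2))"
proof -
  interpret pair_sigma_finite P lborel ..
  let ?I = "area t"
  have [measurable]: "?I \<in> borel_measurable P"
    by (rule measurable_area) (use t in simp)
  have A: "0 < y + b * t / 2" using t b y_nonneg by (simp add: add_nonneg_pos)
  have "(\<integral>\<^sup>+w. ennreal (1 / ?I w) \<partial>P) =
    (\<integral>\<^sup>+w. \<integral>\<^sup>+u. ennreal (exp (- (\<gamma> * u\<^sup>2 + 2 * u / t) * ?I w) * (2 * \<gamma> * u + 2 / t)) * indicator {0..} u \<partial>lborel \<partial>P)"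
  proof (rule nn_integral_cong_AE)
    show "AE w in P. ennreal (1 / ?I w) = (\<integral>\<^sup>+u. ennreal (exp (- (\<gamma> * u\<^sup>2 + 2 * u / t) * ?I w) * (2 * \<gamma> * u + 2 / t)) * indicator {0..} u \<partial>lborel)"
      using AE_path_int_pos[OF t b]
      by eventually_elim (rule nn_integral_exp_square[symmetric], use t \<gamma>_pos in auto)
  qed
  also have "\<dots> = (\<integral>\<^sup>+u. \<integral>\<^sup>+w. ennreal (exp (- (\<gamma> * u\<^sup>2 + 2 * u / t) * ?I w) * (2 * \<gamma> * u + 2 / t)) * indicator {0..} u \<partial>P \<partial>lborel)"
    by (rule Fubini'[symmetric]) measurable
  also have "\<dots> \<le> (\<integral>\<^sup>+u. ennreal (exp (- u * (y + b * t / 2)) * (2 * \<gamma> * u + 2 / t)) * indicator {0..} u \<partial>lborel)"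
  proof (rule nn_integral_mono)
    fix u :: real
    show "(\<integral>\<^sup>+w. ennreal (exp (- (\<gamma> * u\<^sup>2 + 2 * u / t) * ?I w) * (2 * \<gamma> * u + 2 / t)) * indicator {0..} u \<partial>P)
      \<le> ennreal (exp (- u * (y + b * t / 2)) * (2 * \<gamma> * u + 2 / t)) * indicator {0..} u"
    proof (cases "0 \<le> u")
      case True
      let ?c = "2 * \<gamma> * u + 2 / t"
      have c: "0 \<le> ?c" using True t \<gamma>_pos by simp
      have i1: "integrable P (\<lambda>w. exp (- (\<gamma> * u\<^sup>2 + 2 * u / t) * ?I w))"
      by (rule integrable_exp_path_int[OF t True])
      have "(\<integral>\<^sup>+w. ennreal (exp (- (\<gamma> * u\<^sup>2 + 2 * u / t) * ?I w) * ?c) \<partial>P)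
          = ennreal (expectation (\<lambda>w. exp (- (\<gamma> * u\<^sup>2 + 2 * u / t) * ?I w) * ?c))"
        by (rule nn_integral_eq_integral) (use i1 c in auto)
      also have "\<dots> = ennreal (expectation (\<lambda>w. exp (- (\<gamma> * u\<^sup>2 + 2 * u / t) * ?I w)) * ?c)"
        by simp
      also have "\<dots> \<le> ennreal (exp (- u * (y + b * t / 2)) * ?c)"
        by (intro ennreal_leI mult_right_mono laplace_path_int_le[OF t True] c)
      finally show ?thesis using True by simp
    qed simp
  qed
  also have "\<dots> = ennreal (2 * \<gamma> / (y + b * t / 2)\<^sup>2 + 2 / t / (y + b * t / 2))"
    by (rule nn_integral_exp_quadratic) (use A t \<gamma>_pos in auto)
  finally show ?thesis .
qed

lemma inverse_moment_path_int:
  assumes t: "0 < t" and M: "1 \<le> M" "\<gamma> \<le> M" "1 / M \<le> b"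
  shows "integrable P (\<lambda>w. 1 / area t w)"
    and "expectation (\<lambda>w. 1 / area t w) \<le> 12 * M ^ 3 / (t * (t + y))"
proof -
  let ?I = "area t"
  have "0 < 1 / M" using M by simp
  then have b: "0 < b" using M(3) by linarith
  have [measurable]: "?I \<in> borel_measurable P"
    by (rule measurable_area) (use t in simp)
  have nn: "AE w in P. 0 \<le> 1 / ?I w" using AE_path_int_pos[OF t b] by eventually_elim simp
  \<comment> \<open>As \<open>M \<ge> 1\<close> and \<open>b \<ge> 1 / M\<close>, both
    \<open>y / (2 * M) \<le> y\<close> and \<open>t / (2 * M) \<le> b * t / 2\<close>. The two terms
    of the moment bound then contribute \<open>8 * M ^ 3\<close> and \<open>4 * M ^ 3\<close>, the
    latter after enlarging \<open>M\<close> to \<open>M ^ 3\<close>.\<close>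
  have "(y + t) / (2 * M) \<le> y + b * t / 2"
  proof -
    have "y / (2 * M) \<le> y / 1" using y_nonneg M by (intro divide_left_mono) auto
    then have "y / (2 * M) \<le> y" by simp
    moreover have "1 / M * t \<le> b * t" using M t by (intro mult_right_mono) auto
    ultimately show ?thesis by (simp add: add_divide_distrib)
  qed
  moreover have A: "0 < (y + t) / (2 * M)" using t y_nonneg M by simp
  ultimately have "2 * \<gamma> / (y + b * t / 2)\<^sup>2 \<le> 2 * M / ((y + t) / (2 * M))\<^sup>2"
    "2 / t / (y + b * t / 2) \<le> 2 / t / ((y + t) / (2 * M))"
    using M \<gamma>_pos t by (intro frac_le power_mono; force)+
  moreover have "2 * M / ((y + t) / (2 * M))\<^sup>2 \<le> 8 * M ^ 3 / (t * (t + y))"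
  proof -
    have "2 * M / ((y + t) / (2 * M))\<^sup>2 = 8 * M ^ 3 / (y + t)\<^sup>2"
      by (simp add: field_simps power2_eq_square power3_eq_cube)
    also have "\<dots> \<le> 8 * M ^ 3 / (t * (t + y))"
    proof (rule frac_le)
      show "0 < t * (t + y)" using t y_nonneg by (intro mult_pos_pos) auto
    qed (use t y_nonneg M in \<open>auto simp: power2_eq_square algebra_simps\<close>)
    finally show ?thesis .
  qed
  moreover have "2 / t / ((y + t) / (2 * M)) \<le> 4 * M ^ 3 / (t * (t + y))"
  proof -
    have "M ^ 1 \<le> M ^ 3" using M by (intro power_increasing) auto
    then have "4 * M / (t * (t + y)) \<le> 4 * M ^ 3 / (t * (t + y))"
      using t y_nonneg by (intro divide_right_mono) auto
    moreover have "2 / t / ((y + t) / (2 * M)) = 4 * M / (t * (t + y))"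
      using t y_nonneg M by (simp add: field_simps)
    ultimately show ?thesis by (rule ord_eq_le_trans[rotated])
  qed
  ultimately have "2 * \<gamma> / (y + b * t / 2)\<^sup>2 + 2 / t / (y + b * t / 2) \<le> 12 * M ^ 3 / (t * (t + y))"
    by simp
  then have le: "(\<integral>\<^sup>+w. ennreal (1 / ?I w) \<partial>P) \<le> ennreal (12 * M ^ 3 / (t * (t + y)))"
    by (intro order_trans[OF nn_integral_inverse_path_int_le[OF t b]] ennreal_leI)
  show i: "integrable P (\<lambda>w. 1 / ?I w)"
    by (rule integrableI_nonneg[OF _ nn]) (use le in \<open>auto intro: le_less_trans\<close>)
  have "ennreal (expectation (\<lambda>w. 1 / ?I w)) \<le> ennreal (12 * M ^ 3 / (t * (t + y)))"
    using le nn_integral_eq_integral[OF i nn] by simp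
  then show "expectation (\<lambda>w. 1 / ?I w) \<le> 12 * M ^ 3 / (t * (t + y))"
    using t y_nonneg M by (subst (asm) ennreal_le_iff) auto
qed

text \<open>Chebyshev's inequality for \<open>exp (- (1 / y) * w t)\<close> about
  \<open>exp (- 1)\<close>, its value for a path that is still at \<open>y\<close>. The second
  moment is evaluated by \<open>expectation_exp_diff\<close> at \<open>2 / y\<close> and
  \<open>1 / y\<close>, which avoids moments of the process itself.\<close>

lemma prob_half_le:
  assumes t: "0 < t" and y: "0 < y"
  shows "prob {w \<in> space P. w t < y / 2} * (y / t) \<le> 144 * (b + \<gamma>)"
proof -
  let ?A = "{w \<in> space P. w t < y / 2}" and ?E = "\<lambda>u. expectation (\<lambda>w. exp (- u * w t))"
  have [measurable]: "(\<lambda>w. w t) \<in> borel_measurable P"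
    by (rule measurable_P, rule measurable_path_eval) (use t in simp)
  have nn: "0 \<le> w t" if "w \<in> space P" for w using that t by (simp add: space_P space_path_space)
  have i: "integrable P (\<lambda>w. exp (- u * w t))" if "0 \<le> u" for u
    by (rule integrable_const_bound[where B=1]) (use that nn in \<open>auto intro!: AE_I2\<close>)
  let ?g = "\<lambda>w. exp (- (2 / y) * w t) - 2 * exp (-1) * exp (- (1 / y) * w t) + exp (-2)"
  have sq: "?g w = (exp (- (1 / y) * w t) - exp (-1))\<^sup>2" for w
    by (simp add: power2_eq_square algebra_simps exp_add[symmetric])
  have ig: "integrable P ?g" using i[of "2/y"] i[of "1/y"] y by simp
  have "prob ?A * (1 / 36) = expectation (\<lambda>w. indicator ?A w * (1 / 36))" by simp
  also have "\<dots> \<le> expectation ?g"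
  proof (rule integral_mono[OF _ ig])
    show "integrable P (\<lambda>w. indicator ?A w * (1 / 36) :: real)"
      by (intro integrable_mult_left integrable_real_indicator) (auto simp: emeasure_eq_measure)
    fix w assume w: "w \<in> space P"
    show "indicator ?A w * (1 / 36) \<le> ?g w"
    proof (cases "w \<in> ?A")
      case True
      \<comment> \<open>On the event \<open>w t / y < 1 / 2\<close>, so the deviation is at least
        \<open>exp (- 1) * (exp (1 / 2) - 1)\<close>, hence at least \<open>1 / 6\<close>. The 36
        from squaring and the 4 in the variance bound below make up the constant 144.\<close>
      have "exp (1::real) \<le> 3" by (rule exp_le)
      then have e: "1 / 3 \<le> exp (- 1 :: real)" by (simp add: exp_minus field_simps)
      have "3 / 2 \<le> exp (1 / 2 :: real)" using exp_ge_add_one_self[of "1/2 :: real"] by simp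
      then have "1 / 3 * (1 / 2) \<le> exp (- 1 :: real) * (exp (1 / 2) - 1)"
        by (intro mult_mono e) auto
      also have "\<dots> = exp (- (1 / 2)) - exp (- 1 :: real)" by (simp add: algebra_simps exp_add[symmetric])
      also have "\<dots> \<le> exp (- (1 / y) * w t) - exp (-1)" using True y by (simp add: field_simps)
      finally have "(1 / 6)\<^sup>2 \<le> (exp (- (1 / y) * w t) - exp (-1))\<^sup>2" by (intro power_mono) auto
      then show ?thesis using True unfolding sq by (simp add: power2_eq_square)
    next
      case False
      then have "indicator ?A w = (0 :: real)" by (rule indicator_simps(2))
      then show ?thesis unfolding sq by simp
    qed
  qed
  also have "expectation ?g = ?E (2 / y) - 2 * exp (-1) * ?E (1 / y) + exp (-2)"
    using i[of "2/y"] i[of "1/y"] y by (simp add: prob_space)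
  also have "\<dots> \<le> 4 * ((b + \<gamma>) * t / y)"
  proof -
    let ?r = "(b + \<gamma>) * t / y"
    have "\<bar>?E (2 / y) - exp (- (2 / y) * y)\<bar> \<le> 2 * ?r" "\<bar>?E (1 / y) - exp (- (1 / y) * y)\<bar> \<le> ?r"
      using expectation_exp_diff[of "2/y" t] expectation_exp_diff[of "1/y" t] t y
      by (simp_all add: ring_distribs add_divide_distrib)
    then have 1: "?E (2 / y) \<le> exp (-2) + 2 * ?r" "exp (-1) - ?r \<le> ?E (1 / y)" using y by auto
    have r: "0 \<le> ?r" using b_nonneg \<gamma>_pos t y by simp
    have "2 * exp (-1) * (exp (-1) - ?r) \<le> 2 * exp (-1) * ?E (1 / y)"
      by (rule mult_left_mono[OF 1(2)]) simp
    moreover have "2 * exp (-1) * (exp (-1) - ?r) = 2 * exp (-2) - 2 * (exp (-1) * ?r)"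
      by (simp add: algebra_simps exp_add[symmetric])
    moreover have "exp (-1) * ?r \<le> 1 * ?r" by (rule mult_right_mono[OF _ r]) simp
    ultimately have "?E (2 / y) - 2 * exp (-1) * ?E (1 / y) + exp (-2) \<le> 4 * ?r" using 1(1) by linarith
    then show ?thesis .
  qed
  finally show ?thesis using t y by (simp add: field_simps)
qed

end

section \<open>Derivatives of Gaussian convolutions\<close>

text \<open>Serves on two levels, for the Gaussian integral and for the expectation over the
  catalysts. The mean value inequality turns the bound on derivatives near \<open>y0\<close> into a
  domination of the difference quotients.\<close>

lemma has_real_derivative_integral:
  fixes h h' :: "real \<Rightarrow> 'a \<Rightarrow> real"
  assumes h: "\<And>y. integrable M (h y)"
    and m: "h' y0 \<in> borel_measurable M"
    and G: "integrable M G"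
    and le: "AE w in M. \<forall>y. \<bar>y - y0\<bar> < 1 \<longrightarrow> ((\<lambda>y. h y w) has_real_derivative h' y w) (at y) \<and> \<bar>h' y w\<bar> \<le> G w"
  shows "((\<lambda>y. \<integral>w. h y w \<partial>M) has_real_derivative (\<integral>w. h' y0 w \<partial>M)) (at y0)"
proof -
  let ?q = "\<lambda>r w. (h (y0 + r) w - h y0 w) / r"
  have "((\<lambda>r. \<integral>w. ?q r w \<partial>M) \<longlongrightarrow> (\<integral>w. h' y0 w \<partial>M)) (at 0)"
    unfolding tendsto_at_iff_sequentially comp_def
  proof (intro allI impI)
    fix X :: "nat \<Rightarrow> real" assume X: "\<forall>i. X i \<in> UNIV - {0}" "X \<longlonglongrightarrow> 0"
    from X(2) obtain N where N: "\<And>n. n \<ge> N \<Longrightarrow> \<bar>X n\<bar> < 1"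
      by (metis LIMSEQ_D real_norm_def diff_zero zero_less_one)
    have "(\<lambda>n. \<integral>w. ?q (X (n + N)) w \<partial>M) \<longlonglongrightarrow> (\<integral>w. h' y0 w \<partial>M)"
    proof (rule integral_dominated_convergence[OF m _ G])
      show "?q (X (n + N)) \<in> borel_measurable M" for n
        using h by (intro borel_measurable_divide borel_measurable_diff borel_measurable_integrable) auto
      show "AE w in M. (\<lambda>n. ?q (X (n + N)) w) \<longlonglongrightarrow> h' y0 w"
        using le
      proof eventually_elim
        fix w assume "\<forall>y. \<bar>y - y0\<bar> < 1 \<longrightarrow> ((\<lambda>y. h y w) has_real_derivative h' y w) (at y) \<and> \<bar>h' y w\<bar> \<le> G w"
        then have "((\<lambda>y. h y w) has_real_derivative h' y0 w) (at y0)" by auto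
        then have "((\<lambda>r. ?q r w) \<longlongrightarrow> h' y0 w) (at 0)" by (simp add: DERIV_def)
        then have "(\<lambda>n. ?q (X n) w) \<longlonglongrightarrow> h' y0 w"
          using X unfolding tendsto_at_iff_sequentially comp_def by blast
        then show "(\<lambda>n. ?q (X (n + N)) w) \<longlonglongrightarrow> h' y0 w" by (rule LIMSEQ_ignore_initial_segment)
      qed
      show "AE w in M. norm (?q (X (n + N)) w) \<le> G w" for n
        using le
      proof eventually_elim
        fix w assume *: "\<forall>y. \<bar>y - y0\<bar> < 1 \<longrightarrow> ((\<lambda>y. h y w) has_real_derivative h' y w) (at y) \<and> \<bar>h' y w\<bar> \<le> G w"
        let ?r = "X (n + N)"
        have r: "\<bar>?r\<bar> < 1" "?r \<noteq> 0" using N[of "n + N"] X(1) by auto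
        have "norm (h (y0 + ?r) w - h y0 w) \<le> G w * norm (y0 + ?r - y0)"
        proof (rule field_differentiable_bound[where S="ball y0 1"])
          show "((\<lambda>y. h y w) has_field_derivative h' y w) (at y within ball y0 1)" "norm (h' y w) \<le> G w"
            if "y \<in> ball y0 1" for y
            using * that by (auto simp: dist_real_def abs_minus_commute intro: has_field_derivative_at_within)
        qed (use r in \<open>auto simp: dist_real_def\<close>)
        then show "norm (?q ?r w) \<le> G w" using r by (simp add: abs_divide divide_le_eq)
      qed
    qed
    then have "(\<lambda>n. \<integral>w. ?q (X n) w \<partial>M) \<longlonglongrightarrow> (\<integral>w. h' y0 w \<partial>M)" by (rule LIMSEQ_offset)
    then show "(\<lambda>n. \<integral>w. ?q (X n) w \<partial>M) \<longlonglongrightarrow> (\<integral>w. h' y0 w \<partial>M)" .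
  qed
  moreover have "(\<integral>w. ?q r w \<partial>M) = ((\<integral>w. h (y0 + r) w \<partial>M) - (\<integral>w. h y0 w \<partial>M)) / r" for r
    using h by simp
  ultimately show ?thesis by (simp only: DERIV_def)
qed

text \<open>Difference quotients are measurable and converge. In this way measurability of the
  convolutions with the derivative kernels is inherited from the convolution with the Gaussian
  itself.\<close>

lemma measurable_derivative:
  fixes h :: "real \<Rightarrow> 'a \<Rightarrow> real" and h' :: "'a \<Rightarrow> real"
  assumes h: "\<And>y. h y \<in> borel_measurable M"
    and d: "\<And>w. w \<in> space M \<Longrightarrow> ((\<lambda>y. h y w) has_real_derivative h' w) (at y0)"
  shows "h' \<in> borel_measurable M"
proof (rule borel_measurable_LIMSEQ_real)
  let ?r = "\<lambda>n. inverse (real (Suc n))"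
  show "(\<lambda>w. (h (y0 + ?r n) w - h y0 w) / ?r n) \<in> borel_measurable M" for n
    using h by (intro borel_measurable_divide borel_measurable_diff) auto
  fix w assume "w \<in> space M"
  from d[OF this] have "((\<lambda>r. (h (y0 + r) w - h y0 w) / r) \<longlongrightarrow> h' w) (at 0)" by (simp add: DERIV_def)
  then show "(\<lambda>n. (h (y0 + ?r n) w - h y0 w) / ?r n) \<longlonglongrightarrow> h' w"
    using LIMSEQ_inverse_real_of_nat unfolding tendsto_at_iff_sequentially comp_def by auto
qed

section \<open>The Gaussian kernel and its first two derivatives\<close>

lemma gauss_eq_normal_density: "0 < v \<Longrightarrow> gauss v (z - y) = normal_density y (sqrt v) z"
  by (simp add: gauss_def normal_density_def powr_minus_divide powr_half_sqrt)

text \<open>Since \<open>0 powr (- 1 / 2) = 0\<close>, the kernel of variance 0 is the zero function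
  and not a point mass. For variances \<open>\<ge> 0\<close> the total mass is therefore only at
  most 1.\<close>

lemma gauss_0 [simp]: "gauss 0 z = 0"
  by (simp add: gauss_def)

lemma gauss_nonneg: "0 \<le> gauss v z"
  by (simp add: gauss_def)

lemma measurable_gauss [measurable]: "case_prod gauss \<in> borel_measurable (borel \<Otimes>\<^sub>M borel)"
  unfolding gauss_def[abs_def] by measurable

lemma measurable_gauss_comp [measurable (raw)]:
  "f \<in> borel_measurable M \<Longrightarrow> g \<in> borel_measurable M \<Longrightarrow> (\<lambda>w. gauss (f w) (g w)) \<in> borel_measurable M"
  using measurable_compose[OF _ measurable_gauss, of "\<lambda>w. (f w, g w)" M] by simp

lemma integrable_gauss: "0 \<le> v \<Longrightarrow> integrable lborel (\<lambda>z. gauss v (z - y))"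
  by (cases "v = 0") (auto simp: gauss_eq_normal_density)

lemma integral_gauss: "0 < v \<Longrightarrow> (\<integral>z. gauss v (z - y) \<partial>lborel) = 1"
  by (simp add: gauss_eq_normal_density)

lemma integral_gauss_le_1: "0 \<le> v \<Longrightarrow> (\<integral>z. gauss v (z - y) \<partial>lborel) \<le> 1"
  by (cases "v = 0") (auto simp: integral_gauss)

text \<open>The first two derivatives of \<open>y \<mapsto> gauss v (z - y)\<close> at \<open>x = z - y\<close>.\<close>

definition gauss1 :: "real \<Rightarrow> real \<Rightarrow> real" where
  "gauss1 v x = x / v * gauss v x"

definition gauss2 :: "real \<Rightarrow> real \<Rightarrow> real" where
  "gauss2 v x = (x\<^sup>2 / v - 1) / v * gauss v x"

lemma gauss_has_derivative:
  assumes "0 < v"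
  shows "((\<lambda>y. gauss v (z - y)) has_real_derivative gauss1 v (z - y)) (at y)"
    and "((\<lambda>y. gauss1 v (z - y)) has_real_derivative gauss2 v (z - y)) (at y)"
proof -
  show 1: "((\<lambda>y. gauss v (z - y)) has_real_derivative gauss1 v (z - y)) (at y)"
    unfolding gauss_def gauss1_def
    by (rule derivative_eq_intros refl | (use assms in \<open>simp add: field_simps\<close>))+
  show "((\<lambda>y. gauss1 v (z - y)) has_real_derivative gauss2 v (z - y)) (at y)"
    unfolding gauss1_def gauss2_def
    by (rule derivative_eq_intros refl 1[unfolded gauss1_def] | (use assms in \<open>simp add: field_simps power2_eq_square\<close>))+
qed

lemma measurable_gauss12 [measurable]:
  "gauss1 v \<in> borel_measurable borel" "gauss2 v \<in> borel_measurable borel"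
  unfolding gauss1_def[abs_def] gauss2_def[abs_def] by measurable

text \<open>Half of the Gaussian exponent is kept in the kernel of variance \<open>2 * v\<close>;
  the other half is free to absorb polynomial factors in \<open>x\<^sup>2 / v\<close>.\<close>

lemma gauss_double:
  assumes "0 < v"
  shows "gauss v x = sqrt 2 * exp (- (x\<^sup>2 / v / 4)) * gauss (2 * v) x"
proof -
  have "sqrt (2 * pi * (2 * v)) = sqrt 2 * sqrt (2 * pi * v)"
    by (simp flip: real_sqrt_mult add: mult_ac)
  moreover have "exp (- x\<^sup>2 / (2 * v)) = exp (- (x\<^sup>2 / v / 4)) * exp (- x\<^sup>2 / (2 * (2 * v)))"
    using assms by (simp flip: exp_add add: field_simps)
  ultimately show ?thesis
    using assms by (simp add: gauss_def powr_minus_divide powr_half_sqrt)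
qed

text \<open>With 32 the quadratic terms agree in the Taylor lower bound of the exponential:
  \<open>32 * (s\<^sup>2 / 2) = (4 * s)\<^sup>2\<close>. The application has
  \<open>s = x\<^sup>2 / v / 4\<close>.\<close>

lemma quadratic_le_exp:
  assumes "0 \<le> (s::real)"
  shows "(1 + 4 * s)\<^sup>2 * exp (- s) \<le> 32"
proof -
  have "1 + s + s\<^sup>2 / 2 \<le> exp s" by (rule exp_lower_Taylor_quadratic[OF assms])
  then have "(1 + 4 * s)\<^sup>2 \<le> 32 * exp s"
    using assms by (simp add: power2_eq_square algebra_simps)
  then show ?thesis by (simp add: exp_minus field_simps)
qed

text \<open>The square provides two factors: one pays for the polynomial brought down by
  differentiation, the other for the growth of the oscillation in
  \<open>gauss_convolution_bound\<close>. The 64 is \<open>32 * sqrt 2\<close> rounded up.\<close>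

lemma gauss_poly_bound:
  assumes "0 < v"
  shows "gauss v x * (1 + x\<^sup>2 / v)\<^sup>2 \<le> 64 * gauss (2 * v) x"
proof -
  have "(1 + x\<^sup>2 / v)\<^sup>2 * exp (- (x\<^sup>2 / v / 4)) \<le> 32"
    using quadratic_le_exp[of "x\<^sup>2 / v / 4"] assms by simp
  moreover have "sqrt 2 \<le> 2" by (rule real_le_lsqrt) auto
  ultimately have "((1 + x\<^sup>2 / v)\<^sup>2 * exp (- (x\<^sup>2 / v / 4))) * sqrt 2 \<le> 32 * 2"
    by (intro mult_mono) auto
  then have "((1 + x\<^sup>2 / v)\<^sup>2 * exp (- (x\<^sup>2 / v / 4)) * sqrt 2) * gauss (2 * v) x \<le> 64 * gauss (2 * v) x"
    by (intro mult_right_mono gauss_nonneg) auto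
  then show ?thesis unfolding gauss_double[OF assms] by (simp add: mult_ac)
qed

lemma gauss12_bound:
  assumes "0 < v"
  shows "\<bar>gauss1 v x\<bar> * (1 + x\<^sup>2 / v) \<le> 64 / sqrt v * gauss (2 * v) x"
    and "\<bar>gauss2 v x\<bar> * (1 + x\<^sup>2 / v) \<le> 64 / v * gauss (2 * v) x"
proof -
  define a where "a = \<bar>x\<bar> / sqrt v"
  have a2: "a\<^sup>2 = x\<^sup>2 / v" using assms by (simp add: a_def power_divide)
  have "0 \<le> (1 - a)\<^sup>2" by simp
  then have "2 * a \<le> 1 + a\<^sup>2" by (simp add: power2_eq_square algebra_simps)
  moreover have "0 \<le> a" using assms by (simp add: a_def)
  ultimately have al: "a \<le> 1 + x\<^sup>2 / v" unfolding a2 by linarith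
  have v: "v = sqrt v * sqrt v" using assms by simp
  have "\<bar>gauss1 v x\<bar> = \<bar>x\<bar> / v * gauss v x"
    using assms by (simp add: gauss1_def abs_mult gauss_nonneg)
  also have "\<bar>x\<bar> / v = a / sqrt v" using assms by (simp add: a_def)
  finally have "\<bar>gauss1 v x\<bar> * (1 + x\<^sup>2 / v) = a * ((1 + x\<^sup>2 / v) * gauss v x / sqrt v)"
    by simp
  also have "\<dots> \<le> (1 + x\<^sup>2 / v) * ((1 + x\<^sup>2 / v) * gauss v x / sqrt v)"
    using assms by (intro mult_right_mono[OF al]) (auto simp: gauss_nonneg)
  also have "\<dots> = gauss v x * (1 + x\<^sup>2 / v)\<^sup>2 / sqrt v" by (simp add: power2_eq_square)
  also have "\<dots> \<le> 64 * gauss (2 * v) x / sqrt v"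
    using assms by (intro divide_right_mono gauss_poly_bound) auto
  finally show "\<bar>gauss1 v x\<bar> * (1 + x\<^sup>2 / v) \<le> 64 / sqrt v * gauss (2 * v) x" by simp
  have "0 \<le> x\<^sup>2 / v" using assms by simp
  then have *: "\<bar>x\<^sup>2 / v - 1\<bar> \<le> 1 + x\<^sup>2 / v" by linarith
  have "\<bar>gauss2 v x\<bar> * (1 + x\<^sup>2 / v) = \<bar>x\<^sup>2 / v - 1\<bar> * ((1 + x\<^sup>2 / v) * gauss v x / v)"
    using assms by (simp add: gauss2_def abs_mult gauss_nonneg)
  also have "\<dots> \<le> (1 + x\<^sup>2 / v) * ((1 + x\<^sup>2 / v) * gauss v x / v)"
    using assms by (intro mult_right_mono[OF *]) (auto simp: gauss_nonneg)
  also have "\<dots> = gauss v x * (1 + x\<^sup>2 / v)\<^sup>2 / v" by (simp add: power2_eq_square)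
  also have "\<dots> \<le> 64 * gauss (2 * v) x / v"
    using assms by (intro divide_right_mono gauss_poly_bound) auto
  finally show "\<bar>gauss2 v x\<bar> * (1 + x\<^sup>2 / v) \<le> 64 / v * gauss (2 * v) x" by simp
qed

lemma gauss12_le:
  assumes "0 < v"
  shows "\<bar>gauss1 v x\<bar> \<le> 64 / sqrt v * gauss (2 * v) x"
    and "\<bar>gauss2 v x\<bar> \<le> 64 / v * gauss (2 * v) x"
proof -
  have "1 \<le> 1 + x\<^sup>2 / v" using assms by simp
  then have "\<bar>gauss1 v x\<bar> * 1 \<le> \<bar>gauss1 v x\<bar> * (1 + x\<^sup>2 / v)" "\<bar>gauss2 v x\<bar> * 1 \<le> \<bar>gauss2 v x\<bar> * (1 + x\<^sup>2 / v)"
    by (rule mult_left_mono, simp)+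
  with gauss12_bound[OF assms, of x] show "\<bar>gauss1 v x\<bar> \<le> 64 / sqrt v * gauss (2 * v) x"
    "\<bar>gauss2 v x\<bar> \<le> 64 / v * gauss (2 * v) x" by linarith+
qed

text \<open>A domination uniform over centres within distance 1, bought with a second doubling of
  the variance. The factor \<open>exp (1 / (4 * v))\<close> is harmless: it serves to justify
  differentiation and enters no final bound.\<close>

lemma gauss_shift_le:
  assumes v: "0 < v" and y: "\<bar>y - y0\<bar> < 1"
  shows "gauss (2 * v) (z - y) \<le> 2 * exp (1 / (4 * v)) * gauss (4 * v) (z - y0)"
proof -
  have "(y - y0)\<^sup>2 \<le> 1" using y by (simp add: abs_square_le_1)
  moreover have "0 \<le> ((z - y) - (y - y0))\<^sup>2" by simp
  ultimately have "(z - y0)\<^sup>2 \<le> 2 * (z - y)\<^sup>2 + 2" by (simp add: power2_eq_square algebra_simps)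
  then have "- (z - y)\<^sup>2 / (4 * v) \<le> 1 / (4 * v) + - (z - y0)\<^sup>2 / (8 * v)"
    using v by (simp add: field_simps)
  then have e: "exp (- (z - y)\<^sup>2 / (4 * v)) \<le> exp (1 / (4 * v)) * exp (- (z - y0)\<^sup>2 / (8 * v))"
    by (simp flip: exp_add)
  have s: "1 / sqrt (2 * pi * (2 * v)) \<le> 2 * (1 / sqrt (2 * pi * (4 * v)))"
  proof -
    have "sqrt (2 * pi * (4 * v)) = sqrt 2 * sqrt (2 * pi * (2 * v))"
      by (simp flip: real_sqrt_mult add: mult_ac)
    moreover have "sqrt 2 \<le> 2" by (rule real_le_lsqrt) auto
    ultimately show ?thesis using v by (simp add: field_simps)
  qed
  have "1 / sqrt (2 * pi * (2 * v)) * exp (- (z - y)\<^sup>2 / (4 * v))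
    \<le> 2 * (1 / sqrt (2 * pi * (4 * v))) * (exp (1 / (4 * v)) * exp (- (z - y0)\<^sup>2 / (8 * v)))"
    by (rule mult_mono[OF s e]) (use v in auto)
  then show ?thesis using v by (simp add: gauss_def powr_minus_divide powr_half_sqrt mult_ac)
qed

context
  fixes \<phi> :: "real \<Rightarrow> real" and B v :: real
  assumes \<phi>: "\<phi> \<in> borel_measurable borel" and B: "\<And>z. \<bar>\<phi> z\<bar> \<le> B" and v: "0 < v"
begin

lemma bounded_mult_dominated:
  assumes "g \<in> borel_measurable borel" "\<And>z. \<bar>g z\<bar> \<le> c * gauss v' (z - y)" "0 \<le> v'"
  shows "integrable lborel (\<lambda>z. \<phi> z * g z)"
proof (rule Bochner_Integration.integrable_bound[OF integrable_mult_right[of "B * c", OF integrable_gauss[OF assms(3)]]])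
  show "(\<lambda>z. \<phi> z * g z) \<in> borel_measurable lborel" using \<phi> assms(1) by simp
  have "norm (\<phi> z * g z) \<le> norm (B * c * gauss v' (z - y))" for z
  proof -
    have "norm (\<phi> z * g z) \<le> B * (c * gauss v' (z - y))"
      unfolding real_norm_def abs_mult
      by (rule mult_mono[OF B assms(2)]) (use B[of z] in auto)
    then show ?thesis by simp
  qed
  then show "AE z in lborel. norm (\<phi> z * g z) \<le> norm (B * c * gauss v' (z - y))" by simp
qed

lemma integrable_mult_gauss:
  "integrable lborel (\<lambda>z. \<phi> z * gauss v (z - y))"
  "integrable lborel (\<lambda>z. \<phi> z * gauss1 v (z - y))"
  "integrable lborel (\<lambda>z. \<phi> z * gauss2 v (z - y))"
proof -
  show "integrable lborel (\<lambda>z. \<phi> z * gauss v (z - y))"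
    by (rule bounded_mult_dominated[where v'=v and c=1 and y=y]) (use v in \<open>auto simp: gauss_nonneg\<close>)
  show "integrable lborel (\<lambda>z. \<phi> z * gauss1 v (z - y))"
    by (rule bounded_mult_dominated[OF _ gauss12_le(1)[OF v]]) (use v in auto)
  show "integrable lborel (\<lambda>z. \<phi> z * gauss2 v (z - y))"
    by (rule bounded_mult_dominated[OF _ gauss12_le(2)[OF v]]) (use v in auto)
qed

lemma gauss_convolution_has_derivative:
  "((\<lambda>y. \<integral>z. \<phi> z * gauss v (z - y) \<partial>lborel) has_real_derivative (\<integral>z. \<phi> z * gauss1 v (z - y) \<partial>lborel)) (at y)"
  "((\<lambda>y. \<integral>z. \<phi> z * gauss1 v (z - y) \<partial>lborel) has_real_derivative (\<integral>z. \<phi> z * gauss2 v (z - y) \<partial>lborel)) (at y)"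
proof -
  have B0: "0 \<le> B" using B[of 0] by linarith
  define K where "K = B * (64 / sqrt v + 64 / v) * (2 * exp (1 / (4 * v)))"
  have K: "integrable lborel (\<lambda>z. K * gauss (4 * v) (z - y))"
    using integrable_gauss[of "4 * v" y] v by simp
  have le: "\<bar>\<phi> z * g\<bar> \<le> K * gauss (4 * v) (z - y)"
    if "\<bar>g\<bar> \<le> c * gauss (2 * v) (z - y')" "c = 64 / sqrt v \<or> c = 64 / v" "\<bar>y' - y\<bar> < 1" for g c z y'
  proof -
    have c: "c \<le> 64 / sqrt v + 64 / v" using that(2) v by auto
    have "\<bar>g\<bar> \<le> (64 / sqrt v + 64 / v) * (2 * exp (1 / (4 * v)) * gauss (4 * v) (z - y))"
      using v by (intro order_trans[OF that(1)] mult_mono c gauss_shift_le[OF v that(3)]) (auto simp: gauss_nonneg)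
    then have "\<bar>\<phi> z * g\<bar> \<le> B * ((64 / sqrt v + 64 / v) * (2 * exp (1 / (4 * v)) * gauss (4 * v) (z - y)))"
      unfolding abs_mult using B0 by (intro mult_mono B) auto
    then show ?thesis by (simp add: K_def mult_ac)
  qed
  show "((\<lambda>y. \<integral>z. \<phi> z * gauss v (z - y) \<partial>lborel) has_real_derivative (\<integral>z. \<phi> z * gauss1 v (z - y) \<partial>lborel)) (at y)"
  proof (rule has_real_derivative_integral[OF integrable_mult_gauss(1) _ K])
    show "AE z in lborel. \<forall>y'. \<bar>y' - y\<bar> < 1 \<longrightarrow>
        ((\<lambda>y. \<phi> z * gauss v (z - y)) has_real_derivative \<phi> z * gauss1 v (z - y')) (at y') \<and>
        \<bar>\<phi> z * gauss1 v (z - y')\<bar> \<le> K * gauss (4 * v) (z - y)"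
      by (intro AE_I2 allI impI conjI DERIV_cmult gauss_has_derivative v le[OF gauss12_le(1)[OF v]]) auto
  qed (use \<phi> in simp)
  show "((\<lambda>y. \<integral>z. \<phi> z * gauss1 v (z - y) \<partial>lborel) has_real_derivative (\<integral>z. \<phi> z * gauss2 v (z - y) \<partial>lborel)) (at y)"
  proof (rule has_real_derivative_integral[OF integrable_mult_gauss(2) _ K])
    show "AE z in lborel. \<forall>y'. \<bar>y' - y\<bar> < 1 \<longrightarrow>
        ((\<lambda>y. \<phi> z * gauss1 v (z - y)) has_real_derivative \<phi> z * gauss2 v (z - y')) (at y') \<and>
        \<bar>\<phi> z * gauss2 v (z - y')\<bar> \<le> K * gauss (4 * v) (z - y)"
      by (intro AE_I2 allI impI conjI DERIV_cmult gauss_has_derivative v le[OF gauss12_le(2)[OF v]]) auto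
  qed (use \<phi> in simp)
qed

end

text \<open>Convolving the constant 1 with the Gaussian gives the constant 1, whose derivatives
  vanish.\<close>

lemma integral_gauss12:
  assumes "0 < v"
  shows "(\<integral>z. gauss1 v (z - y) \<partial>lborel) = 0" "(\<integral>z. gauss2 v (z - y) \<partial>lborel) = 0"
proof -
  note d = gauss_convolution_has_derivative[of "\<lambda>_. 1" 1 v, OF _ _ assms, simplified]
  have 1: "(\<integral>z. gauss1 v (z - y) \<partial>lborel) = 0" for y
    using d(1)[of y] unfolding integral_gauss[OF assms] by (rule DERIV_unique) simp
  then show "(\<integral>z. gauss1 v (z - y) \<partial>lborel) = 0" .
  show "(\<integral>z. gauss2 v (z - y) \<partial>lborel) = 0"
    using d(2)[of y] unfolding 1 by (rule DERIV_unique) simp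
qed

text \<open>
  The kernels integrate to \<open>0\<close>, so only the oscillation of \<open>\<phi>\<close> around \<open>y\<close> matters.
\<close>

lemma gauss_convolution_bound:
  fixes \<phi> :: "real \<Rightarrow> real"
  assumes \<phi>: "\<phi> \<in> borel_measurable borel" and B: "\<And>z. \<bar>\<phi> z\<bar> \<le> B" and v: "0 < v"
    and L: "\<And>z. \<bar>\<phi> z - \<phi> y\<bar> \<le> L * (1 + (z - y)\<^sup>2 / v)"
  shows "\<bar>\<integral>z. \<phi> z * gauss1 v (z - y) \<partial>lborel\<bar> \<le> 64 * L / sqrt v"
    and "\<bar>\<integral>z. \<phi> z * gauss2 v (z - y) \<partial>lborel\<bar> \<le> 64 * L / v"
proof -
  have L0: "0 \<le> L" using L[of y] by simp
  have *: "\<bar>\<integral>z. \<phi> z * g (z - y) \<partial>lborel\<bar> \<le> L * c"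
    if g: "g \<in> borel_measurable borel" "\<And>x. \<bar>g x\<bar> * (1 + x\<^sup>2 / v) \<le> c * gauss (2 * v) x"
      "\<And>x. \<bar>g x\<bar> \<le> c * gauss (2 * v) x" "(\<integral>z. g (z - y) \<partial>lborel) = 0" for g c
  proof -
    have i1: "integrable lborel (\<lambda>z. \<phi> z * g (z - y))"
      by (rule bounded_mult_dominated[OF \<phi> B v, where v'="2 * v" and c=c and y=y]) (use g v in auto)
    have "integrable lborel (\<lambda>z. 1 * g (z - y))"
      by (rule bounded_mult_dominated[where B=1 and v=v and v'="2 * v" and c=c and y=y]) (use g v in auto)
    then have i2: "integrable lborel (\<lambda>z. g (z - y))" by simp
    have "(\<integral>z. \<phi> z * g (z - y) \<partial>lborel) = (\<integral>z. \<phi> z * g (z - y) - \<phi> y * g (z - y) \<partial>lborel)"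
      using i1 i2 g(4) by simp
    also have "\<bar>\<dots>\<bar> \<le> (\<integral>z. \<bar>\<phi> z * g (z - y) - \<phi> y * g (z - y)\<bar> \<partial>lborel)"
      by (rule integral_abs_bound)
    also have "\<dots> \<le> (\<integral>z. L * (c * gauss (2 * v) (z - y)) \<partial>lborel)"
    proof (rule integral_mono)
      show "integrable lborel (\<lambda>z. \<bar>\<phi> z * g (z - y) - \<phi> y * g (z - y)\<bar>)" using i1 i2 by simp
      show "integrable lborel (\<lambda>z. L * (c * gauss (2 * v) (z - y)))"
        using integrable_gauss[of "2 * v" y] v by simp
      fix z
      have "\<bar>\<phi> z * g (z - y) - \<phi> y * g (z - y)\<bar> = \<bar>\<phi> z - \<phi> y\<bar> * \<bar>g (z - y)\<bar>"
        by (simp flip: abs_mult add: algebra_simps)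
      also have "\<dots> \<le> L * (1 + (z - y)\<^sup>2 / v) * \<bar>g (z - y)\<bar>"
        by (rule mult_right_mono[OF L]) simp
      also have "\<dots> = L * (\<bar>g (z - y)\<bar> * (1 + (z - y)\<^sup>2 / v))" by simp
      also have "\<dots> \<le> L * (c * gauss (2 * v) (z - y))" by (rule mult_left_mono[OF g(2) L0])
      finally show "\<bar>\<phi> z * g (z - y) - \<phi> y * g (z - y)\<bar> \<le> L * (c * gauss (2 * v) (z - y))" .
    qed
    also have "\<dots> = L * c" using integral_gauss[of "2 * v" y] v by simp
    finally show ?thesis .
  qed
  show "\<bar>\<integral>z. \<phi> z * gauss1 v (z - y) \<partial>lborel\<bar> \<le> 64 * L / sqrt v"
    using *[OF _ gauss12_bound(1)[OF v] gauss12_le(1)[OF v] integral_gauss12(1)[OF v]] by (simp add: mult.commute)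
  show "\<bar>\<integral>z. \<phi> z * gauss2 v (z - y) \<partial>lborel\<bar> \<le> 64 * L / v"
    using *[OF _ gauss12_bound(2)[OF v] gauss12_le(2)[OF v] integral_gauss12(2)[OF v]] by (simp add: mult.commute)
qed

section \<open>The time scale of an increment\<close>

text \<open>
  The distance at time scale \<open>s\<close> travelled by a coordinate whose catalyst is at \<open>X\<close> is of order
  \<open>sqrt (s * (s + X))\<close>; up to constants, \<open>time_scale h X\<close> is the time needed to travel \<open>h\<close>.
\<close>

definition time_scale :: "real \<Rightarrow> real \<Rightarrow> real" where
  "time_scale h X = h\<^sup>2 / (h + X)"

lemma time_scale_nonneg: "0 \<le> h \<Longrightarrow> 0 \<le> X \<Longrightarrow> 0 \<le> time_scale h X"
  by (simp add: time_scale_def)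

lemma time_scale_pos: "0 < h \<Longrightarrow> 0 \<le> X \<Longrightarrow> 0 < time_scale h X"
  by (simp add: time_scale_def add_pos_nonneg)

lemma time_scale_0 [simp]: "time_scale 0 X = 0"
  by (simp add: time_scale_def)

text \<open>For \<open>h \<le> sqrt v\<close> monotonicity in \<open>h\<close> suffices; beyond that
  the denominator only grows and \<open>h\<^sup>2 / v\<close> is left. The factor
  \<open>1 + h\<^sup>2 / v\<close> is the growth that \<open>gauss_convolution_bound\<close>
  tolerates.\<close>

lemma time_scale_growth:
  assumes "0 \<le> h" "0 < v" "0 \<le> X"
  shows "time_scale h X \<le> (1 + h\<^sup>2 / v) * time_scale (sqrt v) X"
proof -
  have v: "0 < sqrt v" "(sqrt v)\<^sup>2 = v" using assms by auto
  show ?thesis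
  proof (cases "h \<le> sqrt v")
    case True
    show ?thesis
    proof (cases "h = 0")
      case False
      then have h: "0 < h" using assms by simp
      have "h * h * sqrt v \<le> v * h" "h * h * X \<le> v * X"
      proof -
        have "h * (h * sqrt v) \<le> sqrt v * (h * sqrt v)" using True h v by (intro mult_right_mono) auto
        then show "h * h * sqrt v \<le> v * h" using assms by (simp add: mult_ac)
        have "h * h \<le> sqrt v * sqrt v" using True h v by (intro mult_mono) auto
        then have "h * h \<le> v" using assms by simp
        then show "h * h * X \<le> v * X" using assms by (intro mult_right_mono) auto
      qed
      then have "h\<^sup>2 * (sqrt v + X) \<le> v * (h + X)" by (simp add: power2_eq_square ring_distribs)
      then have "time_scale h X \<le> 1 * time_scale (sqrt v) X"
        unfolding time_scale_def v(2)
        using add_pos_nonneg[OF h assms(3)] add_pos_nonneg[OF v(1) assms(3)]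
        by (simp add: pos_divide_le_eq pos_le_divide_eq)
      also have "1 * time_scale (sqrt v) X \<le> (1 + h\<^sup>2 / v) * time_scale (sqrt v) X"
        using assms by (intro mult_right_mono time_scale_nonneg) auto
      finally show ?thesis .
    qed (use assms time_scale_nonneg[of "sqrt v" X] in simp)
  next
    case False
    then have "time_scale h X \<le> h\<^sup>2 / (sqrt v + X)"
      unfolding time_scale_def using v assms by (intro divide_left_mono mult_pos_pos add_pos_nonneg; linarith?) auto
    also have "\<dots> = h\<^sup>2 / v * time_scale (sqrt v) X"
      using assms by (simp add: time_scale_def)
    also have "\<dots> \<le> (1 + h\<^sup>2 / v) * time_scale (sqrt v) X"
      using assms by (intro mult_right_mono time_scale_nonneg) auto
    finally show ?thesis .
  qed
qed

text \<open>With \<open>s = K * time_scale h X\<close>, the distance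
  \<open>sqrt (s * (s + X))\<close> is at least \<open>sqrt K * h / 2\<close>. Nothing better than
  \<open>sqrt K\<close> can be expected, since for large \<open>X\<close> the distance behaves like
  \<open>sqrt (s * X)\<close>.\<close>

lemma time_scale_inverse:
  assumes "0 < h" "0 \<le> X" "1 \<le> K"
  shows "K * h\<^sup>2 \<le> 4 * (K * time_scale h X * (K * time_scale h X + X))"
proof -
  let ?s = "time_scale h X"
  have s: "?s * (h + X) = h\<^sup>2" using assms by (simp add: time_scale_def)
  have "0 \<le> (h - X)\<^sup>2" by simp
  then have "(h + X)\<^sup>2 \<le> 4 * (h\<^sup>2 + X * (h + X))"
    using assms by (simp add: power2_eq_square algebra_simps)
  then have "h\<^sup>2 * (h + X)\<^sup>2 \<le> h\<^sup>2 * (4 * (?s * (h + X) + X * (h + X)))"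
    unfolding s by (rule mult_left_mono) simp
  also have "\<dots> = 4 * (?s * (?s + X)) * (h + X)\<^sup>2"
    unfolding s[symmetric] by (simp add: power2_eq_square algebra_simps)
  finally have "h\<^sup>2 \<le> 4 * (?s * (?s + X))"
    using assms by (simp add: mult_le_cancel_right)
  then have "K * h\<^sup>2 \<le> K * (4 * (?s * (?s + X)))" using assms by (intro mult_left_mono) auto
  also have "\<dots> \<le> 4 * (K * ?s * (K * ?s + X))"
  proof -
    have "1 * ?s \<le> K * ?s" using assms time_scale_nonneg[of h X] by (intro mult_right_mono) auto
    then have "K * ?s * (?s + X) \<le> K * ?s * (K * ?s + X)"
      using assms time_scale_nonneg[of h X] by (intro mult_left_mono) auto
    then show ?thesis by simp
  qed
  finally show ?thesis .
qed

text \<open>A substitute for Hoelder's inequality: the random factors are dependent and only first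
  moments are at hand, so products of powers are reduced to sums.\<close>

lemma powr_mult_powr_le:
  fixes A C p r :: real
  assumes "0 \<le> A" "0 \<le> C" "0 \<le> p" "0 \<le> r" "p + r \<le> 1"
  shows "A powr p * C powr r \<le> 1 + A + C"
proof -
  define N where "N = max 1 (max A C)"
  have N: "1 \<le> N" "A \<le> N" "C \<le> N" by (auto simp: N_def)
  have "A powr p * C powr r \<le> N powr p * N powr r"
    using assms N by (intro mult_mono powr_mono2) auto
  also have "\<dots> = N powr (p + r)" by (simp add: powr_add)
  also have "\<dots> \<le> N powr 1" using assms N by (intro powr_mono) auto
  also have "\<dots> \<le> 1 + A + C" using assms N by (simp add: N_def)
  finally show ?thesis .
qed

text \<open>This separates the variance \<open>v\<close> from the terminal catalyst \<open>X\<close>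
  path by path. If \<open>X \<ge> x / 2\<close>, the scale at one standard deviation is controlled
  by \<open>v\<close>, \<open>t\<close> and \<open>x\<close>; otherwise the weight
  \<open>x / t\<close> pays. The exponents \<open>k = 1 / 2\<close> and \<open>k = 1\<close> belong
  to the first and the second derivative.\<close>

lemma time_scale_moment_bound:
  fixes t x v X \<beta> k :: real
  defines "q \<equiv> t * (t + x)"
  assumes t: "0 < t" and x: "0 \<le> x" and v: "0 < v" and X: "0 \<le> X"
    and \<beta>: "0 < \<beta>" "\<beta> \<le> 1 / 2" and k: "1 / 2 \<le> k" "k \<le> 1"
  shows "(q / v) powr k * time_scale (sqrt v) X powr \<beta>
    \<le> t powr \<beta> * (5 + q / v + 2 * (if X < x / 2 then x / t else 0))"
proof -
  let ?R = "q / v" and ?s = "time_scale (sqrt v) X" and ?a = "if X < x / 2 then x / t else 0"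
  define y where "y = ?s / t"
  have q: "0 < q" unfolding q_def using t x by (intro mult_pos_pos) auto
  then have R: "0 < ?R" using v by simp
  have s0: "0 \<le> ?s" using v X by (intro time_scale_nonneg) auto
  then have y0: "0 \<le> y" using t by (simp add: y_def)
  have a0: "0 \<le> ?a" using t x by simp
  have s1: "?s\<^sup>2 \<le> v"
  proof -
    have "?s \<le> v / sqrt v"
      unfolding time_scale_def using v X by (simp, intro divide_left_mono) (auto intro!: mult_pos_pos add_pos_nonneg)
    then have "?s \<le> sqrt v" using v by (simp add: real_div_sqrt)
    then have "?s\<^sup>2 \<le> (sqrt v)\<^sup>2" using s0 by (intro power_mono) auto
    then show ?thesis using v by simp
  qed
  then have y1: "y\<^sup>2 \<le> (t + x) / t / ?R"
  proof -
    have "y\<^sup>2 = ?s\<^sup>2 / t\<^sup>2" by (simp add: y_def power_divide)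
    also have "\<dots> \<le> v / t\<^sup>2" using s1 by (rule divide_right_mono) simp
    also have "\<dots> = (t + x) / t / ?R"
      using add_pos_nonneg[OF t x] t v by (simp add: q_def power2_eq_square)
    finally show ?thesis .
  qed
  \<comment> \<open>The linear bound is for \<open>x > t\<close> and \<open>X \<ge> x / 2\<close>,
    where the denominator of the scale is at least \<open>x / 2\<close>. In the other cases
    \<open>y1\<close> is enough, since \<open>(t + x) / t\<close> is at most 2 or is paid for by the
    weight.\<close>
  have "y \<le> 4 / ?R \<or> y\<^sup>2 \<le> 2 * (1 + ?a) / ?R"
  proof (cases "x \<le> t")
    case True
    then have "(t + x) / t \<le> 2 * (1 + ?a)" using t x a0 by (simp add: field_simps)
    then have "(t + x) / t / ?R \<le> 2 * (1 + ?a) / ?R" using R by (intro divide_right_mono) auto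
    then show ?thesis using y1 by linarith
  next
    case False
    show ?thesis
    proof (cases "X < x / 2")
      case True
      then have "(t + x) / t \<le> 2 * (1 + ?a)" using t x by (simp add: field_simps)
      then have "(t + x) / t / ?R \<le> 2 * (1 + ?a) / ?R" using R by (intro divide_right_mono) auto
      then show ?thesis using y1 by linarith
    next
      case X': False
      have "x / 2 \<le> sqrt v + X" "0 < x / 2" "0 \<le> sqrt v" using v X' False t real_sqrt_ge_zero[of v] by linarith+
      then have "v / (sqrt v + X) \<le> v / (x / 2)" using v by (intro divide_left_mono) auto
      then have "?s \<le> v / (x / 2)" using v by (simp add: time_scale_def)
      then have "y \<le> v / (x / 2) / t" unfolding y_def using t by (intro divide_right_mono) auto
      also have "\<dots> = 2 * (t + x) / x / ?R"
      proof -
        have "t + x \<noteq> 0" "x \<noteq> 0" using False t by auto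
        then show ?thesis using t v by (simp add: q_def divide_simps)
      qed
      also have "\<dots> \<le> 4 / ?R"
        using R False t by (intro divide_right_mono) (auto simp: field_simps)
      finally show ?thesis ..
    qed
  qed
  then have "?R powr k * y powr \<beta> \<le> 5 + ?R + 2 * ?a"
  proof
    assume "y \<le> 4 / ?R"
    then have "?R powr k * y powr \<beta> \<le> ?R powr k * (4 / ?R) powr \<beta>"
      using \<beta> y0 by (intro mult_left_mono powr_mono2) auto
    also have "\<dots> = ?R powr (k - \<beta>) * 4 powr \<beta>"
      using R powr_divide[of 4 ?R \<beta>] by (simp only: powr_diff) simp
    also have "\<dots> \<le> 1 + ?R + 4" using R \<beta> k by (intro powr_mult_powr_le) auto
    finally show ?thesis using a0 by linarith
  next
    assume y2: "y\<^sup>2 \<le> 2 * (1 + ?a) / ?R"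
    have "y powr \<beta> = (y\<^sup>2) powr (\<beta> / 2)"
      using y0 by (simp add: powr_powr flip: powr_numeral)
    also have "\<dots> \<le> (2 * (1 + ?a) / ?R) powr (\<beta> / 2)" using \<beta> y2 by (intro powr_mono2) auto
    finally have "?R powr k * y powr \<beta> \<le> ?R powr k * (2 * (1 + ?a) / ?R) powr (\<beta> / 2)"
      by (intro mult_left_mono) auto
    also have "\<dots> = ?R powr (k - \<beta> / 2) * (2 * (1 + ?a)) powr (\<beta> / 2)"
      using R a0 by (simp only: powr_divide powr_diff) simp
    also have "\<dots> \<le> 1 + ?R + 2 * (1 + ?a)" using R a0 \<beta> k by (intro powr_mult_powr_le) auto
    finally show ?thesis by simp
  qed
  moreover have "?s powr \<beta> = t powr \<beta> * y powr \<beta>"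
    using t s0 by (simp add: y_def powr_divide)
  ultimately show ?thesis
    using mult_left_mono[of "?R powr k * y powr \<beta>" "5 + ?R + 2 * ?a" "t powr \<beta>"] by (simp add: mult_ac)
qed

lemma powr_le_2_plus: "0 \<le> (R::real) \<Longrightarrow> 0 \<le> k \<Longrightarrow> k \<le> 1 \<Longrightarrow> R powr k \<le> 2 + R"
  using powr_mult_powr_le[of R 1 k 0] by simp

section \<open>Differentiating the semigroup in a reactant\<close>

locale catalytic =
  fixes E :: "('v::finite \<times> 'v) set" and x0 :: "real ^ 'v" and b \<gamma> :: "'v \<Rightarrow> real"
    and P :: "'v \<Rightarrow> real \<Rightarrow> (real \<Rightarrow> real) measure" and M :: real
  assumes net: "network E" and x0: "x0 \<in> net_states E" and adm: "admissible_coeffs E x0 b \<gamma>"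
    and cb: "coeff_bound E x0 b \<gamma> \<le> M"
    and laws: "\<And>i y. i \<in> NC2 E x0 \<Longrightarrow> 0 \<le> y \<Longrightarrow> feller_law (b i) (\<gamma> i) y (P i y)"
begin

abbreviation "R0 \<equiv> NR E x0"
abbreviation "C0 \<equiv> NC2 E x0"
abbreviation "S \<equiv> S0 E x0"
abbreviation "PS \<equiv> Pt E x0 b \<gamma> P"

section \<open>Consequences of the conditions on network and coefficients\<close>

lemma coeff_le: "\<gamma> i \<le> M" "inverse (\<gamma> i) \<le> M" "\<bar>b i\<bar> \<le> M"
  and coeff_le': "i \<in> (reactants E \<union> catalysts E) \<inter> zero_set x0 \<Longrightarrow> inverse (b i) \<le> M"
proof -
  let ?S = "(\<Union>i. {\<gamma> i, inverse (\<gamma> i), \<bar>b i\<bar>}) \<union>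
          (\<lambda>i. inverse (b i)) ` ((reactants E \<union> catalysts E) \<inter> zero_set x0)"
  have "finite ?S" by (intro finite_UnI finite_imageI finite_UN_I) auto
  then have *: "z \<le> M" if "z \<in> ?S" for z
    using Max_ge[of ?S z] that cb unfolding coeff_bound_def by linarith
  show "\<gamma> i \<le> M" "inverse (\<gamma> i) \<le> M" "\<bar>b i\<bar> \<le> M" by (rule *, blast)+
  show "inverse (b i) \<le> M" if "i \<in> (reactants E \<union> catalysts E) \<inter> zero_set x0"
    by (rule *) (use that in blast)
qed

lemma \<gamma>_pos: "0 < \<gamma> i"
  using adm by (simp add: admissible_coeffs_def)

lemma M_ge_1: "1 \<le> M"
proof -
  \<comment> \<open>\<open>undefined\<close> stands for an arbitrary vertex: \<open>\<gamma>\<close>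
    there and its inverse have product 1 and are both at most \<open>M\<close>.\<close>
  have "0 \<le> inverse (\<gamma> undefined)" "0 < \<gamma> undefined" using \<gamma>_pos[of undefined] by auto
  then have "\<gamma> undefined * inverse (\<gamma> undefined) \<le> M * M"
    using coeff_le[of undefined] by (intro mult_mono) auto
  moreover have "\<gamma> undefined * inverse (\<gamma> undefined) = 1" using \<gamma>_pos[of undefined] by simp
  moreover have "0 \<le> M" using coeff_le(1)[of undefined] \<gamma>_pos[of undefined] by linarith
  ultimately show ?thesis using power2_le_imp_le[of 1 M] by (simp add: power2_eq_square)
qed

lemma \<gamma>_ge: "1 / M \<le> \<gamma> i"
  using coeff_le(2)[of i] \<gamma>_pos[of i] M_ge_1 by (simp add: field_simps)

lemma x0_nonneg: "0 \<le> x0 $ i"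
  using x0 by (simp add: net_states_def)

lemma reactant_pos:
  assumes "j \<in> reactants E" shows "0 < (\<Sum>i\<in>cat_of E j. x0 $ i) + x0 $ j"
proof -
  have "0 < (\<Prod>j\<in>reactants E. (\<Sum>i\<in>cat_of E j. x0 $ i) + x0 $ j)"
    using x0 by (simp add: net_states_def)
  from less_imp_neq[OF this, THEN not_sym] have "(\<Sum>i\<in>cat_of E j. x0 $ i) + x0 $ j \<noteq> 0"
    using assms by (subst (asm) prod_zero_iff) auto
  then show ?thesis using x0_nonneg by (simp add: less_le sum_nonneg)
qed

lemma cat_zero:
  assumes "j \<in> R0" "i \<in> cat_of E j" shows "x0 $ i = 0"
proof -
  have "(\<Sum>i\<in>cat_of E j. x0 $ i) = 0" using assms by (simp add: NR_def)
  then show ?thesis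
    using assms x0_nonneg by (subst (asm) sum_nonneg_eq_0_iff) auto
qed

text \<open>If a vertex of \<open>R0\<close> were also a catalyst of one, both its own value and the
  sum over its catalysts would vanish at \<open>x0\<close>, against the positivity of its factor in
  \<open>net_states\<close>.\<close>

lemma NR_notin_NC2: "j \<in> R0 \<Longrightarrow> j \<notin> C0"
proof
  assume j: "j \<in> R0" "j \<in> C0"
  then have "j \<in> NC E x0" by (auto simp: NC2_def N2_def)
  then obtain k where "k \<in> R0" "j \<in> cat_of E k" by (auto simp: NC_def)
  then have "x0 $ j = 0" by (rule cat_zero)
  moreover have "(\<Sum>i\<in>cat_of E j. x0 $ i) = 0" "j \<in> reactants E" using j by (auto simp: NR_def)
  ultimately show False using reactant_pos[of j] by simp
qed

lemma in_NC2_iff: "i \<in> C0 \<longleftrightarrow> i \<notin> R0"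
  using NR_notin_NC2[of i] by (auto simp: NC2_def N2_def)

lemma cat_in_NC2: "j \<in> R0 \<Longrightarrow> i \<in> cat_of E j \<Longrightarrow> i \<in> C0"
  by (auto simp: NC2_def NC_def)

lemma cat_nonempty: "j \<in> R0 \<Longrightarrow> cat_of E j \<noteq> {}"
  by (force simp: NR_def reactants_def cat_of_def)

lemma b_nonneg: "i \<in> C0 \<Longrightarrow> 0 \<le> b i"
  using adm in_NC2_iff by (auto simp: admissible_coeffs_def)

text \<open>Catalysts of \<open>R0\<close> vanish at \<open>x0\<close> by \<open>cat_zero\<close>,
  so the bound on inverse immigration rates in \<open>coeff_bound\<close> covers them.\<close>

lemma b_ge:
  assumes "j \<in> R0" "i \<in> cat_of E j" shows "1 / M \<le> b i"
proof -
  have i: "i \<in> (reactants E \<union> catalysts E) \<inter> zero_set x0"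
    using assms cat_zero by (force simp: zero_set_def catalysts_def cat_of_def)
  then have "0 < b i" using adm by (simp add: admissible_coeffs_def)
  then show ?thesis using coeff_le'[OF i] M_ge_1 by (simp add: field_simps)
qed

lemma feller: "i \<in> C0 \<Longrightarrow> 0 \<le> y \<Longrightarrow> feller (b i) (\<gamma> i) y (P i y)"
  by standard (auto simp: laws b_nonneg \<gamma>_pos)

lemma shift_in_S: "x \<in> S \<Longrightarrow> j \<in> R0 \<Longrightarrow> x + h *\<^sub>R axis j 1 \<in> S"
  using NR_notin_NC2 by (auto simp: S0_def axis_def)

lemma S_nonneg: "x \<in> S \<Longrightarrow> i \<in> C0 \<Longrightarrow> 0 \<le> x $ i"
  by (simp add: S0_def)

section \<open>The product law of the Feller coordinates\<close>

definition Q :: "real ^ 'v \<Rightarrow> ('v \<Rightarrow> real \<Rightarrow> real) measure" where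
  "Q x = (\<Pi>\<^sub>M i\<in>C0. P i (x $ i))"

text \<open>The law does not see a shift in a reactant coordinate, so differentiating in that
  coordinate acts on the Gaussian kernel alone.\<close>

lemma Q_shift: "j \<in> R0 \<Longrightarrow> Q (x + h *\<^sub>R axis j 1) = Q x"
  unfolding Q_def by (rule PiM_cong) (use NR_notin_NC2 in \<open>auto simp: axis_def\<close>)

context
  fixes x :: "real ^ 'v"
  assumes x: "x \<in> S"
begin

lemma feller_x: "i \<in> C0 \<Longrightarrow> feller (b i) (\<gamma> i) (x $ i) (P i (x $ i))"
  by (rule feller) (auto intro: S_nonneg[OF x])

lemma prob_space_P: "i \<in> C0 \<Longrightarrow> prob_space (P i (x $ i))"
  using laws[OF _ S_nonneg[OF x]] by (simp add: feller_law_def)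

lemma prob_space_Q: "prob_space (Q x)"
  unfolding Q_def by (rule prob_space_PiM) (rule prob_space_P)

lemma distr_Q: "i \<in> C0 \<Longrightarrow> distr (Q x) (P i (x $ i)) (\<lambda>\<omega>. \<omega> i) = P i (x $ i)"
  unfolding Q_def by (rule distr_PiM_component[OF prob_space_P])

lemma measurable_component: "i \<in> C0 \<Longrightarrow> (\<lambda>\<omega>. \<omega> i) \<in> Q x \<rightarrow>\<^sub>M P i (x $ i)"
  unfolding Q_def by (rule measurable_component_singleton)

lemma measurable_component_path: "i \<in> C0 \<Longrightarrow> (\<lambda>\<omega>. \<omega> i) \<in> Q x \<rightarrow>\<^sub>M path_space"
  using measurable_component[of i] measurable_cong_sets[OF refl feller.sets_P[OF feller_x]] by blast

lemma space_Q: "\<omega> \<in> space (Q x) \<Longrightarrow> i \<in> C0 \<Longrightarrow> \<omega> i \<in> space path_space"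
  using measurable_space[OF measurable_component_path] by blast

lemma integral_component:
  fixes g :: "(real \<Rightarrow> real) \<Rightarrow> real"
  assumes "i \<in> C0" "g \<in> borel_measurable path_space"
  shows "(\<integral>\<omega>. g (\<omega> i) \<partial>Q x) = (\<integral>w. g w \<partial>P i (x $ i))"
    and "integrable (Q x) (\<lambda>\<omega>. g (\<omega> i)) \<longleftrightarrow> integrable (P i (x $ i)) g"
proof -
  have g: "g \<in> borel_measurable (P i (x $ i))"
    by (rule feller.measurable_P[OF feller_x[OF assms(1)] assms(2)])
  show "(\<integral>\<omega>. g (\<omega> i) \<partial>Q x) = (\<integral>w. g w \<partial>P i (x $ i))"
    using integral_distr[OF measurable_component[OF assms(1)] g] distr_Q[OF assms(1)] by simp
  show "integrable (Q x) (\<lambda>\<omega>. g (\<omega> i)) \<longleftrightarrow> integrable (P i (x $ i)) g"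
    using integrable_distr_eq[OF measurable_component[OF assms(1)] g] distr_Q[OF assms(1)] by simp
qed

lemma AE_component:
  assumes "i \<in> C0" "AE w in P i (x $ i). R w" shows "AE \<omega> in Q x. R (\<omega> i)"
  unfolding Q_def by (rule AE_PiM_component[of C0 "\<lambda>i. P i (x $ i)" i R, OF prob_space_P assms])

lemma cat_integral_eq_sum:
  assumes "j \<in> R0" "\<omega> \<in> space (Q x)"
  shows "cat_integral E j t \<omega> = (\<Sum>i\<in>cat_of E j. area t (\<omega> i))"
  unfolding cat_integral_def path_int_def set_lebesgue_integral_def scaleR_sum_right
proof (rule Bochner_Integration.integral_sum)
  fix i assume "i \<in> cat_of E j"
  then have "\<omega> i \<in> space path_space" using assms by (intro space_Q cat_in_NC2)
  from path_int_integrable[OF this continuous_on_id order.refl]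
  show "integrable lborel (\<lambda>s. indicator {0..t} s *\<^sub>R \<omega> i s)" by (simp add: set_integrable_def)
qed

lemma path_int_component_nonneg:
  assumes "i \<in> C0" "\<omega> \<in> space (Q x)" shows "0 \<le> area t (\<omega> i)"
  using feller.area_nonneg[OF feller_x[OF assms(1)]] space_Q[OF assms(2,1)] by blast

lemma cat_integral_ge:
  assumes "j \<in> R0" "i \<in> cat_of E j" "\<omega> \<in> space (Q x)"
  shows "area t (\<omega> i) \<le> cat_integral E j t \<omega>"
  unfolding cat_integral_eq_sum[OF assms(1,3)]
  by (rule member_le_sum) (use assms path_int_component_nonneg cat_in_NC2 in auto)

lemma cat_integral_nonneg:
  assumes "j \<in> R0" "\<omega> \<in> space (Q x)" shows "0 \<le> cat_integral E j t \<omega>"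
  unfolding cat_integral_eq_sum[OF assms]
  by (rule sum_nonneg) (use assms path_int_component_nonneg cat_in_NC2 in auto)

lemma measurable_cat_integral:
  assumes "j \<in> R0" "0 \<le> t" shows "cat_integral E j t \<in> borel_measurable (Q x)"
proof -
  have "(\<lambda>\<omega>. \<Sum>i\<in>cat_of E j. area t (\<omega> i)) \<in> borel_measurable (Q x)"
  proof (rule borel_measurable_sum)
    fix i assume "i \<in> cat_of E j"
    then show "(\<lambda>\<omega>. area t (\<omega> i)) \<in> borel_measurable (Q x)"
      using assms by (intro measurable_compose[OF measurable_component_path measurable_path_int[OF continuous_on_id[unfolded id_def]]] cat_in_NC2)
  qed
  then show ?thesis
    using measurable_cong[of "Q x" "cat_integral E j t", OF cat_integral_eq_sum[OF assms(1)]] by blast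
qed

lemma measurable_eval:
  assumes "i \<in> C0" "0 \<le> t" shows "(\<lambda>\<omega>. \<omega> i t) \<in> borel_measurable (Q x)"
  by (rule measurable_compose[OF measurable_component_path measurable_path_eval]) (use assms in auto)

end

definition variance_of :: "'v \<Rightarrow> real \<Rightarrow> ('v \<Rightarrow> real \<Rightarrow> real) \<Rightarrow> real" where
  "variance_of j t \<omega> = 2 * \<gamma> j * cat_integral E j t \<omega>"

text \<open>Any single catalyst \<open>i\<close> of \<open>j\<close> suffices, as its area is a
  lower bound for the whole catalyst integral and \<open>\<gamma> j \<ge> 1 / M\<close>. The
  constant is \<open>M / 2\<close> times the \<open>12 * M ^ 3\<close> of
  \<open>inverse_moment_path_int\<close>.\<close>

lemma variance_of_moments:
  assumes x: "x \<in> S" and j: "j \<in> R0" and i: "i \<in> cat_of E j" and t: "0 < t"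
  shows "AE \<omega> in Q x. 0 < variance_of j t \<omega>"
    and "integrable (Q x) (\<lambda>\<omega>. t * (t + x $ i) / variance_of j t \<omega>)"
    and "(\<integral>\<omega>. t * (t + x $ i) / variance_of j t \<omega> \<partial>Q x) \<le> 6 * M ^ 4"
proof -
  have iC: "i \<in> C0" by (rule cat_in_NC2[OF j i])
  interpret F: feller "b i" "\<gamma> i" "x $ i" "P i (x $ i)" by (rule feller_x[OF x iC])
  let ?I = "area t" and ?q = "t * (t + x $ i)"
  have xi: "0 \<le> x $ i" by (rule S_nonneg[OF x iC])
  have q: "0 < ?q" using t xi by (intro mult_pos_pos) auto
  have M: "0 < M" using M_ge_1 by simp
  have "0 < b i" using b_ge[OF j i] M by (rule_tac less_le_trans[of 0 "1 / M"]) auto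
  then have ae: "AE \<omega> in Q x. 0 < ?I (\<omega> i)"
    by (intro AE_component[OF x iC] F.AE_path_int_pos[OF t])
  have le: "2 / M * ?I (\<omega> i) \<le> variance_of j t \<omega>" if "\<omega> \<in> space (Q x)" for \<omega>
  proof -
    have "(2 / M) * ?I (\<omega> i) \<le> (2 * \<gamma> j) * cat_integral E j t \<omega>"
      using \<gamma>_ge[of j] \<gamma>_pos[of j]
      by (intro mult_mono cat_integral_ge[OF x j i that] path_int_component_nonneg[OF x iC that]) auto
    then show ?thesis by (simp add: variance_of_def)
  qed
  have ae2: "AE \<omega> in Q x. 0 < ?I (\<omega> i) \<and> 2 / M * ?I (\<omega> i) \<le> variance_of j t \<omega>"
    using ae AE_space by eventually_elim (use le in auto)
  show pos: "AE \<omega> in Q x. 0 < variance_of j t \<omega>"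
    using ae2
  proof eventually_elim
    fix \<omega> assume "0 < ?I (\<omega> i) \<and> 2 / M * ?I (\<omega> i) \<le> variance_of j t \<omega>"
    moreover from this have "0 < 2 / M * ?I (\<omega> i)" using M by (intro mult_pos_pos) auto
    ultimately show "0 < variance_of j t \<omega>" by linarith
  qed
  have bound: "AE \<omega> in Q x. ?q / variance_of j t \<omega> \<le> ?q * M / 2 * (1 / ?I (\<omega> i))"
    using ae2
  proof eventually_elim
    fix \<omega> assume *: "0 < ?I (\<omega> i) \<and> 2 / M * ?I (\<omega> i) \<le> variance_of j t \<omega>"
    then have "?q / variance_of j t \<omega> \<le> ?q / (2 / M * ?I (\<omega> i))"
      using q M by (intro divide_left_mono mult_pos_pos) (auto intro: less_le_trans[of 0 "2 / M * ?I (\<omega> i)"])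
    then show "?q / variance_of j t \<omega> \<le> ?q * M / 2 * (1 / ?I (\<omega> i))" using M by (simp add: field_simps)
  qed
  have mI: "(\<lambda>w. 1 / ?I w) \<in> borel_measurable path_space"
    using t by (intro borel_measurable_divide measurable_path_int continuous_on_id[unfolded id_def]) auto
  note mom = F.inverse_moment_path_int[OF t M_ge_1 coeff_le(1) b_ge[OF j i]]
  have int: "integrable (Q x) (\<lambda>\<omega>. ?q * M / 2 * (1 / ?I (\<omega> i)))"
    using mom(1) integral_component(2)[OF x iC mI] by (intro integrable_mult_right) simp
  have meas: "(\<lambda>\<omega>. ?q / variance_of j t \<omega>) \<in> borel_measurable (Q x)"
    unfolding variance_of_def using measurable_cat_integral[OF x j] t
    by (intro borel_measurable_divide borel_measurable_times) auto
  show i1: "integrable (Q x) (\<lambda>\<omega>. ?q / variance_of j t \<omega>)"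
  proof (rule Bochner_Integration.integrable_bound[OF int meas])
    show "AE \<omega> in Q x. norm (?q / variance_of j t \<omega>) \<le> norm (?q * M / 2 * (1 / ?I (\<omega> i)))"
      using bound pos ae
    proof eventually_elim
      fix \<omega> assume *: "?q / variance_of j t \<omega> \<le> ?q * M / 2 * (1 / ?I (\<omega> i))" "0 < variance_of j t \<omega>"
      then have "0 \<le> ?q / variance_of j t \<omega>" using q by (intro divide_nonneg_pos) auto
      from *(1) show "norm (?q / variance_of j t \<omega>) \<le> norm (?q * M / 2 * (1 / ?I (\<omega> i)))"
        unfolding real_norm_def abs_of_nonneg[OF \<open>0 \<le> ?q / variance_of j t \<omega>\<close>] by (rule order_trans[OF _ abs_ge_self])
    qed
  qed
  have "(\<integral>\<omega>. ?q / variance_of j t \<omega> \<partial>Q x) \<le> (\<integral>\<omega>. ?q * M / 2 * (1 / ?I (\<omega> i)) \<partial>Q x)"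
    by (rule integral_mono_AE[OF i1 int bound])
  also have "\<dots> = ?q * M / 2 * (\<integral>\<omega>. 1 / ?I (\<omega> i) \<partial>Q x)" by (rule integral_mult_right_zero)
  also have "\<dots> = ?q * M / 2 * (\<integral>w. 1 / ?I w \<partial>P i (x $ i))"
    using integral_component(1)[OF x iC mI] by simp
  also have "\<dots> \<le> ?q * M / 2 * (12 * M ^ 3 / ?q)"
    using q M by (intro mult_left_mono[OF mom(2)]) auto
  also have "\<dots> = 6 * M ^ 4" using q by (simp add: field_simps power_numeral_reduce)
  finally show "(\<integral>\<omega>. ?q / variance_of j t \<omega> \<partial>Q x) \<le> 6 * M ^ 4" .
qed

text \<open>The weight \<open>x $ i / t\<close> is the reciprocal of the order of the probability in
  \<open>prob_half_le\<close>, so the expectation stays bounded. The constant is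
  \<open>144 * (M + M)\<close>.\<close>

lemma low_catalyst_moment:
  assumes x: "x \<in> S" and j: "j \<in> R0" and i: "i \<in> cat_of E j" and t: "0 < t"
  shows "integrable (Q x) (\<lambda>\<omega>. if \<omega> i t < x $ i / 2 then x $ i / t else 0)"
    and "(\<integral>\<omega>. (if \<omega> i t < x $ i / 2 then x $ i / t else 0) \<partial>Q x) \<le> 288 * M"
proof -
  have iC: "i \<in> C0" by (rule cat_in_NC2[OF j i])
  interpret F: feller "b i" "\<gamma> i" "x $ i" "P i (x $ i)" by (rule feller_x[OF x iC])
  have xi: "0 \<le> x $ i" by (rule S_nonneg[OF x iC])
  let ?g = "\<lambda>w :: real \<Rightarrow> real. if w t < x $ i / 2 then x $ i / t else 0"
  have [measurable]: "(\<lambda>w. w t) \<in> borel_measurable path_space"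
    by (rule measurable_path_eval) (use t in simp)
  have g: "?g \<in> borel_measurable path_space" by measurable
  have gP: "?g \<in> borel_measurable (P i (x $ i))" by (rule F.measurable_P[OF g])
  have ig: "integrable (P i (x $ i)) ?g"
    by (rule F.integrable_const_bound[where B="x $ i / t", OF _ gP]) (use t xi in auto)
  then show "integrable (Q x) (\<lambda>\<omega>. ?g (\<omega> i))" using integral_component(2)[OF x iC g] by simp
  let ?A = "{w \<in> space (P i (x $ i)). w t < x $ i / 2}"
  have A: "?A \<in> sets (P i (x $ i))"
  proof -
    have [measurable]: "(\<lambda>w. w t) \<in> borel_measurable (P i (x $ i))"
      by (rule F.measurable_P, rule measurable_path_eval) (use t in simp)
    show ?thesis by measurable
  qed
  have "(\<integral>\<omega>. ?g (\<omega> i) \<partial>Q x) = (\<integral>w. ?g w \<partial>P i (x $ i))" by (rule integral_component(1)[OF x iC g])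
  also have "\<dots> = (\<integral>w. indicator ?A w * (x $ i / t) \<partial>P i (x $ i))"
    by (rule Bochner_Integration.integral_cong) (auto simp: indicator_def)
  also have "\<dots> = F.prob ?A * (x $ i / t)" using A by simp
  also have "\<dots> \<le> 288 * M"
  proof (cases "x $ i = 0")
    case False
    then have "F.prob ?A * (x $ i / t) \<le> 144 * (b i + \<gamma> i)" using xi by (intro F.prob_half_le[OF t]) simp
    also have "\<dots> \<le> 144 * (M + M)"
      using coeff_le(1)[of i] abs_le_D1[OF coeff_le(3)[of i]] by (intro mult_left_mono add_mono) auto
    also have "\<dots> = 288 * M" by simp
    finally show ?thesis .
  qed (use M_ge_1 in simp)
  finally show "(\<integral>\<omega>. ?g (\<omega> i) \<partial>Q x) \<le> 288 * M" .
qed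

end

section \<open>Integrating out all reactant coordinates but one\<close>

interpretation lborel_product: product_sigma_finite "\<lambda>_ :: 'i. lborel :: real measure"
  by standard

abbreviation LR :: "'i set \<Rightarrow> ('i \<Rightarrow> real) measure" where
  "LR I \<equiv> (\<Pi>\<^sub>M k\<in>I. lborel)"

lemma measurable_coordinate: "k \<in> I \<Longrightarrow> (\<lambda>z. z k) \<in> borel_measurable (LR I)"
  using measurable_component_singleton[of k I "\<lambda>_. lborel :: real measure"] by simp

lemma sigma_finite_LR: "finite I \<Longrightarrow> sigma_finite_measure (LR I)"
  by (rule lborel_product.sigma_finite)

context catalytic begin

definition state :: "real \<Rightarrow> ('v \<Rightarrow> real \<Rightarrow> real) \<Rightarrow> ('v \<Rightarrow> real) \<Rightarrow> real ^ 'v" where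
  "state t \<omega> z = (\<chi> k. if k \<in> R0 then z k else \<omega> k t)"

definition kernel :: "'v set \<Rightarrow> real \<Rightarrow> real ^ 'v \<Rightarrow> ('v \<Rightarrow> real \<Rightarrow> real) \<Rightarrow> ('v \<Rightarrow> real) \<Rightarrow> real" where
  "kernel I t x \<omega> z = (\<Prod>k\<in>I. gauss (variance_of k t \<omega>) (z k - x $ k - b k * t))"

lemma Pt_eq:
  "PS t f x = (\<integral>\<omega>. \<integral>z. f (state t \<omega> z) * kernel R0 t x \<omega> z \<partial>(LR R0) \<partial>Q x)"
  unfolding Pt_def state_def kernel_def variance_of_def Q_def ..

text \<open>The function that is convolved with the Gaussian of coordinate \<open>j\<close> once the
  other reactants are integrated out. It does not depend on \<open>x $ j\<close>, so derivatives
  fall on the Gaussian.\<close>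

definition marginal :: "'v \<Rightarrow> real \<Rightarrow> real ^ 'v \<Rightarrow> (real ^ 'v \<Rightarrow> real) \<Rightarrow> ('v \<Rightarrow> real \<Rightarrow> real) \<Rightarrow> real \<Rightarrow> real" where
  "marginal j t x f \<omega> r =
     (\<integral>z. f (state t \<omega> (z(j := r))) * kernel (R0 - {j}) t x \<omega> z \<partial>(LR (R0 - {j})))"

context
  fixes x :: "real ^ 'v" and t :: real
  assumes x: "x \<in> S" and t: "0 < t"
begin

lemma variance_of_nonneg: "k \<in> R0 \<Longrightarrow> \<omega> \<in> space (Q x) \<Longrightarrow> 0 \<le> variance_of k t \<omega>"
  unfolding variance_of_def using cat_integral_nonneg[OF x] \<gamma>_pos[of k] by (intro mult_nonneg_nonneg) auto

lemma measurable_variance_of: "k \<in> R0 \<Longrightarrow> variance_of k t \<in> borel_measurable (Q x)"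
  unfolding variance_of_def[abs_def]
  using measurable_cat_integral[OF x] t by (intro borel_measurable_times) auto

lemma kernel_nonneg: "0 \<le> kernel I t x' \<omega> z"
  unfolding kernel_def by (intro prod_nonneg) (simp add: gauss_nonneg)

text \<open>The mass is a product of factors that are 1 for positive and 0 for vanishing
  variance.\<close>

lemma kernel_integral:
  assumes "I \<subseteq> R0" "\<omega> \<in> space (Q x)"
  shows "integrable (LR I) (kernel I t x' \<omega>)"
    and "(\<integral>z. kernel I t x' \<omega> z \<partial>(LR I)) \<le> 1"
proof -
  have i: "integrable lborel (\<lambda>z. gauss (variance_of k t \<omega>) (z - x' $ k - b k * t))" if "k \<in> I" for k
    using integrable_gauss[OF variance_of_nonneg, of k \<omega> "x' $ k + b k * t"] that assms
    by (auto simp: diff_diff_eq)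
  have le: "(\<integral>z. gauss (variance_of k t \<omega>) (z - x' $ k - b k * t) \<partial>lborel) \<le> 1" if "k \<in> I" for k
    using integral_gauss_le_1[OF variance_of_nonneg, of k \<omega> "x' $ k + b k * t"] that assms
    by (auto simp: diff_diff_eq)
  show "integrable (LR I) (kernel I t x' \<omega>)"
    unfolding kernel_def[abs_def] by (rule lborel_product.product_integrable_prod[OF finite i])
  have "(\<integral>z. kernel I t x' \<omega> z \<partial>(LR I)) =
    (\<Prod>k\<in>I. \<integral>z. gauss (variance_of k t \<omega>) (z - x' $ k - b k * t) \<partial>lborel)"
    unfolding kernel_def by (rule lborel_product.product_integral_prod[OF finite i])
  also have "\<dots> \<le> 1"
    by (intro prod_le_1 conjI le integral_nonneg_AE) (auto simp: gauss_nonneg)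
  finally show "(\<integral>z. kernel I t x' \<omega> z \<partial>(LR I)) \<le> 1" .
qed

lemma state_in_S: "\<omega> \<in> space (Q x) \<Longrightarrow> state t \<omega> z \<in> S"
  using space_Q[OF x, of \<omega>] t by (auto simp: S0_def state_def in_NC2_iff space_path_space)

lemma measurable_state:
  assumes f: "f \<in> borel_measurable (restrict_space borel S)"
  shows "(\<lambda>p. f (state t (fst p) (snd p))) \<in> borel_measurable (Q x \<Otimes>\<^sub>M LR R0)"
proof (rule measurable_compose[OF _ f], rule measurable_restrict_space2)
  show "(\<lambda>p. state t (fst p) (snd p)) \<in> space (Q x \<Otimes>\<^sub>M LR R0) \<rightarrow> S"
    using state_in_S by (auto simp: space_pair_measure)
  have "(\<lambda>p. state t (fst p) (snd p) $ k) \<in> borel_measurable (Q x \<Otimes>\<^sub>M LR R0)" for k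
  proof (cases "k \<in> R0")
    case True
    have "(\<lambda>p. snd p k) \<in> borel_measurable (Q x \<Otimes>\<^sub>M LR R0)"
      by (rule measurable_compose[OF measurable_snd measurable_coordinate[OF True]])
    then show ?thesis using True by (simp add: state_def)
  next
    case False
    have "(\<lambda>p. fst p k t) \<in> borel_measurable (Q x \<Otimes>\<^sub>M LR R0)"
      using False t by (intro measurable_compose[OF measurable_fst measurable_eval[OF x]]) (auto simp: in_NC2_iff)
    then show ?thesis using False by (simp add: state_def)
  qed
  then show "(\<lambda>p. state t (fst p) (snd p)) \<in> borel_measurable (Q x \<Otimes>\<^sub>M LR R0)"
    by (subst borel_measurable_euclidean_space) (auto simp: Basis_vec_def inner_axis)
qed

lemma measurable_kernel:
  "(\<lambda>p. kernel R0 t x' (fst p) (snd p)) \<in> borel_measurable (Q x \<Otimes>\<^sub>M LR R0)"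
  unfolding kernel_def
proof (rule borel_measurable_prod)
  fix k assume k: "k \<in> R0"
  have [measurable]: "(\<lambda>p. variance_of k t (fst p)) \<in> borel_measurable (Q x \<Otimes>\<^sub>M LR R0)"
    by (rule measurable_compose[OF measurable_fst measurable_variance_of[OF k]])
  have [measurable]: "(\<lambda>p. snd p k) \<in> borel_measurable (Q x \<Otimes>\<^sub>M LR R0)"
    by (rule measurable_compose[OF measurable_snd measurable_coordinate[OF k]])
  show "(\<lambda>p. gauss (variance_of k t (fst p)) (snd p k - x' $ k - b k * t))
      \<in> borel_measurable (Q x \<Otimes>\<^sub>M LR R0)"
    by measurable
qed

context
  fixes f :: "real ^ 'v \<Rightarrow> real" and B :: real and j :: 'v
  assumes f: "f \<in> borel_measurable (restrict_space borel S)" and B: "\<And>y. y \<in> S \<Longrightarrow> \<bar>f y\<bar> \<le> B"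
    and j: "j \<in> R0"
begin

lemma measurable_inner:
  "(\<lambda>\<omega>. \<integral>z. f (state t \<omega> z) * kernel R0 t x' \<omega> z \<partial>(LR R0)) \<in> borel_measurable (Q x)"
proof (rule sigma_finite_measure.borel_measurable_lebesgue_integral)
  show "sigma_finite_measure (LR R0)"
    by (rule sigma_finite_LR[OF finite])
  show "(\<lambda>(\<omega>, z). f (state t \<omega> z) * kernel R0 t x' \<omega> z) \<in> borel_measurable (Q x \<Otimes>\<^sub>M LR R0)"
    using borel_measurable_times[OF measurable_state[OF f] measurable_kernel] by (simp add: split_beta')
qed

lemma measurable_state_fixed:
  assumes "\<omega> \<in> space (Q x)"
  shows "(\<lambda>z. f (state t \<omega> z)) \<in> borel_measurable (LR R0)"
  using measurable_compose[OF measurable_Pair1'[OF assms] measurable_state[OF f]] by simp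

lemma R0_insert: "insert j (R0 - {j}) = R0"
  using j by auto

lemma measurable_state_upd:
  assumes "\<omega> \<in> space (Q x)"
  shows "(\<lambda>p. f (state t \<omega> ((snd p)(j := fst p)))) \<in> borel_measurable (lborel \<Otimes>\<^sub>M LR (R0 - {j}))"
proof -
  have "(\<lambda>p. (snd p)(j := fst p)) \<in> lborel \<Otimes>\<^sub>M LR (R0 - {j}) \<rightarrow>\<^sub>M (LR (insert j (R0 - {j})))"
    using measurable_compose[OF measurable_pair_swap' measurable_add_dim[of j "R0 - {j}" "\<lambda>_. lborel"]]
    by (simp add: split_beta')
  then show ?thesis
    unfolding R0_insert by (rule measurable_compose[OF _ measurable_state_fixed[OF assms]])
qed

lemma measurable_kernel_fixed: "kernel I t x' \<omega> \<in> borel_measurable (LR I)"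
  unfolding kernel_def[abs_def]
proof (rule borel_measurable_prod)
  fix k assume k: "k \<in> I"
  have [measurable]: "(\<lambda>z. z k) \<in> borel_measurable (LR I)"
    by (rule measurable_coordinate[OF k])
  show "(\<lambda>z. gauss (variance_of k t \<omega>) (z k - x' $ k - b k * t)) \<in> borel_measurable (LR I)"
    by measurable
qed

lemma measurable_marginal:
  assumes "\<omega> \<in> space (Q x)"
  shows "marginal j t x f \<omega> \<in> borel_measurable borel"
proof -
  have "(\<lambda>r. marginal j t x f \<omega> r) \<in> borel_measurable lborel"
    unfolding marginal_def
  proof (rule sigma_finite_measure.borel_measurable_lebesgue_integral)
    show "sigma_finite_measure (LR (R0 - {j}))"
      by (rule sigma_finite_LR[OF finite])
    have "(\<lambda>p. kernel (R0 - {j}) t x \<omega> (snd p)) \<in> borel_measurable (lborel \<Otimes>\<^sub>M LR (R0 - {j}))"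
      by (rule measurable_compose[OF measurable_snd measurable_kernel_fixed])
    from borel_measurable_times[OF measurable_state_upd[OF assms] this]
    show "(\<lambda>(r, z). f (state t \<omega> (z(j := r))) * kernel (R0 - {j}) t x \<omega> z)
        \<in> borel_measurable (lborel \<Otimes>\<^sub>M LR (R0 - {j}))"
      by (simp add: split_beta')
  qed
  then show ?thesis by simp
qed

lemma integrable_state_upd:
  assumes "\<omega> \<in> space (Q x)"
  shows "integrable (LR (R0 - {j})) (\<lambda>z. f (state t \<omega> (z(j := r))) * kernel (R0 - {j}) t x \<omega> z)"
proof (rule Bochner_Integration.integrable_bound[OF integrable_mult_right[of B]])
  show "integrable (LR (R0 - {j})) (kernel (R0 - {j}) t x \<omega>)"
    by (rule kernel_integral(1)[OF _ assms]) auto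
  show "(\<lambda>z. f (state t \<omega> (z(j := r))) * kernel (R0 - {j}) t x \<omega> z) \<in> borel_measurable (LR (R0 - {j}))"
    using measurable_compose[OF measurable_Pair1' measurable_state_upd[OF assms], of r]
    by (intro borel_measurable_times measurable_kernel_fixed) simp
  show "AE z in LR (R0 - {j}). norm (f (state t \<omega> (z(j := r))) * kernel (R0 - {j}) t x \<omega> z)
      \<le> norm (B * kernel (R0 - {j}) t x \<omega> z)"
  proof (rule AE_I2)
    fix z
    have "\<bar>f (state t \<omega> (z(j := r)))\<bar> \<le> \<bar>B\<bar>" using B[OF state_in_S[OF assms], of "z(j := r)"] by linarith
    then show "norm (f (state t \<omega> (z(j := r))) * kernel (R0 - {j}) t x \<omega> z) \<le> norm (B * kernel (R0 - {j}) t x \<omega> z)"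
      by (simp add: abs_mult mult_right_mono)
  qed
qed

lemma state_upd: "state t \<omega> (z(j := r)) = state t \<omega> (z(j := s)) + (r - s) *\<^sub>R axis j 1"
  using j by (auto simp: state_def vec_eq_iff axis_def)

text \<open>Averaging against a kernel of mass at most 1 does not increase oscillations. The bound
  is required only at states whose coordinates outside \<open>R0\<close> are those of
  \<open>\<omega>\<close> at time \<open>t\<close>, so \<open>w\<close> may depend on the terminal
  catalyst.\<close>

lemma marginal_diff_le:
  assumes \<omega>: "\<omega> \<in> space (Q x)" and w: "\<And>y. y \<in> S \<Longrightarrow> (\<And>k. k \<notin> R0 \<Longrightarrow> y $ k = \<omega> k t) \<Longrightarrow> \<bar>f (y + (r - s) *\<^sub>R axis j 1) - f y\<bar> \<le> w"
    and w0: "0 \<le> w"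
  shows "\<bar>marginal j t x f \<omega> r - marginal j t x f \<omega> s\<bar> \<le> w"
proof -
  let ?K = "kernel (R0 - {j}) t x \<omega>" and ?N = "LR (R0 - {j})"
  let ?F = "\<lambda>r z. f (state t \<omega> (z(j := r))) * ?K z"
  have ir: "integrable ?N (?F r)" for r
    by (rule integrable_state_upd[OF \<omega>])
  have m: "marginal j t x f \<omega> r = integral\<^sup>L ?N (?F r)" for r
    by (simp only: marginal_def)
  have "integral\<^sup>L ?N (?F r) - integral\<^sup>L ?N (?F s) = (\<integral>z. ?F r z - ?F s z \<partial>?N)"
    by (rule Bochner_Integration.integral_diff[OF ir[of r] ir[of s], symmetric])
  then have "\<bar>marginal j t x f \<omega> r - marginal j t x f \<omega> s\<bar> = \<bar>\<integral>z. ?F r z - ?F s z \<partial>?N\<bar>"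
    by (simp only: m)
  also have "\<dots> \<le> (\<integral>z. \<bar>f (state t \<omega> (z(j := r))) * ?K z - f (state t \<omega> (z(j := s))) * ?K z\<bar> \<partial>?N)"
    by (rule integral_abs_bound)
  also have "\<dots> \<le> (\<integral>z. w * ?K z \<partial>?N)"
  proof (rule integral_mono)
    show "integrable ?N (\<lambda>z. \<bar>f (state t \<omega> (z(j := r))) * ?K z - f (state t \<omega> (z(j := s))) * ?K z\<bar>)"
      by (rule integrable_abs[OF Bochner_Integration.integrable_diff[OF ir[of r] ir[of s]]])
    show "integrable ?N (\<lambda>z. w * ?K z)"
      by (intro integrable_mult_right kernel_integral(1)[OF _ \<omega>]) auto
    fix z
    have "\<bar>f (state t \<omega> (z(j := s)) + (r - s) *\<^sub>R axis j 1) - f (state t \<omega> (z(j := s)))\<bar> \<le> w"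
      by (rule w[OF state_in_S[OF \<omega>]]) (simp add: state_def)
    then have "\<bar>f (state t \<omega> (z(j := r))) - f (state t \<omega> (z(j := s)))\<bar> \<le> w"
      by (simp only: state_upd[of \<omega> z r s])
    then have "\<bar>f (state t \<omega> (z(j := r))) - f (state t \<omega> (z(j := s)))\<bar> * ?K z \<le> w * ?K z"
      by (rule mult_right_mono[OF _ kernel_nonneg])
    moreover have "\<bar>f (state t \<omega> (z(j := r))) * ?K z - f (state t \<omega> (z(j := s))) * ?K z\<bar>
        = \<bar>f (state t \<omega> (z(j := r))) - f (state t \<omega> (z(j := s)))\<bar> * ?K z"
      unfolding left_diff_distrib[symmetric] abs_mult by (simp add: kernel_nonneg)
    ultimately show "\<bar>f (state t \<omega> (z(j := r))) * ?K z - f (state t \<omega> (z(j := s))) * ?K z\<bar> \<le> w * ?K z"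
      by simp
  qed
  also have "\<dots> = w * (\<integral>z. ?K z \<partial>?N)" by (rule integral_mult_right_zero)
  also have "\<dots> \<le> w * 1" by (intro mult_left_mono w0 kernel_integral(2)[OF _ \<omega>]) auto
  finally show ?thesis by simp
qed

lemma B_nonneg: "0 \<le> B"
  using B[OF x] by linarith

lemma marginal_bound:
  assumes \<omega>: "\<omega> \<in> space (Q x)"
  shows "\<bar>marginal j t x f \<omega> r\<bar> \<le> B"
proof -
  let ?K = "kernel (R0 - {j}) t x \<omega>" and ?N = "LR (R0 - {j})"
  have "\<bar>marginal j t x f \<omega> r\<bar> \<le> (\<integral>z. \<bar>f (state t \<omega> (z(j := r))) * ?K z\<bar> \<partial>?N)"
    unfolding marginal_def by (rule integral_abs_bound)
  also have "\<dots> \<le> (\<integral>z. B * ?K z \<partial>?N)"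
  proof (rule integral_mono)
    show "integrable ?N (\<lambda>z. \<bar>f (state t \<omega> (z(j := r))) * ?K z\<bar>)"
      by (rule integrable_abs[OF integrable_state_upd[OF \<omega>, of r]])
    show "integrable ?N (\<lambda>z. B * ?K z)"
      by (intro integrable_mult_right kernel_integral(1)[OF _ \<omega>]) auto
    show "\<bar>f (state t \<omega> (z(j := r))) * ?K z\<bar> \<le> B * ?K z" for z
      using mult_right_mono[OF B[OF state_in_S[OF \<omega>]] kernel_nonneg] by (simp add: abs_mult kernel_nonneg)
  qed
  also have "\<dots> = B * (\<integral>z. ?K z \<partial>?N)" by (rule integral_mult_right_zero)
  also have "\<dots> \<le> B * 1" by (intro mult_left_mono B_nonneg kernel_integral(2)[OF _ \<omega>]) auto
  finally show ?thesis by simp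
qed

text \<open>Fubini separates coordinate \<open>j\<close> from the other reactants. The shift
  \<open>h\<close> then survives only in the centre of a single Gaussian, and derivatives in
  \<open>x $ j\<close> become derivatives of a one-dimensional convolution.\<close>

lemma inner_eq_convolution:
  assumes \<omega>: "\<omega> \<in> space (Q x)"
  shows "(\<integral>z. f (state t \<omega> z) * kernel R0 t (x + h *\<^sub>R axis j 1) \<omega> z \<partial>(LR R0))
    = (\<integral>r. marginal j t x f \<omega> r * gauss (variance_of j t \<omega>) (r - (x $ j + b j * t + h)) \<partial>lborel)"
proof -
  let ?J = "R0 - {j}" and ?x = "x + h *\<^sub>R axis j 1"
  let ?F = "\<lambda>z. f (state t \<omega> z) * kernel R0 t ?x \<omega> z"
  let ?G = "\<lambda>r z. f (state t \<omega> (z(j := r))) * kernel ?J t x \<omega> z * gauss (variance_of j t \<omega>) (r - (x $ j + b j * t + h))"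
  have R0: "{j} \<union> ?J = R0" using j by auto
  have i: "integrable (LR R0) ?F"
  proof (rule Bochner_Integration.integrable_bound[OF integrable_mult_right[of B]])
    show "integrable (LR R0) (kernel R0 t ?x \<omega>)" by (rule kernel_integral(1)[OF _ \<omega>]) auto
    show "?F \<in> borel_measurable (LR R0)"
      by (intro borel_measurable_times measurable_kernel_fixed measurable_state_fixed \<omega>)
    show "AE z in LR R0. norm (?F z) \<le> norm (B * kernel R0 t ?x \<omega> z)"
    proof (rule AE_I2)
      fix z
      have "\<bar>f (state t \<omega> z)\<bar> \<le> \<bar>B\<bar>" using B[OF state_in_S[OF \<omega>], of z] by linarith
      then show "norm (?F z) \<le> norm (B * kernel R0 t ?x \<omega> z)" by (simp add: abs_mult mult_right_mono)
    qed
  qed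
  have upd: "?F (z(j := r)) = ?G r z" for z r
  proof -
    have "kernel R0 t ?x \<omega> (z(j := r)) = gauss (variance_of j t \<omega>) (r - ?x $ j - b j * t) * kernel ?J t ?x \<omega> (z(j := r))"
      unfolding kernel_def using prod.remove[OF finite j, of "\<lambda>k. gauss (variance_of k t \<omega>) ((z(j := r)) k - ?x $ k - b k * t)"] by simp
    moreover have "kernel ?J t ?x \<omega> (z(j := r)) = kernel ?J t x \<omega> z"
      unfolding kernel_def by (rule prod.cong) (auto simp: axis_def)
    moreover have "r - ?x $ j - b j * t = r - (x $ j + b j * t + h)" by (simp add: axis_def)
    ultimately show ?thesis by (simp only: mult_ac)
  qed
  have "(\<integral>z. ?F z \<partial>(LR R0)) = (\<integral>z. ?F z \<partial>(LR ({j} \<union> ?J)))" unfolding R0 ..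
  also have "\<dots> = (\<integral>a. (\<integral>z. ?F (merge {j} ?J (a, z)) \<partial>(LR ?J)) \<partial>(LR {j}))"
    by (rule lborel_product.product_integral_fold) (use i in \<open>unfold R0, auto\<close>)
  also have "\<dots> = (\<integral>a. (\<integral>z. ?G (a j) z \<partial>(LR ?J)) \<partial>(LR {j}))"
  proof (intro Bochner_Integration.integral_cong refl)
    fix a z assume "z \<in> space (LR ?J)"
    then have "merge {j} ?J (a, z) = z(j := a j)"
      by (auto simp: merge_def space_PiM PiE_def extensional_def)
    then show "?F (merge {j} ?J (a, z)) = ?G (a j) z" by (simp only: upd)
  qed
  also have "\<dots> = (\<integral>a. marginal j t x f \<omega> (a j) * gauss (variance_of j t \<omega>) (a j - (x $ j + b j * t + h)) \<partial>(LR {j}))"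
    unfolding marginal_def by (simp only: integral_mult_left_zero)
  also have "\<dots> = (\<integral>r. marginal j t x f \<omega> r * gauss (variance_of j t \<omega>) (r - (x $ j + b j * t + h)) \<partial>lborel)"
  proof (rule lborel_product.product_integral_singleton)
    have [measurable]: "marginal j t x f \<omega> \<in> borel_measurable borel" by (rule measurable_marginal[OF \<omega>])
    show "(\<lambda>r. marginal j t x f \<omega> r * gauss (variance_of j t \<omega>) (r - (x $ j + b j * t + h))) \<in> borel_measurable lborel"
      by measurable
  qed
  finally show ?thesis .
qed

end
end
end

text \<open>For variance 0 all three kernels vanish and both claims are trivial. Including this case
  gives differentiability for every \<open>\<omega>\<close> in the space, as
  \<open>measurable_derivative\<close> requires, and not just almost surely.\<close>

lemma gauss_convolution_has_derivative_nonneg: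
  fixes \<phi> :: "real \<Rightarrow> real"
  assumes "\<phi> \<in> borel_measurable borel" "\<And>z. \<bar>\<phi> z\<bar> \<le> B" "0 \<le> v"
  shows "((\<lambda>y. \<integral>z. \<phi> z * gauss v (z - y) \<partial>lborel) has_real_derivative (\<integral>z. \<phi> z * gauss1 v (z - y) \<partial>lborel)) (at y)"
    "((\<lambda>y. \<integral>z. \<phi> z * gauss1 v (z - y) \<partial>lborel) has_real_derivative (\<integral>z. \<phi> z * gauss2 v (z - y) \<partial>lborel)) (at y)"
proof -
  have "((\<lambda>y. \<integral>z. \<phi> z * gauss v (z - y) \<partial>lborel) has_real_derivative (\<integral>z. \<phi> z * gauss1 v (z - y) \<partial>lborel)) (at y) \<and>
    ((\<lambda>y. \<integral>z. \<phi> z * gauss1 v (z - y) \<partial>lborel) has_real_derivative (\<integral>z. \<phi> z * gauss2 v (z - y) \<partial>lborel)) (at y)"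
  proof (cases "v = 0")
    case True
    then show ?thesis by (simp add: gauss1_def gauss2_def)
  next
    case False
    then show ?thesis using gauss_convolution_has_derivative[OF assms(1,2)] assms(3) by simp
  qed
  then show "((\<lambda>y. \<integral>z. \<phi> z * gauss v (z - y) \<partial>lborel) has_real_derivative (\<integral>z. \<phi> z * gauss1 v (z - y) \<partial>lborel)) (at y)"
    "((\<lambda>y. \<integral>z. \<phi> z * gauss1 v (z - y) \<partial>lborel) has_real_derivative (\<integral>z. \<phi> z * gauss2 v (z - y) \<partial>lborel)) (at y)"
    by blast+
qed

section \<open>Differentiation under the expectation over the catalysts\<close>

context catalytic begin

text \<open>The sum of 5, of the bound \<open>6 * M ^ 4\<close> in
  \<open>variance_of_moments\<close> and of twice the bound \<open>288 * M\<close> in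
  \<open>low_catalyst_moment\<close>, matching the right-hand side of
  \<open>time_scale_moment_bound\<close>.\<close>

definition moment_const :: real where
  "moment_const = 5 + 6 * M ^ 4 + 576 * M"

lemma moment_const_ge: "5 \<le> moment_const"
  using M_ge_1 by (simp add: moment_const_def)

context
  fixes x :: "real ^ 'v" and t :: real and f :: "real ^ 'v \<Rightarrow> real" and B :: real and j :: 'v
  assumes x: "x \<in> S" and t: "0 < t"
    and f: "f \<in> borel_measurable (restrict_space borel S)" and B: "\<And>y. y \<in> S \<Longrightarrow> \<bar>f y\<bar> \<le> B"
    and j: "j \<in> R0"
begin

definition conv :: "(real \<Rightarrow> real \<Rightarrow> real) \<Rightarrow> real \<Rightarrow> ('v \<Rightarrow> real \<Rightarrow> real) \<Rightarrow> real" where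
  "conv g y \<omega> = (\<integral>r. marginal j t x f \<omega> r * g (variance_of j t \<omega>) (r - y) \<partial>lborel)"

lemma Pt_shift: "PS t f (x + h *\<^sub>R axis j 1) = (\<integral>\<omega>. conv gauss (h + (x $ j + b j * t)) \<omega> \<partial>Q x)"
  unfolding Pt_eq Q_shift[OF j] conv_def add.commute[of h]
  by (rule Bochner_Integration.integral_cong[OF refl inner_eq_convolution[OF x t f B j]])

lemma conv_has_derivative:
  assumes "\<omega> \<in> space (Q x)"
  shows "((\<lambda>y. conv gauss y \<omega>) has_real_derivative conv gauss1 y \<omega>) (at y)"
    "((\<lambda>y. conv gauss1 y \<omega>) has_real_derivative conv gauss2 y \<omega>) (at y)"
proof -
  note * = gauss_convolution_has_derivative_nonneg[OF measurable_marginal[OF x t f B j assms] marginal_bound[OF x t f B j assms]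
      variance_of_nonneg[OF x t j assms], of y]
  show "((\<lambda>y. conv gauss y \<omega>) has_real_derivative conv gauss1 y \<omega>) (at y)"
    unfolding conv_def by (rule *(1))
  show "((\<lambda>y. conv gauss1 y \<omega>) has_real_derivative conv gauss2 y \<omega>) (at y)"
    unfolding conv_def by (rule *(2))
qed

lemma measurable_conv:
  "conv gauss y \<in> borel_measurable (Q x)" "conv gauss1 y \<in> borel_measurable (Q x)" "conv gauss2 y \<in> borel_measurable (Q x)"
proof -
  show 0: "conv gauss y \<in> borel_measurable (Q x)" for y
  proof -
    let ?g = "\<lambda>\<omega>. \<integral>z. f (state t \<omega> z) * kernel R0 t (x + (y - x $ j - b j * t) *\<^sub>R axis j 1) \<omega> z \<partial>(LR R0)"
    have eq: "conv gauss y \<omega> = ?g \<omega>" if "\<omega> \<in> space (Q x)" for \<omega>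
      using inner_eq_convolution[OF x t f B j that, of "y - x $ j - b j * t"] by (simp add: conv_def)
    show ?thesis
      by (rule measurable_cong[of "Q x" "conv gauss y" ?g, THEN iffD2, OF eq measurable_inner[OF x t f B j]])
  qed
  show 1: "conv gauss1 y \<in> borel_measurable (Q x)" for y
    by (rule measurable_derivative[OF 0 conv_has_derivative(1)])
  show "conv gauss2 y \<in> borel_measurable (Q x)"
    by (rule measurable_derivative[OF 1 conv_has_derivative(2)])
qed

text \<open>Independent of \<open>y\<close>, and large enough for both derivatives because
  \<open>1 / sqrt v \<le> 1 + 1 / v\<close>. The 128 is 64 times the 2 of the oscillation bound
  \<open>2 * B\<close>.\<close>

definition dominator :: "('v \<Rightarrow> real \<Rightarrow> real) \<Rightarrow> real" where
  "dominator \<omega> = 128 * B * (1 + 1 / variance_of j t \<omega>)"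

lemma integrable_dominator: "integrable (Q x) dominator"
proof -
  interpret prob_space "Q x" by (rule prob_space_Q[OF x])
  obtain i where i: "i \<in> cat_of E j" using cat_nonempty[OF j] by blast
  define q where "q = t * (t + x $ i)"
  have "0 < q" unfolding q_def using t S_nonneg[OF x cat_in_NC2[OF j i]] by (intro mult_pos_pos) auto
  moreover have "integrable (Q x) (\<lambda>\<omega>. inverse q * (q / variance_of j t \<omega>))"
    unfolding q_def by (intro integrable_mult_right variance_of_moments(2)[OF x j i t])
  ultimately have "integrable (Q x) (\<lambda>\<omega>. 1 / variance_of j t \<omega>)" by simp
  then show ?thesis unfolding dominator_def[abs_def] by simp
qed

lemma conv_le_dominator:
  assumes \<omega>: "\<omega> \<in> space (Q x)" and v: "0 < variance_of j t \<omega>"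
  shows "\<bar>conv gauss1 y \<omega>\<bar> \<le> dominator \<omega>" "\<bar>conv gauss2 y \<omega>\<bar> \<le> dominator \<omega>"
proof -
  let ?v = "variance_of j t \<omega>"
  have B0: "0 \<le> B" using B[OF x] by linarith
  have "\<bar>marginal j t x f \<omega> z - marginal j t x f \<omega> y\<bar> \<le> 2 * B * (1 + (z - y)\<^sup>2 / ?v)" for z
  proof -
    have "\<bar>marginal j t x f \<omega> z - marginal j t x f \<omega> y\<bar> \<le> 2 * B"
      using marginal_bound[OF x t f B j \<omega>, of z] marginal_bound[OF x t f B j \<omega>, of y] by linarith
    also have "\<dots> = 2 * B * 1" by simp
    also have "\<dots> \<le> 2 * B * (1 + (z - y)\<^sup>2 / ?v)" using v B0 by (intro mult_left_mono) auto
    finally show ?thesis .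
  qed
  note * = gauss_convolution_bound[OF measurable_marginal[OF x t f B j \<omega>] marginal_bound[OF x t f B j \<omega>] v this]
  have v0: "0 < 1 / ?v" using v by simp
  have "1 / sqrt ?v = sqrt (1 / ?v)" by (simp add: real_sqrt_divide)
  also have "\<dots> \<le> 1 + 1 / ?v"
  proof (rule real_le_lsqrt)
    have "u \<le> (1 + u)\<^sup>2" if "0 < u" for u :: real
      using that zero_le_power2[of u] by (simp only: power2_sum) simp
    from this[OF v0] show "1 / ?v \<le> (1 + 1 / ?v)\<^sup>2" .
  qed (use v0 in simp)
  finally have s: "1 / sqrt ?v \<le> 1 + 1 / ?v" .
  have "\<bar>conv gauss1 y \<omega>\<bar> \<le> 128 * B * (1 / sqrt ?v)" using *(1) unfolding conv_def by simp
  also have "\<dots> \<le> 128 * B * (1 + 1 / ?v)" using B0 by (intro mult_left_mono s) auto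
  finally show "\<bar>conv gauss1 y \<omega>\<bar> \<le> dominator \<omega>" by (simp add: dominator_def)
  have "\<bar>conv gauss2 y \<omega>\<bar> \<le> 128 * B * (1 / ?v)" using *(2) unfolding conv_def by simp
  also have "\<dots> \<le> 128 * B * (1 + 1 / ?v)" using B0 by (intro mult_left_mono) auto
  finally show "\<bar>conv gauss2 y \<omega>\<bar> \<le> dominator \<omega>" by (simp add: dominator_def)
qed

lemma AE_variance_pos: "AE \<omega> in Q x. \<omega> \<in> space (Q x) \<and> 0 < variance_of j t \<omega>"
proof -
  obtain i where i: "i \<in> cat_of E j" using cat_nonempty[OF j] by blast
  show ?thesis using variance_of_moments(1)[OF x j i t] AE_space by eventually_elim simp
qed

lemma conv_gauss_le: assumes \<omega>: "\<omega> \<in> space (Q x)" shows "\<bar>conv gauss y \<omega>\<bar> \<le> B"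
proof (cases "variance_of j t \<omega> = 0")
  case True
  then show ?thesis using B[OF x] by (simp add: conv_def)
next
  case False
  then have v: "0 < variance_of j t \<omega>" using variance_of_nonneg[OF x t j \<omega>] by simp
  have "\<bar>conv gauss y \<omega>\<bar> \<le> (\<integral>r. \<bar>marginal j t x f \<omega> r * gauss (variance_of j t \<omega>) (r - y)\<bar> \<partial>lborel)"
    unfolding conv_def by (rule integral_abs_bound)
  also have "\<dots> \<le> (\<integral>r. B * gauss (variance_of j t \<omega>) (r - y) \<partial>lborel)"
  proof (rule integral_mono)
    show "integrable lborel (\<lambda>r. \<bar>marginal j t x f \<omega> r * gauss (variance_of j t \<omega>) (r - y)\<bar>)"
      by (rule integrable_abs[OF integrable_mult_gauss(1)[OF measurable_marginal[OF x t f B j \<omega>] marginal_bound[OF x t f B j \<omega>] v]])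
    show "integrable lborel (\<lambda>r. B * gauss (variance_of j t \<omega>) (r - y))"
      using v by (intro integrable_mult_right integrable_gauss) simp
    show "\<bar>marginal j t x f \<omega> r * gauss (variance_of j t \<omega>) (r - y)\<bar> \<le> B * gauss (variance_of j t \<omega>) (r - y)" for r
      using mult_right_mono[OF marginal_bound[OF x t f B j \<omega>] gauss_nonneg] by (simp add: abs_mult gauss_nonneg)
  qed
  also have "\<dots> = B" using integral_gauss[OF v] by simp
  finally show ?thesis .
qed

lemma integrable_conv:
  "integrable (Q x) (conv gauss y)" "integrable (Q x) (conv gauss1 y)" "integrable (Q x) (conv gauss2 y)"
proof -
  interpret prob_space "Q x" by (rule prob_space_Q[OF x])
  show "integrable (Q x) (conv gauss y)"
    by (rule integrable_const_bound[where B=B, OF AE_I2 measurable_conv(1)]) (use conv_gauss_le in simp)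
  show "integrable (Q x) (conv gauss1 y)"
  proof (rule Bochner_Integration.integrable_bound[OF integrable_dominator measurable_conv(2)])
    show "AE \<omega> in Q x. norm (conv gauss1 y \<omega>) \<le> norm (dominator \<omega>)"
      using AE_variance_pos
    proof eventually_elim
      fix \<omega> assume "\<omega> \<in> space (Q x) \<and> 0 < variance_of j t \<omega>"
      then have "\<bar>conv gauss1 y \<omega>\<bar> \<le> dominator \<omega>" by (intro conv_le_dominator(1)) auto
      then show "norm (conv gauss1 y \<omega>) \<le> norm (dominator \<omega>)"
        unfolding real_norm_def by (rule order_trans[OF _ abs_ge_self])
    qed
  qed
  show "integrable (Q x) (conv gauss2 y)"
  proof (rule Bochner_Integration.integrable_bound[OF integrable_dominator measurable_conv(3)])
    show "AE \<omega> in Q x. norm (conv gauss2 y \<omega>) \<le> norm (dominator \<omega>)"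
      using AE_variance_pos
    proof eventually_elim
      fix \<omega> assume "\<omega> \<in> space (Q x) \<and> 0 < variance_of j t \<omega>"
      then have "\<bar>conv gauss2 y \<omega>\<bar> \<le> dominator \<omega>" by (intro conv_le_dominator(2)) auto
      then show "norm (conv gauss2 y \<omega>) \<le> norm (dominator \<omega>)"
        unfolding real_norm_def by (rule order_trans[OF _ abs_ge_self])
    qed
  qed
qed

lemma expectation_conv_has_derivative:
  "((\<lambda>y. \<integral>\<omega>. conv gauss y \<omega> \<partial>Q x) has_real_derivative (\<integral>\<omega>. conv gauss1 y \<omega> \<partial>Q x)) (at y)"
  "((\<lambda>y. \<integral>\<omega>. conv gauss1 y \<omega> \<partial>Q x) has_real_derivative (\<integral>\<omega>. conv gauss2 y \<omega> \<partial>Q x)) (at y)"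
proof -
  show "((\<lambda>y. \<integral>\<omega>. conv gauss y \<omega> \<partial>Q x) has_real_derivative (\<integral>\<omega>. conv gauss1 y \<omega> \<partial>Q x)) (at y)"
  proof (rule has_real_derivative_integral[where h="conv gauss" and h'="conv gauss1" and ?y0.0=y,
        OF integrable_conv(1) measurable_conv(2) integrable_dominator])
    show "AE \<omega> in Q x. \<forall>y'. \<bar>y' - y\<bar> < 1 \<longrightarrow>
      ((\<lambda>y. conv gauss y \<omega>) has_real_derivative conv gauss1 y' \<omega>) (at y') \<and> \<bar>conv gauss1 y' \<omega>\<bar> \<le> dominator \<omega>"
      using AE_variance_pos by eventually_elim (elim conjE, intro allI impI conjI conv_has_derivative(1) conv_le_dominator(1))
  qed
  show "((\<lambda>y. \<integral>\<omega>. conv gauss1 y \<omega> \<partial>Q x) has_real_derivative (\<integral>\<omega>. conv gauss2 y \<omega> \<partial>Q x)) (at y)"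
  proof (rule has_real_derivative_integral[where h="conv gauss1" and h'="conv gauss2" and ?y0.0=y,
        OF integrable_conv(2) measurable_conv(3) integrable_dominator])
    show "AE \<omega> in Q x. \<forall>y'. \<bar>y' - y\<bar> < 1 \<longrightarrow>
      ((\<lambda>y. conv gauss1 y \<omega>) has_real_derivative conv gauss2 y' \<omega>) (at y') \<and> \<bar>conv gauss2 y' \<omega>\<bar> \<le> dominator \<omega>"
      using AE_variance_pos by eventually_elim (elim conjE, intro allI impI conjI conv_has_derivative(2) conv_le_dominator(2))
  qed
qed

lemma Pt_has_derivative:
  "((\<lambda>h. PS t f (x + h *\<^sub>R axis j 1)) has_real_derivative (\<integral>\<omega>. conv gauss1 (h + (x $ j + b j * t)) \<omega> \<partial>Q x)) (at h)"
proof -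
  have "((\<lambda>h. \<integral>\<omega>. conv gauss (h + (x $ j + b j * t)) \<omega> \<partial>Q x) has_real_derivative (\<integral>\<omega>. conv gauss1 (h + (x $ j + b j * t)) \<omega> \<partial>Q x)) (at h)"
    by (rule DERIV_shift[of "\<lambda>y. \<integral>\<omega>. conv gauss y \<omega> \<partial>Q x" _ h "x $ j + b j * t", THEN iffD1])
       (rule expectation_conv_has_derivative(1))
  then show ?thesis unfolding Pt_shift .
qed

lemma partial_Pt: "partial j (PS t f) (x + h *\<^sub>R axis j 1) = (\<integral>\<omega>. conv gauss1 (h + (x $ j + b j * t)) \<omega> \<partial>Q x)"
proof -
  have "((\<lambda>k. PS t f (x + (k + h) *\<^sub>R axis j 1)) has_real_derivative (\<integral>\<omega>. conv gauss1 (h + (x $ j + b j * t)) \<omega> \<partial>Q x)) (at 0)"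
    by (rule DERIV_shift[of "\<lambda>h. PS t f (x + h *\<^sub>R axis j 1)" _ 0 h, THEN iffD1])
       (unfold add_0, rule Pt_has_derivative)
  moreover have "x + (k + h) *\<^sub>R axis j 1 = x + h *\<^sub>R axis j 1 + k *\<^sub>R axis j 1" for k
    by (simp add: scaleR_add_left)
  ultimately have "((\<lambda>k. PS t f (x + h *\<^sub>R axis j 1 + k *\<^sub>R axis j 1)) has_real_derivative (\<integral>\<omega>. conv gauss1 (h + (x $ j + b j * t)) \<omega> \<partial>Q x)) (at 0)"
    by (simp only:)
  then show ?thesis unfolding partial_def by (rule DERIV_imp_deriv)
qed

lemma partial_Pt_has_derivative:
  "((\<lambda>h. partial j (PS t f) (x + h *\<^sub>R axis j 1)) has_real_derivative
    (\<integral>\<omega>. conv gauss2 (x $ j + b j * t) \<omega> \<partial>Q x)) (at 0)"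
proof -
  have "((\<lambda>h. \<integral>\<omega>. conv gauss1 (h + (x $ j + b j * t)) \<omega> \<partial>Q x) has_real_derivative (\<integral>\<omega>. conv gauss2 (x $ j + b j * t) \<omega> \<partial>Q x)) (at 0)"
    by (rule DERIV_shift[of "\<lambda>y. \<integral>\<omega>. conv gauss1 y \<omega> \<partial>Q x" _ 0 "x $ j + b j * t", THEN iffD1])
       (unfold add_0, rule expectation_conv_has_derivative(2))
  then show ?thesis unfolding partial_Pt .
qed

lemma partial_differentiable_Pt:
  "partial_differentiable j (PS t f) x"
  "partial_differentiable j (partial j (PS t f)) x"
  unfolding partial_differentiable_def field_differentiable_def
  by (rule exI, rule Pt_has_derivative) (rule exI, rule partial_Pt_has_derivative)

lemma partial_partial_Pt:
  "partial j (partial j (PS t f)) x = (\<integral>\<omega>. conv gauss2 (x $ j + b j * t) \<omega> \<partial>Q x)"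
  unfolding partial_def[of j "partial j (PS t f)"]
  by (rule DERIV_imp_deriv[OF partial_Pt_has_derivative])

text \<open>The common core of the estimates by either norm. \<open>w\<close> is a modulus of
  oscillation in terms of the shift and of the catalyst, and \<open>key\<close> trades it for a
  quantity with expectation at most \<open>moment_const\<close>. Its two inequalities serve the
  first and the second derivative, normalised by \<open>sqrt q\<close> and \<open>q\<close> with
  \<open>q = t * (t + x $ i)\<close>.\<close>

lemma partial_Pt_bounds:
  fixes w :: "real \<Rightarrow> real \<Rightarrow> real" and A :: real
  assumes i: "i \<in> cat_of E j"
    and w0: "\<And>h X. 0 \<le> h \<Longrightarrow> 0 \<le> X \<Longrightarrow> 0 \<le> w h X"
    and osc: "\<And>y h. y \<in> S \<Longrightarrow> \<bar>f (y + h *\<^sub>R axis j 1) - f y\<bar> \<le> w \<bar>h\<bar> (y $ i)"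
    and key: "\<And>v X. 0 < v \<Longrightarrow> 0 \<le> X \<Longrightarrow> \<exists>L. (\<forall>h\<ge>0. w h X \<le> L * (1 + h\<^sup>2 / v)) \<and>
        sqrt (t * (t + x $ i) / v) * L \<le> A * (5 + t * (t + x $ i) / v + 2 * (if X < x $ i / 2 then x $ i / t else 0)) \<and>
        t * (t + x $ i) / v * L \<le> A * (5 + t * (t + x $ i) / v + 2 * (if X < x $ i / 2 then x $ i / t else 0))"
  shows "\<bar>partial j (PS t f) x\<bar> \<le> 64 * A * moment_const / sqrt (t * (t + x $ i))"
    and "\<bar>partial j (partial j (PS t f)) x\<bar> \<le> 64 * A * moment_const / (t * (t + x $ i))"
proof -
  interpret prob_space "Q x" by (rule prob_space_Q[OF x])
  define q where "q = t * (t + x $ i)"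
  define y where "y = x $ j + b j * t"
  let ?v = "variance_of j t" and ?a = "\<lambda>\<omega>. if \<omega> i t < x $ i / 2 then x $ i / t else 0"
  let ?U = "\<lambda>\<omega>. 5 + q / ?v \<omega> + 2 * ?a \<omega>"
  have iC: "i \<in> C0" by (rule cat_in_NC2[OF j i])
  have q: "0 < q" unfolding q_def using t S_nonneg[OF x iC] by (intro mult_pos_pos) auto
  note iU = variance_of_moments(2)[OF x j i t, folded q_def] low_catalyst_moment(1)[OF x j i t]
  have U: "integrable (Q x) ?U"
    by (intro Bochner_Integration.integrable_add integrable_mult_right iU) simp
  have "(\<integral>\<omega>. ?U \<omega> \<partial>Q x) = 5 + (\<integral>\<omega>. q / ?v \<omega> \<partial>Q x) + 2 * (\<integral>\<omega>. ?a \<omega> \<partial>Q x)"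
    using iU by (subst Bochner_Integration.integral_add Bochner_Integration.integral_mult_right; (simp add: prob_space)?)+
  also have "\<dots> \<le> moment_const"
    using variance_of_moments(3)[OF x j i t, folded q_def] low_catalyst_moment(2)[OF x j i t]
    unfolding moment_const_def by linarith
  finally have UE: "(\<integral>\<omega>. ?U \<omega> \<partial>Q x) \<le> moment_const" .
  \<comment> \<open>The sign of \<open>A\<close> is read off from \<open>key\<close> at
    \<open>v = q\<close> and \<open>X = x $ i\<close>, where the ratio is 1 and the weight
    vanishes.\<close>
  have A: "0 \<le> A"
  proof -
    obtain L where L: "\<forall>h\<ge>0. w h (x $ i) \<le> L * (1 + h\<^sup>2 / q)"
      "q / q * L \<le> A * (5 + q / q + 2 * (if x $ i < x $ i / 2 then x $ i / t else 0))"
      using key[OF q S_nonneg[OF x iC]] unfolding q_def by blast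
    have "0 \<le> L" using L(1)[rule_format, of 0] w0[of 0 "x $ i"] S_nonneg[OF x iC] by simp
    moreover have "\<not> x $ i < x $ i / 2" using S_nonneg[OF x iC] by simp
    ultimately show ?thesis using L(2) q by simp
  qed
  have bd: "\<bar>conv gauss1 y \<omega>\<bar> \<le> 64 * A / sqrt q * ?U \<omega>" "\<bar>conv gauss2 y \<omega>\<bar> \<le> 64 * A / q * ?U \<omega>"
    if \<omega>: "\<omega> \<in> space (Q x)" and v: "0 < ?v \<omega>" for \<omega>
  proof -
    have X: "0 \<le> \<omega> i t" using space_Q[OF x \<omega> iC] t by (simp add: space_path_space)
    obtain L where L: "\<forall>h\<ge>0. w h (\<omega> i t) \<le> L * (1 + h\<^sup>2 / ?v \<omega>)"
      "sqrt (q / ?v \<omega>) * L \<le> A * ?U \<omega>" "q / ?v \<omega> * L \<le> A * ?U \<omega>"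
      using key[OF v X] unfolding q_def by blast
    have "\<bar>marginal j t x f \<omega> z - marginal j t x f \<omega> y\<bar> \<le> L * (1 + (z - y)\<^sup>2 / ?v \<omega>)" for z
    proof -
      have "\<bar>marginal j t x f \<omega> z - marginal j t x f \<omega> y\<bar> \<le> w \<bar>z - y\<bar> (\<omega> i t)"
      proof (rule marginal_diff_le[OF x t f B j \<omega>])
        fix u :: "real ^ 'v" assume u: "u \<in> S" "\<And>k. k \<notin> R0 \<Longrightarrow> u $ k = \<omega> k t"
        then show "\<bar>f (u + (z - y) *\<^sub>R axis j 1) - f u\<bar> \<le> w \<bar>z - y\<bar> (\<omega> i t)"
          using osc[OF u(1), of "z - y"] iC by (simp add: in_NC2_iff)
      qed (use w0[OF _ X] in auto)
      also have "\<dots> \<le> L * (1 + \<bar>z - y\<bar>\<^sup>2 / ?v \<omega>)" by (rule L(1)[rule_format, OF abs_ge_zero])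
      finally show ?thesis by simp
    qed
    note * = gauss_convolution_bound[OF measurable_marginal[OF x t f B j \<omega>] marginal_bound[OF x t f B j \<omega>] v this]
    have "\<bar>conv gauss1 y \<omega>\<bar> \<le> 64 / sqrt q * (sqrt (q / ?v \<omega>) * L)"
      using *(1) q v unfolding conv_def by (simp add: real_sqrt_divide)
    also have "\<dots> \<le> 64 / sqrt q * (A * ?U \<omega>)" using q by (intro mult_left_mono L(2)) auto
    finally show "\<bar>conv gauss1 y \<omega>\<bar> \<le> 64 * A / sqrt q * ?U \<omega>" by simp
    have "\<bar>conv gauss2 y \<omega>\<bar> \<le> 64 / q * (q / ?v \<omega> * L)"
      using *(2) q v unfolding conv_def by simp
    also have "\<dots> \<le> 64 / q * (A * ?U \<omega>)" using q by (intro mult_left_mono L(3)) auto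
    finally show "\<bar>conv gauss2 y \<omega>\<bar> \<le> 64 * A / q * ?U \<omega>" by simp
  qed
  have fin: "\<bar>\<integral>\<omega>. g \<omega> \<partial>Q x\<bar> \<le> c * moment_const"
    if g: "integrable (Q x) g" "\<And>\<omega>. \<omega> \<in> space (Q x) \<Longrightarrow> 0 < ?v \<omega> \<Longrightarrow> \<bar>g \<omega>\<bar> \<le> c * ?U \<omega>" "0 \<le> c" for g c
  proof -
    have "\<bar>\<integral>\<omega>. g \<omega> \<partial>Q x\<bar> \<le> (\<integral>\<omega>. \<bar>g \<omega>\<bar> \<partial>Q x)" by (rule integral_abs_bound)
    also have "\<dots> \<le> (\<integral>\<omega>. c * ?U \<omega> \<partial>Q x)"
    proof (rule integral_mono_AE)
      show "integrable (Q x) (\<lambda>\<omega>. \<bar>g \<omega>\<bar>)" by (rule integrable_abs[OF g(1)])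
      show "integrable (Q x) (\<lambda>\<omega>. c * ?U \<omega>)" by (rule integrable_mult_right[OF U])
      show "AE \<omega> in Q x. \<bar>g \<omega>\<bar> \<le> c * ?U \<omega>" using AE_variance_pos by eventually_elim (use g(2) in blast)
    qed
    also have "\<dots> = c * (\<integral>\<omega>. ?U \<omega> \<partial>Q x)" by (rule integral_mult_right_zero)
    also have "\<dots> \<le> c * moment_const" by (rule mult_left_mono[OF UE g(3)])
    finally show ?thesis .
  qed
  have "\<bar>\<integral>\<omega>. conv gauss1 y \<omega> \<partial>Q x\<bar> \<le> 64 * A / sqrt q * moment_const"
    by (rule fin[OF integrable_conv(2) bd(1)]) (use A q in auto)
  then show "\<bar>partial j (PS t f) x\<bar> \<le> 64 * A * moment_const / sqrt (t * (t + x $ i))"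
    using partial_Pt[of 0] by (simp add: y_def q_def)
  have "\<bar>\<integral>\<omega>. conv gauss2 y \<omega> \<partial>Q x\<bar> \<le> 64 * A / q * moment_const"
    by (rule fin[OF integrable_conv(3) bd(2)]) (use A q in auto)
  then show "\<bar>partial j (partial j (PS t f)) x\<bar> \<le> 64 * A * moment_const / (t * (t + x $ i))"
    unfolding partial_partial_Pt by (simp add: y_def q_def)
qed

end
end

section \<open>Estimates in terms of the seminorm\<close>

lemma sup_norm_finite: "bounded (f ` S) \<Longrightarrow> sup_norm S f < \<infinity>"
proof -
  assume "bounded (f ` S)"
  then obtain B where "\<And>y. y \<in> S \<Longrightarrow> \<bar>f y\<bar> \<le> B" by (auto simp: bounded_iff)
  then have "sup_norm S f \<le> ennreal B" unfolding sup_norm_def by (intro SUP_least ennreal_leI)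
  also have "\<dots> < \<infinity>" by simp
  finally show ?thesis .
qed

text \<open>Finiteness matters, since \<open>enn2real\<close> maps infinity to 0.\<close>

lemma sup_norm_upper:
  assumes "sup_norm S f < \<infinity>" "y \<in> S"
  shows "\<bar>f y\<bar> \<le> enn2real (sup_norm S f)"
proof -
  have "ennreal \<bar>f y\<bar> \<le> sup_norm S f" unfolding sup_norm_def by (rule SUP_upper[OF assms(2)])
  then have "enn2real (ennreal \<bar>f y\<bar>) \<le> enn2real (sup_norm S f)"
    using assms(1) by (intro enn2real_mono) auto
  then show ?thesis by simp
qed

lemma alpha_seminorm_upper:
  assumes "alpha_seminorm E x0 b \<gamma> P \<alpha> f < \<infinity>" "0 < t" "y \<in> S0 E x0"
  shows "\<bar>Pt E x0 b \<gamma> P t f y - f y\<bar> \<le> enn2real (alpha_seminorm E x0 b \<gamma> P \<alpha> f) * t powr (\<alpha> / 2)"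
proof -
  let ?N = "alpha_seminorm E x0 b \<gamma> P \<alpha> f" and ?d = "\<lambda>y. Pt E x0 b \<gamma> P t f y - f y"
  have "ennreal (t powr (- \<alpha> / 2)) * ennreal \<bar>?d y\<bar> \<le> ennreal (t powr (- \<alpha> / 2)) * sup_norm (S0 E x0) ?d"
    unfolding sup_norm_def by (intro mult_left_mono SUP_upper[OF assms(3)]) simp
  also have "\<dots> \<le> ?N"
    unfolding alpha_seminorm_def using assms(2) by (intro SUP_upper) simp
  finally have "ennreal (t powr (- \<alpha> / 2) * \<bar>?d y\<bar>) \<le> ?N" by (simp add: ennreal_mult)
  then have "enn2real (ennreal (t powr (- \<alpha> / 2) * \<bar>?d y\<bar>)) \<le> enn2real ?N"
    using assms(1) by (intro enn2real_mono) auto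
  then have "t powr (- \<alpha> / 2) * \<bar>?d y\<bar> \<le> enn2real ?N" by simp
  then have "t powr (\<alpha> / 2) * (t powr (- \<alpha> / 2) * \<bar>?d y\<bar>) \<le> t powr (\<alpha> / 2) * enn2real ?N"
    by (rule mult_left_mono) simp
  moreover have "t powr (\<alpha> / 2) * (t powr (- \<alpha> / 2) * \<bar>?d y\<bar>) = \<bar>?d y\<bar>"
  proof -
    have "t powr (\<alpha> / 2) * t powr (- \<alpha> / 2) = 1" using assms(2) by (simp flip: powr_add)
    then show ?thesis by (simp only: mult.assoc[symmetric] mult_1)
  qed
  ultimately show ?thesis by (simp only: mult.commute[of "enn2real ?N"])
qed

context catalytic begin

context
  fixes f :: "real ^ 'v \<Rightarrow> real" and B :: real and i j :: 'v
  assumes f: "f \<in> borel_measurable (restrict_space borel S)" and B: "\<And>y. y \<in> S \<Longrightarrow> \<bar>f y\<bar> \<le> B"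
    and j: "j \<in> R0" and i: "i \<in> cat_of E j"
begin

text \<open>The case of the constant modulus \<open>2 * B\<close>; \<open>powr_le_2_plus\<close>
  absorbs the square root into the linear moment. The 128 is \<open>64 * 2\<close>.\<close>

lemma partial_Pt_le_sup:
  assumes x: "x \<in> S" and t: "0 < t"
  shows "\<bar>partial j (PS t f) x\<bar> \<le> 128 * B * moment_const / sqrt (t * (t + x $ i))"
    and "\<bar>partial j (partial j (PS t f)) x\<bar> \<le> 128 * B * moment_const / (t * (t + x $ i))"
proof -
  have B0: "0 \<le> B" using B[OF x] by linarith
  have xi: "0 \<le> x $ i" by (rule S_nonneg[OF x cat_in_NC2[OF j i]])
  have osc: "\<bar>f (y + h *\<^sub>R axis j 1) - f y\<bar> \<le> 2 * B" if "y \<in> S" for y h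
    using B[OF that] B[OF shift_in_S[OF that j], of h] by linarith
  have key: "\<exists>L. (\<forall>h\<ge>0. 2 * B \<le> L * (1 + h\<^sup>2 / v)) \<and>
      sqrt (t * (t + x $ i) / v) * L \<le> 2 * B * (5 + t * (t + x $ i) / v + 2 * (if X < x $ i / 2 then x $ i / t else 0)) \<and>
      t * (t + x $ i) / v * L \<le> 2 * B * (5 + t * (t + x $ i) / v + 2 * (if X < x $ i / 2 then x $ i / t else 0))"
    if v: "0 < v" for v X :: real
  proof (intro exI[of _ "2 * B"] conjI allI impI)
    let ?R = "t * (t + x $ i) / v" and ?a = "if X < x $ i / 2 then x $ i / t else 0"
    have R: "0 \<le> ?R" using t v xi by simp
    have a: "0 \<le> ?a" using t xi by simp
    show "2 * B \<le> 2 * B * (1 + h\<^sup>2 / v)" for h using B0 v by (simp add: mult_le_cancel_left1)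
    have "sqrt ?R \<le> 2 + ?R" using powr_le_2_plus[OF R, of "1/2"] R by (simp add: powr_half_sqrt)
    then have "sqrt ?R \<le> 5 + ?R + 2 * ?a" "?R \<le> 5 + ?R + 2 * ?a" using a by linarith+
    then have "2 * B * sqrt ?R \<le> 2 * B * (5 + ?R + 2 * ?a)" "2 * B * ?R \<le> 2 * B * (5 + ?R + 2 * ?a)"
      using B0 by (intro mult_left_mono; simp)+
    then show "sqrt ?R * (2 * B) \<le> 2 * B * (5 + ?R + 2 * ?a)" "?R * (2 * B) \<le> 2 * B * (5 + ?R + 2 * ?a)"
      by (simp_all only: mult.commute[of "2 * B"])
  qed
  note r = partial_Pt_bounds[OF x t f B j i, where w="\<lambda>h X. 2 * B" and A="2 * B", OF _ _ osc key]
  have "\<bar>partial j (PS t f) x\<bar> \<le> 64 * (2 * B) * moment_const / sqrt (t * (t + x $ i))"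
    by (rule r(1)) (use B0 in auto)
  then show "\<bar>partial j (PS t f) x\<bar> \<le> 128 * B * moment_const / sqrt (t * (t + x $ i))"
    by simp
  have "\<bar>partial j (partial j (PS t f)) x\<bar> \<le> 64 * (2 * B) * moment_const / (t * (t + x $ i))"
    by (rule r(2)) (use B0 in auto)
  then show "\<bar>partial j (partial j (PS t f)) x\<bar> \<le> 128 * B * moment_const / (t * (t + x $ i))"
    by simp
qed

text \<open>Here the modulus is a power of the time scale. \<open>time_scale_moment_bound\<close> at
  \<open>k = 1 / 2\<close> and \<open>k = 1\<close> trades this power for
  \<open>t powr \<beta>\<close>, while \<open>\<epsilon>\<close> is treated like a constant
  modulus.\<close>

lemma partial_Pt_le_osc:
  assumes x: "x \<in> S" and t: "0 < t" and \<beta>: "0 < \<beta>" "\<beta> \<le> 1 / 2" and D: "0 \<le> D" and \<epsilon>: "0 \<le> \<epsilon>"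
    and osc: "\<And>y h. y \<in> S \<Longrightarrow> \<bar>f (y + h *\<^sub>R axis j 1) - f y\<bar> \<le> D * (time_scale \<bar>h\<bar> (y $ i) powr \<beta> + \<epsilon>)"
  shows "\<bar>partial j (PS t f) x\<bar> \<le> 64 * (D * (t powr \<beta> + \<epsilon>)) * moment_const / sqrt (t * (t + x $ i))"
    and "\<bar>partial j (partial j (PS t f)) x\<bar> \<le> 64 * (D * (t powr \<beta> + \<epsilon>)) * moment_const / (t * (t + x $ i))"
proof -
  have xi: "0 \<le> x $ i" by (rule S_nonneg[OF x cat_in_NC2[OF j i]])
  let ?w = "\<lambda>h X. D * (time_scale h X powr \<beta> + \<epsilon>)" and ?A = "D * (t powr \<beta> + \<epsilon>)"
  have key: "\<exists>L. (\<forall>h\<ge>0. ?w h X \<le> L * (1 + h\<^sup>2 / v)) \<and>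
      sqrt (t * (t + x $ i) / v) * L \<le> ?A * (5 + t * (t + x $ i) / v + 2 * (if X < x $ i / 2 then x $ i / t else 0)) \<and>
      t * (t + x $ i) / v * L \<le> ?A * (5 + t * (t + x $ i) / v + 2 * (if X < x $ i / 2 then x $ i / t else 0))"
    if v: "0 < v" and X: "0 \<le> X" for v X :: real
  proof (intro exI[of _ "?w (sqrt v) X"] conjI allI impI)
    let ?R = "t * (t + x $ i) / v" and ?a = "if X < x $ i / 2 then x $ i / t else 0"
    let ?s = "time_scale (sqrt v) X" and ?U = "5 + t * (t + x $ i) / v + 2 * (if X < x $ i / 2 then x $ i / t else 0)"
    have s: "0 \<le> ?s" using v X by (intro time_scale_nonneg) auto
    \<comment> \<open>The witness \<open>L\<close> is the modulus at one standard deviation. Larger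
      shifts cost the factor of \<open>time_scale_growth\<close>, which is at least 1 and so
      dominates its own power \<open>\<beta>\<close>.\<close>
    show "?w h X \<le> ?w (sqrt v) X * (1 + h\<^sup>2 / v)" if h: "0 \<le> h" for h
    proof -
      let ?g = "1 + h\<^sup>2 / v"
      have g: "1 \<le> ?g" using v by simp
      have "time_scale h X powr \<beta> \<le> (?g * ?s) powr \<beta>"
        using \<beta> h X v time_scale_growth[OF h v X] time_scale_nonneg[OF h X] by (intro powr_mono2) auto
      also have "\<dots> = ?g powr \<beta> * ?s powr \<beta>" by (rule powr_mult)
      also have "\<dots> \<le> ?g powr 1 * ?s powr \<beta>" using g \<beta> by (intro mult_right_mono powr_mono) auto
      also have "\<dots> = ?s powr \<beta> * ?g" using g by simp
      finally have "time_scale h X powr \<beta> + \<epsilon> \<le> ?s powr \<beta> * ?g + \<epsilon> * ?g"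
        using \<epsilon> g by (intro add_mono) (auto simp: mult_le_cancel_left1)
      then have "D * (time_scale h X powr \<beta> + \<epsilon>) \<le> D * ((?s powr \<beta> + \<epsilon>) * ?g)"
        unfolding distrib_right[symmetric] by (rule mult_left_mono[OF _ D])
      then show ?thesis by (simp only: mult.assoc)
    qed
    have R: "0 \<le> ?R" using t v xi by simp
    have a: "0 \<le> ?a" using t xi by simp
    have *: "?R powr k * ?w (sqrt v) X \<le> ?A * ?U" if k: "1 / 2 \<le> k" "k \<le> 1" for k
    proof -
      have "?R powr k \<le> 2 + ?R" using k by (intro powr_le_2_plus[OF R]) auto
      then have "?R powr k \<le> ?U" using a by linarith
      then have "?R powr k * \<epsilon> \<le> ?U * \<epsilon>" by (rule mult_right_mono[OF _ \<epsilon>])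
      then have "?R powr k * ?s powr \<beta> + ?R powr k * \<epsilon> \<le> t powr \<beta> * ?U + ?U * \<epsilon>"
        by (rule add_mono[OF time_scale_moment_bound[OF t xi v X \<beta> k]])
      then have "D * (?R powr k * ?s powr \<beta> + ?R powr k * \<epsilon>) \<le> D * (t powr \<beta> * ?U + ?U * \<epsilon>)"
        by (rule mult_left_mono[OF _ D])
      moreover have "D * (r * p + r * e) = r * (D * (p + e))" "D * (p * r + r * e) = D * (p + e) * r" for r p e
        by (simp_all add: algebra_simps)
      ultimately show ?thesis by (simp only:)
    qed
    show "sqrt ?R * ?w (sqrt v) X \<le> ?A * ?U"
      using *[of "1/2"] R by (simp only: powr_half_sqrt)
    show "?R * ?w (sqrt v) X \<le> ?A * ?U"
      using *[of 1] R by (simp only: powr_one)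
  qed
  have w0: "0 \<le> ?w h X" for h X using D \<epsilon> by simp
  note r = partial_Pt_bounds[OF x t f B j i, where w="?w" and A="?A", OF _ w0 osc key]
  show "\<bar>partial j (PS t f) x\<bar> \<le> 64 * ?A * moment_const / sqrt (t * (t + x $ i))"
    by (rule r(1))
  show "\<bar>partial j (partial j (PS t f)) x\<bar> \<le> 64 * ?A * moment_const / (t * (t + x $ i))"
    by (rule r(2))
qed

section \<open>Improving the modulus of oscillation by iteration\<close>

context
  fixes \<beta> N K :: real
  assumes \<beta>: "0 < \<beta>" "\<beta> < 1 / 2" and K: "1 \<le> K" "256 * moment_const * K powr (\<beta> - 1 / 2) \<le> 1"
    and N: "\<And>s y. 0 < s \<Longrightarrow> y \<in> S \<Longrightarrow> \<bar>PS s f y - f y\<bar> \<le> N * s powr \<beta>"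
begin

text \<open>
  The term \<open>\<epsilon>\<close> makes the estimate available at all, with \<open>D = 2 B / \<epsilon>\<close>, before it is
  iterated.
\<close>

lemma oscillation_improve:
  assumes D: "0 \<le> D" and \<epsilon>: "0 \<le> \<epsilon>"
    and osc: "\<And>y h. y \<in> S \<Longrightarrow> \<bar>f (y + h *\<^sub>R axis j 1) - f y\<bar> \<le> D * (time_scale \<bar>h\<bar> (y $ i) powr \<beta> + \<epsilon>)"
    and y: "y \<in> S"
  shows "\<bar>f (y + h *\<^sub>R axis j 1) - f y\<bar> \<le> (2 * N * K powr \<beta> + D / 2) * (time_scale \<bar>h\<bar> (y $ i) powr \<beta> + \<epsilon>)"
proof (cases "h = 0")
  case True
  have "0 \<le> N * 1 powr \<beta>" using N[OF zero_less_one y] by linarith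
  then show ?thesis using True D \<epsilon> K by simp
next
  case False
  have yi: "0 \<le> y $ i" by (rule S_nonneg[OF y cat_in_NC2[OF j i]])
  define \<sigma> where "\<sigma> = time_scale \<bar>h\<bar> (y $ i)"
  define s where "s = K * \<sigma>"
  have \<sigma>: "0 < \<sigma>" unfolding \<sigma>_def using False yi by (intro time_scale_pos) auto
  then have s: "0 < s" using K by (simp add: s_def)
  have N0: "0 \<le> N" using N[OF zero_less_one y] by simp
  define C where "C = 64 * (D * (s powr \<beta> + \<epsilon>)) * moment_const / sqrt (s * (s + y $ i))"
  let ?g = "\<lambda>r. PS s f (y + r *\<^sub>R axis j 1)"
  have "norm (?g h - ?g 0) \<le> C * norm (h - 0)"
  proof (rule field_differentiable_bound[where S=UNIV and f'="\<lambda>r. partial j (PS s f) (y + r *\<^sub>R axis j 1)"])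
    fix r :: real
    show "(?g has_field_derivative partial j (PS s f) (y + r *\<^sub>R axis j 1)) (at r within UNIV)"
      using Pt_has_derivative[OF y s f B j] partial_Pt[OF y s f B j] by simp
    \<comment> \<open>Moving along \<open>axis j 1\<close> leaves the catalyst coordinate unchanged,
      so the single constant \<open>C\<close> bounds the derivative on the whole line.\<close>
    have "i \<noteq> j" using cat_in_NC2[OF j i] NR_notin_NC2[OF j] by blast
    then have eq: "(y + r *\<^sub>R axis j 1) $ i = y $ i" by (simp add: axis_def)
    have "\<bar>partial j (PS s f) (y + r *\<^sub>R axis j 1)\<bar>
        \<le> 64 * (D * (s powr \<beta> + \<epsilon>)) * moment_const / sqrt (s * (s + (y + r *\<^sub>R axis j 1) $ i))"
      by (rule partial_Pt_le_osc(1)[OF shift_in_S[OF y j] s \<beta>(1) less_imp_le[OF \<beta>(2)] D \<epsilon> osc])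
    then show "norm (partial j (PS s f) (y + r *\<^sub>R axis j 1)) \<le> C"
      unfolding eq real_norm_def C_def .
  qed auto
  then have "\<bar>?g h - PS s f y\<bar> \<le> C * \<bar>h\<bar>" by simp
  moreover have "\<bar>?g h - f (y + h *\<^sub>R axis j 1)\<bar> \<le> N * s powr \<beta>" by (rule N[OF s shift_in_S[OF y j]])
  moreover have "\<bar>PS s f y - f y\<bar> \<le> N * s powr \<beta>" by (rule N[OF s y])
  ultimately have "\<bar>f (y + h *\<^sub>R axis j 1) - f y\<bar> \<le> 2 * (N * s powr \<beta>) + C * \<bar>h\<bar>" by linarith
  moreover have sp: "s powr \<beta> = K powr \<beta> * \<sigma> powr \<beta>" unfolding s_def by (rule powr_mult)
  moreover have "C * \<bar>h\<bar> \<le> D / 2 * (\<sigma> powr \<beta> + \<epsilon>)"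
  proof -
    have q: "0 < s * (s + y $ i)" using s yi by (intro mult_pos_pos) auto
    have "K * h\<^sup>2 \<le> 4 * (s * (s + y $ i))"
      using time_scale_inverse[of "\<bar>h\<bar>" "y $ i" K] False yi K by (simp add: s_def \<sigma>_def)
    then have "sqrt (K * h\<^sup>2) \<le> sqrt (4 * (s * (s + y $ i)))" by simp
    then have "sqrt K * \<bar>h\<bar> \<le> 2 * sqrt (s * (s + y $ i))" by (simp add: real_sqrt_mult)
    then have h: "\<bar>h\<bar> / sqrt (s * (s + y $ i)) \<le> 2 / sqrt K"
      using q K by (simp add: field_simps)
    have "s powr \<beta> + \<epsilon> \<le> K powr \<beta> * (\<sigma> powr \<beta> + \<epsilon>)"
      using \<epsilon> K \<beta> ge_one_powr_ge_zero[of K \<beta>] by (simp add: sp distrib_left mult_le_cancel_right1)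
    then have "64 * (D * (s powr \<beta> + \<epsilon>)) * moment_const \<le> 64 * (D * (K powr \<beta> * (\<sigma> powr \<beta> + \<epsilon>))) * moment_const"
      using D moment_const_ge by (intro mult_right_mono mult_left_mono) auto
    then have "C * \<bar>h\<bar> \<le> 64 * (D * (K powr \<beta> * (\<sigma> powr \<beta> + \<epsilon>))) * moment_const * (2 / sqrt K)"
    proof -
      assume a: "64 * (D * (s powr \<beta> + \<epsilon>)) * moment_const \<le> 64 * (D * (K powr \<beta> * (\<sigma> powr \<beta> + \<epsilon>))) * moment_const"
      have "C * \<bar>h\<bar> = 64 * (D * (s powr \<beta> + \<epsilon>)) * moment_const * (\<bar>h\<bar> / sqrt (s * (s + y $ i)))"
        by (simp add: C_def)
      also have "\<dots> \<le> 64 * (D * (K powr \<beta> * (\<sigma> powr \<beta> + \<epsilon>))) * moment_const * (2 / sqrt K)"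
        using D \<epsilon> q moment_const_ge by (intro mult_mono[OF a h]) auto
      finally show ?thesis .
    qed
    also have "\<dots> = D / 2 * (\<sigma> powr \<beta> + \<epsilon>) * (256 * moment_const * (K powr \<beta> / sqrt K))"
    proof -
      have "64 * (D * (k * z)) * m * (2 / r) = D / 2 * z * (256 * m * (k / r))" for k z m r :: real by simp
      then show ?thesis .
    qed
    \<comment> \<open>The longer waiting time costs \<open>K powr \<beta>\<close> and gains
      \<open>sqrt K\<close>; as \<open>\<beta> < 1 / 2\<close>, the net factor is small for large
      \<open>K\<close>. The 256 in the condition on \<open>K\<close> is 64 from the kernel, 2 from
      \<open>2 / sqrt K\<close> and 2 for the target \<open>D / 2\<close>.\<close>
    also have "K powr \<beta> / sqrt K = K powr (\<beta> - 1 / 2)"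
      using K by (simp add: powr_diff powr_half_sqrt)
    also have "D / 2 * (\<sigma> powr \<beta> + \<epsilon>) * (256 * moment_const * K powr (\<beta> - 1 / 2)) \<le> D / 2 * (\<sigma> powr \<beta> + \<epsilon>) * 1"
      using D \<epsilon> by (intro mult_left_mono K(2)) auto
    finally show ?thesis by simp
  qed
  ultimately have "\<bar>f (y + h *\<^sub>R axis j 1) - f y\<bar> \<le> 2 * N * K powr \<beta> * \<sigma> powr \<beta> + D / 2 * (\<sigma> powr \<beta> + \<epsilon>)"
    by simp
  also have "\<dots> \<le> 2 * N * K powr \<beta> * (\<sigma> powr \<beta> + \<epsilon>) + D / 2 * (\<sigma> powr \<beta> + \<epsilon>)"
    using N0 \<epsilon> by (intro add_right_mono mult_left_mono) auto
  finally show ?thesis by (simp only: \<sigma>_def distrib_right)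
qed

text \<open>\<open>4 * N * K powr \<beta>\<close> is the fixed point of
  \<open>D \<mapsto> 2 * N * K powr \<beta> + D / 2\<close>. Iterating halves the excess over it, so
  the crude starting value disappears in the limit for each \<open>\<epsilon>\<close>, and
  \<open>\<epsilon>\<close> may then tend to 0.\<close>

lemma oscillation_le:
  assumes y: "y \<in> S"
  shows "\<bar>f (y + h *\<^sub>R axis j 1) - f y\<bar> \<le> 4 * N * K powr \<beta> * time_scale \<bar>h\<bar> (y $ i) powr \<beta>"
proof -
  let ?A = "4 * N * K powr \<beta>"
  have A0: "0 \<le> ?A" using N[OF zero_less_one y] by simp
  have B0: "0 \<le> B" using B[OF y] by linarith
  have reg: "\<bar>f (y + h *\<^sub>R axis j 1) - f y\<bar> \<le> ?A * (time_scale \<bar>h\<bar> (y $ i) powr \<beta> + \<epsilon>)" if \<epsilon>: "0 < \<epsilon>" for \<epsilon>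
  proof -
    \<comment> \<open>The induction runs over all \<open>y\<close> and \<open>h\<close> at once,
      because improving the modulus at one state uses it at all others.\<close>
    have it: "\<bar>f (y + h *\<^sub>R axis j 1) - f y\<bar> \<le> (?A + 2 * B / \<epsilon> / 2 ^ n) * (time_scale \<bar>h\<bar> (y $ i) powr \<beta> + \<epsilon>)"
      if "y \<in> S" for n y h
      using that
    proof (induction n arbitrary: y h)
      case 0
      have "\<bar>f (y + h *\<^sub>R axis j 1) - f y\<bar> \<le> 2 * B"
        using B[OF 0] B[OF shift_in_S[OF 0 j], of h] by linarith
      also have "\<dots> = 2 * B / \<epsilon> * \<epsilon>" using \<epsilon> by simp
      also have "\<dots> \<le> (?A + 2 * B / \<epsilon> / 2 ^ 0) * (time_scale \<bar>h\<bar> (y $ i) powr \<beta> + \<epsilon>)"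
        using A0 B0 \<epsilon> by (intro mult_mono) auto
      finally show ?case .
    next
      case (Suc n)
      have "\<bar>f (y + h *\<^sub>R axis j 1) - f y\<bar> \<le>
        (2 * N * K powr \<beta> + (?A + 2 * B / \<epsilon> / 2 ^ n) / 2) * (time_scale \<bar>h\<bar> (y $ i) powr \<beta> + \<epsilon>)"
        by (rule oscillation_improve[OF _ _ Suc.IH Suc.prems]) (use A0 B0 \<epsilon> in auto)
      also have "2 * N * K powr \<beta> + (?A + 2 * B / \<epsilon> / 2 ^ n) / 2 = ?A + 2 * B / \<epsilon> / 2 ^ Suc n"
        by (simp add: field_simps)
      finally show ?case .
    qed
    have "(\<lambda>n. (?A + 2 * B / \<epsilon> / 2 ^ n) * (time_scale \<bar>h\<bar> (y $ i) powr \<beta> + \<epsilon>))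
      \<longlonglongrightarrow> (?A + 0) * (time_scale \<bar>h\<bar> (y $ i) powr \<beta> + \<epsilon>)"
      by (intro tendsto_intros LIMSEQ_divide_realpow_zero) auto
    then have "\<bar>f (y + h *\<^sub>R axis j 1) - f y\<bar> \<le> (?A + 0) * (time_scale \<bar>h\<bar> (y $ i) powr \<beta> + \<epsilon>)"
      by (rule LIMSEQ_le_const) (use it[OF y] in blast)
    then show ?thesis by simp
  qed
  have "((\<lambda>\<epsilon>. ?A * (time_scale \<bar>h\<bar> (y $ i) powr \<beta> + \<epsilon>)) \<longlongrightarrow> ?A * (time_scale \<bar>h\<bar> (y $ i) powr \<beta> + 0)) (at_right 0)"
    by (intro tendsto_intros)
  then have "\<bar>f (y + h *\<^sub>R axis j 1) - f y\<bar> \<le> ?A * (time_scale \<bar>h\<bar> (y $ i) powr \<beta> + 0)"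
    by (rule tendsto_lowerbound) (use reg in \<open>auto simp: eventually_at_right_less intro: eventually_mono[OF eventually_at_right_less]\<close>)
  then show ?thesis by simp
qed

lemma partial_Pt_le_seminorm:
  assumes x: "x \<in> S" and t: "0 < t"
  shows "\<bar>partial j (PS t f) x\<bar> \<le> 256 * moment_const * K powr \<beta> * N * t powr \<beta> / sqrt (t * (t + x $ i))"
    and "\<bar>partial j (partial j (PS t f)) x\<bar> \<le> 256 * moment_const * K powr \<beta> * N * t powr \<beta> / (t * (t + x $ i))"
proof -
  have N0: "0 \<le> 4 * N * K powr \<beta>" using N[OF zero_less_one x] by simp
  have osc: "\<bar>f (y + h *\<^sub>R axis j 1) - f y\<bar> \<le> 4 * N * K powr \<beta> * (time_scale \<bar>h\<bar> (y $ i) powr \<beta> + 0)" if "y \<in> S" for y h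
    using oscillation_le[OF that] by simp
  note * = partial_Pt_le_osc[OF x t \<beta>(1) less_imp_le[OF \<beta>(2)] N0 order.refl osc]
  show "\<bar>partial j (PS t f) x\<bar> \<le> 256 * moment_const * K powr \<beta> * N * t powr \<beta> / sqrt (t * (t + x $ i))"
    "\<bar>partial j (partial j (PS t f)) x\<bar> \<le> 256 * moment_const * K powr \<beta> * N * t powr \<beta> / (t * (t + x $ i))"
    using * by (simp_all add: mult_ac)
qed

end
end

section \<open>Passage to the maximum over the catalysts\<close>

lemma Max_sqrt_obtain:
  assumes "j \<in> R0"
  obtains i where "i \<in> cat_of E j" "Max ((\<lambda>i. sqrt (t + x $ i)) ` cat_of E j) = sqrt (t + x $ i)"
proof -
  have "Max ((\<lambda>i. sqrt (t + x $ i)) ` cat_of E j) \<in> (\<lambda>i. sqrt (t + x $ i)) ` cat_of E j"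
    using cat_nonempty[OF assms] by (intro Max_in) auto
  then show ?thesis using that by (elim imageE) simp
qed

lemma Max_obtain:
  assumes "j \<in> R0"
  obtains i where "i \<in> cat_of E j" "Max ((\<lambda>i. x $ i) ` cat_of E j) = x $ i"
proof -
  have "Max ((\<lambda>i. x $ i) ` cat_of E j) \<in> (\<lambda>i. x $ i) ` cat_of E j"
    using cat_nonempty[OF assms] by (intro Max_in) auto
  then show ?thesis using that by (elim imageE) simp
qed

text \<open>The weight cancels one factor of the denominator, since
  \<open>X \<le> t + X\<close>.\<close>

lemma weighted_second_le:
  fixes X D2 C t :: real
  assumes "\<bar>D2\<bar> \<le> C / (t * (t + X))" "0 < t" "0 \<le> X" "0 \<le> C"
  shows "\<bar>X * D2\<bar> \<le> C / t"
proof -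
  have "\<bar>X * D2\<bar> = X * \<bar>D2\<bar>" using assms(3) by (simp add: abs_mult)
  also have "\<dots> \<le> X * (C / (t * (t + X)))" by (rule mult_left_mono[OF assms(1,3)])
  also have "\<dots> \<le> (t + X) * (C / (t * (t + X)))"
    using assms by (intro mult_right_mono) auto
  also have "\<dots> = C / t" using assms add_pos_nonneg[of t X] by simp
  finally show ?thesis .
qed

lemma bounded_estimates:
  assumes x: "x \<in> S" and t: "0 < t" and j: "j \<in> R0" and c: "128 * moment_const \<le> c"
    and f: "f \<in> borel_measurable (restrict_space borel S)" and bd: "bounded (f ` S)"
  shows "partial_differentiable j (PS t f) x \<and>
        \<bar>partial j (PS t f) x\<bar>
          \<le> c * enn2real (sup_norm S f) / (sqrt t * Max ((\<lambda>i. sqrt (t + x $ i)) ` cat_of E j)) \<and>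
        partial_differentiable j (partial j (PS t f)) x \<and>
        \<bar>Max ((\<lambda>i. x $ i) ` cat_of E j) * partial j (partial j (PS t f)) x\<bar>
          \<le> c * enn2real (sup_norm S f) / t"
proof -
  define B where "B = enn2real (sup_norm S f)"
  have B: "\<bar>f y\<bar> \<le> B" if "y \<in> S" for y
    unfolding B_def by (rule sup_norm_upper[OF sup_norm_finite[OF bd] that])
  have B0: "0 \<le> B" by (simp add: B_def)
  have cB: "128 * B * moment_const \<le> c * B" using mult_right_mono[OF c B0] by (simp add: mult_ac)
  \<comment> \<open>The two maxima get their own maximisers \<open>i\<close> and \<open>k\<close>;
    since the bounds hold for every catalyst of \<open>j\<close>, these need not be matched.\<close>
  obtain i where i: "i \<in> cat_of E j" "Max ((\<lambda>i. sqrt (t + x $ i)) ` cat_of E j) = sqrt (t + x $ i)"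
    by (rule Max_sqrt_obtain[OF j])
  obtain k where k: "k \<in> cat_of E j" "Max ((\<lambda>i. x $ i) ` cat_of E j) = x $ k"
    by (rule Max_obtain[OF j])
  have nn: "0 \<le> x $ i" "0 \<le> x $ k" using S_nonneg[OF x cat_in_NC2[OF j]] i k by auto
  have "\<bar>partial j (PS t f) x\<bar> \<le> 128 * B * moment_const / sqrt (t * (t + x $ i))"
    by (rule partial_Pt_le_sup(1)[OF f B j i(1) x t])
  also have "\<dots> \<le> c * B / sqrt (t * (t + x $ i))"
    using t nn by (intro divide_right_mono cB) simp
  finally have 1: "\<bar>partial j (PS t f) x\<bar> \<le> c * B / (sqrt t * sqrt (t + x $ i))"
    by (simp add: real_sqrt_mult)
  have "\<bar>x $ k * partial j (partial j (PS t f)) x\<bar> \<le> 128 * B * moment_const / t"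
    using moment_const_ge B0 by (intro weighted_second_le[OF partial_Pt_le_sup(2)[OF f B j k(1) x t] t nn(2)]) auto
  also have "\<dots> \<le> c * B / t" using t by (intro divide_right_mono cB) simp
  finally have 2: "\<bar>x $ k * partial j (partial j (PS t f)) x\<bar> \<le> c * B / t" .
  show ?thesis
    using partial_differentiable_Pt[OF x t f B j] 1 2 unfolding i(2) k(2) B_def by blast
qed

lemma Hoelder_estimates:
  assumes x: "x \<in> S" and t: "0 < t" and j: "j \<in> R0"
    and \<alpha>: "0 < \<alpha>" "\<alpha> < 1" and K: "1 \<le> K" "256 * moment_const * K powr (\<alpha> / 2 - 1 / 2) \<le> 1"
    and c: "c = 256 * moment_const * K powr (\<alpha> / 2)"
    and fS: "f \<in> Salpha E x0 b \<gamma> P \<alpha>"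
  shows "partial_differentiable j (PS t f) x \<and>
        \<bar>partial j (PS t f) x\<bar>
          \<le> c * enn2real (alpha_seminorm E x0 b \<gamma> P \<alpha> f) * t powr (\<alpha> / 2 - 1 / 2) /
             Max ((\<lambda>i. sqrt (t + x $ i)) ` cat_of E j) \<and>
        c * enn2real (alpha_seminorm E x0 b \<gamma> P \<alpha> f) * t powr (\<alpha> / 2 - 1 / 2) /
             Max ((\<lambda>i. sqrt (t + x $ i)) ` cat_of E j)
          \<le> c * enn2real (alpha_seminorm E x0 b \<gamma> P \<alpha> f) * t powr (\<alpha> / 2 - 1) \<and>
        partial_differentiable j (partial j (PS t f)) x \<and>
        \<bar>Max ((\<lambda>i. x $ i) ` cat_of E j) * partial j (partial j (PS t f)) x\<bar>
          \<le> c * enn2real (alpha_seminorm E x0 b \<gamma> P \<alpha> f) * t powr (\<alpha> / 2 - 1)"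
proof -
  define N where "N = enn2real (alpha_seminorm E x0 b \<gamma> P \<alpha> f)"
  define B where "B = enn2real (sup_norm S f)"
  have f: "f \<in> borel_measurable (restrict_space borel S)"
    and fin: "alpha_seminorm E x0 b \<gamma> P \<alpha> f < \<infinity>" "sup_norm S f < \<infinity>"
    using fS by (auto simp: Salpha_def alpha_norm_def)
  have B: "\<bar>f y\<bar> \<le> B" if "y \<in> S" for y
    unfolding B_def by (rule sup_norm_upper[OF fin(2) that])
  have N: "\<bar>PS s f y - f y\<bar> \<le> N * s powr (\<alpha> / 2)" if "0 < s" "y \<in> S" for s y
    unfolding N_def by (rule alpha_seminorm_upper[OF fin(1) that])
  have cN: "0 \<le> c * N" unfolding c N_def using moment_const_ge by simp
  have \<beta>: "0 < \<alpha> / 2" "\<alpha> / 2 < 1 / 2" using \<alpha> by auto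
  obtain i where i: "i \<in> cat_of E j" "Max ((\<lambda>i. sqrt (t + x $ i)) ` cat_of E j) = sqrt (t + x $ i)"
    by (rule Max_sqrt_obtain[OF j])
  obtain k where k: "k \<in> cat_of E j" "Max ((\<lambda>i. x $ i) ` cat_of E j) = x $ k"
    by (rule Max_obtain[OF j])
  have nn: "0 \<le> x $ i" "0 \<le> x $ k" using S_nonneg[OF x cat_in_NC2[OF j]] i k by auto
  have p: "t powr (\<alpha> / 2) / sqrt t = t powr (\<alpha> / 2 - 1 / 2)" "t powr (\<alpha> / 2 - 1 / 2) / sqrt t = t powr (\<alpha> / 2 - 1)"
    "t powr (\<alpha> / 2) / t = t powr (\<alpha> / 2 - 1)"
  proof -
    show "t powr (\<alpha> / 2) / sqrt t = t powr (\<alpha> / 2 - 1 / 2)"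
      using t by (simp only: powr_diff powr_half_sqrt less_imp_le)
    have "t powr (\<alpha> / 2 - 1 / 2) / sqrt t = t powr (\<alpha> / 2 - 1 / 2 - 1 / 2)"
      using t by (simp only: powr_diff powr_half_sqrt less_imp_le)
    then show "t powr (\<alpha> / 2 - 1 / 2) / sqrt t = t powr (\<alpha> / 2 - 1)" by simp
    show "t powr (\<alpha> / 2) / t = t powr (\<alpha> / 2 - 1)" using t by (simp add: powr_diff)
  qed
  have "\<bar>partial j (PS t f) x\<bar> \<le> c * N * t powr (\<alpha> / 2) / sqrt (t * (t + x $ i))"
    unfolding c by (rule partial_Pt_le_seminorm(1)[OF f B j i(1) \<beta> K N x t])
  also have "\<dots> = c * N * (t powr (\<alpha> / 2) / sqrt t) / sqrt (t + x $ i)"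
    by (simp add: real_sqrt_mult)
  finally have 1: "\<bar>partial j (PS t f) x\<bar> \<le> c * N * t powr (\<alpha> / 2 - 1 / 2) / sqrt (t + x $ i)"
    unfolding p(1) .
  have "c * N * t powr (\<alpha> / 2 - 1 / 2) / sqrt (t + x $ i) \<le> c * N * t powr (\<alpha> / 2 - 1 / 2) / sqrt t"
    using t nn cN by (intro divide_left_mono mult_pos_pos) auto
  also have "\<dots> = c * N * (t powr (\<alpha> / 2 - 1 / 2) / sqrt t)" by simp
  finally have 2: "c * N * t powr (\<alpha> / 2 - 1 / 2) / sqrt (t + x $ i) \<le> c * N * t powr (\<alpha> / 2 - 1)"
    unfolding p(2) .
  have "\<bar>partial j (partial j (PS t f)) x\<bar> \<le> c * N * t powr (\<alpha> / 2) / (t * (t + x $ k))"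
    unfolding c by (rule partial_Pt_le_seminorm(2)[OF f B j k(1) \<beta> K N x t])
  then have "\<bar>x $ k * partial j (partial j (PS t f)) x\<bar> \<le> c * N * t powr (\<alpha> / 2) / t"
    using cN by (intro weighted_second_le[OF _ t nn(2)]) auto
  also have "\<dots> = c * N * (t powr (\<alpha> / 2) / t)" by simp
  finally have 3: "\<bar>x $ k * partial j (partial j (PS t f)) x\<bar> \<le> c * N * t powr (\<alpha> / 2 - 1)"
    unfolding p(3) .
  show ?thesis
    using partial_differentiable_Pt[OF x t f B j] 1 2 3 unfolding i(2) k(2) N_def by blast
qed

end

theorem proposition2p12:
  fixes \<alpha> M :: real
  assumes "0 < \<alpha>" and "\<alpha> < 1"
  shows "\<exists>c>0. \<forall>(E :: ('v::finite \<times> 'v) set) x0 b \<gamma> P.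
    network E \<and> x0 \<in> net_states E \<and> admissible_coeffs E x0 b \<gamma> \<and> coeff_bound E x0 b \<gamma> \<le> M \<and>
    (\<forall>i\<in>NC2 E x0. \<forall>y\<ge>0. feller_law (b i) (\<gamma> i) y (P i y)) \<longrightarrow>
    (\<forall>t>0. \<forall>x\<in>S0 E x0. \<forall>f. \<forall>j\<in>NR E x0.
      (f \<in> borel_measurable (restrict_space borel (S0 E x0)) \<and> bounded (f ` S0 E x0) \<longrightarrow>
        partial_differentiable j (Pt E x0 b \<gamma> P t f) x \<and>
        \<bar>partial j (Pt E x0 b \<gamma> P t f) x\<bar>
          \<le> c * enn2real (sup_norm (S0 E x0) f) /
             (sqrt t * Max ((\<lambda>i. sqrt (t + x $ i)) ` cat_of E j)) \<and>
        partial_differentiable j (partial j (Pt E x0 b \<gamma> P t f)) x \<and>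
        \<bar>Max ((\<lambda>i. x $ i) ` cat_of E j) * partial j (partial j (Pt E x0 b \<gamma> P t f)) x\<bar>
          \<le> c * enn2real (sup_norm (S0 E x0) f) / t) \<and>
      (f \<in> Salpha E x0 b \<gamma> P \<alpha> \<longrightarrow>
        partial_differentiable j (Pt E x0 b \<gamma> P t f) x \<and>
        \<bar>partial j (Pt E x0 b \<gamma> P t f) x\<bar>
          \<le> c * enn2real (alpha_seminorm E x0 b \<gamma> P \<alpha> f) * t powr (\<alpha> / 2 - 1 / 2) /
             Max ((\<lambda>i. sqrt (t + x $ i)) ` cat_of E j) \<and>
        c * enn2real (alpha_seminorm E x0 b \<gamma> P \<alpha> f) * t powr (\<alpha> / 2 - 1 / 2) /
             Max ((\<lambda>i. sqrt (t + x $ i)) ` cat_of E j)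
          \<le> c * enn2real (alpha_seminorm E x0 b \<gamma> P \<alpha> f) * t powr (\<alpha> / 2 - 1) \<and>
        partial_differentiable j (partial j (Pt E x0 b \<gamma> P t f)) x \<and>
        \<bar>Max ((\<lambda>i. x $ i) ` cat_of E j) * partial j (partial j (Pt E x0 b \<gamma> P t f)) x\<bar>
          \<le> c * enn2real (alpha_seminorm E x0 b \<gamma> P \<alpha> f) * t powr (\<alpha> / 2 - 1)))"
proof -
  \<comment> \<open>The constants have to be fixed before any network is given.
    \<open>M_ge_1\<close> excludes networks with a bound below 1, but positivity of \<open>c\<close>
    is claimed for every \<open>M\<close>, hence the maximum with 1.\<close>
  define M' where "M' = max M 1"
  define m where "m = 5 + 6 * M' ^ 4 + 576 * M'"
  \<comment> \<open>Chosen so that \<open>256 * m * K powr (\<alpha> / 2 - 1 / 2)\<close> is exactly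
    1; the exponent is finite because \<open>\<alpha> < 1\<close>.\<close>
  define K where "K = (256 * m) powr (1 / (1 / 2 - \<alpha> / 2))"
  define c where "c = 256 * m * K powr (\<alpha> / 2)"
  have "1 \<le> M'" by (simp add: M'_def)
  then have m: "5 \<le> m" by (simp add: m_def)
  have K1: "1 \<le> K" unfolding K_def using m assms by (intro ge_one_powr_ge_zero) auto
  have "K powr (\<alpha> / 2 - 1 / 2) = (256 * m) powr (- 1)"
  proof -
    have "1 / d * (- d) = - 1" if "d \<noteq> 0" for d :: real using that by simp
    from this[of "1 / 2 - \<alpha> / 2"] have "1 / (1 / 2 - \<alpha> / 2) * (\<alpha> / 2 - 1 / 2) = - 1"
      using assms by (simp only: minus_diff_eq)
    then show ?thesis unfolding K_def powr_powr by (simp only:)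
  qed
  also have "\<dots> = 1 / (256 * m)" using m by (simp add: powr_minus_divide)
  finally have K2: "256 * m * K powr (\<alpha> / 2 - 1 / 2) \<le> 1" using m by simp
  have "1 \<le> K powr (\<alpha> / 2)" using K1 assms by (intro ge_one_powr_ge_zero) auto
  \<comment> \<open>As \<open>K \<ge> 1\<close>, the constant of the seminorm estimates also serves
    those by the supremum norm, which ask for \<open>128 * m\<close>.\<close>
  then have "256 * m * 1 \<le> c" unfolding c_def using m by (intro mult_left_mono) auto
  then have c: "0 < c" "128 * m \<le> c" using m by auto
  show ?thesis
  proof (intro exI[of _ c] conjI[OF c(1)] allI impI ballI, goal_cases)
    case (1 E x0 b \<gamma> P t x f j)
    interpret catalytic E x0 b \<gamma> P M'
      by standard (use 1(1) in \<open>auto simp: M'_def\<close>)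
    have mc: "m = moment_const" by (simp add: moment_const_def m_def)
    show ?case
      by (rule conjI[OF impI impI], elim conjE, rule bounded_estimates[OF 1(3,2,4) c(2)[unfolded mc]])
         (assumption | rule Hoelder_estimates[OF 1(3,2,4) assms K1 K2[unfolded mc] c_def[unfolded mc]])+
  qed
qed

end
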